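(* Let $f$ be a density function on $\mathbb{R}$ with distribution function $F$, having exactly $k$ local extreme values, taken at the points $t_1^e<\dots<t_k^e$, and suppose that $$\inf_{G}\ \sup_{x\in\mathbb{R}}|F(x)-G(x)|>0,$$ where the infimum is over all distribution functions $G$ possessing a density $g$ with at most $k-1$ local extreme values. Let $X_1,X_2,\dots$ be i.i.d. with common distribution $F$, and for $C>0$ and $n\ge 1$ let $k_n^C$, $I_i^e(n,C)$ and $t_i^e(n,C)$ be the number of local extremes, the local extreme intervals and their midpoints for the derivative $s_n^C$ of the taut string $S_n^C$ through the tube $T(F_n,C/\sqrt n)$ (defined in the context). Then for all $\delta>0$, $$\lim_{C\to\infty}\liminf_{n\to\infty}\mathbb{P}\Big(\{k_n^C=k\}\cap\Big\{\max_{1\le i\le k_n^C}|I_i^e(n,C)|\le\delta\Big\}\cap\Big\{\max_{1\le i\le k_n^C}|t_i^e(n,C)-t_i^e|\le\delta\Big\}\Big)=1.$$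
   Context: $F_n$ denotes the empirical distribution function of $X_1,\dots,X_n$, with order statistics $X_{(1)}\le\dots\le X_{(n)}$. For $\varepsilon>0$, the Kolmogorov tube is $T(F_n,\varepsilon)=\{G: G \text{ monotone},\ \sup_x|G(x)-F_n(x)|\le\varepsilon\}$. The taut string through $T(F_n,\varepsilon)$ is the function on $[X_{(1)},X_{(n)}]$ whose graph is the shortest curve (a string pulled taut) joining $(X_{(1)},0)$ to $(X_{(n)},1)$ and constrained to lie between the lower boundary $F_n-\varepsilon$ and the upper boundary $F_n+\varepsilon$. It is increasing and piecewise linear; its knots are the points at which it touches the lower or upper boundary. $S_n^C$ is the taut string for $\varepsilon=C/\sqrt n$, and $s_n^C$ is its derivative (left-hand derivative, except at $X_{(1)}$ where the right-hand derivative is used), a piecewise constant function. $k_n^C$ is the number of local extreme values (local maxima and minima) of $s_n^C$; $I_1^e(n,C),\dots,I_{k_n^C}^e(n,C)$ are, from left to right, the intervals (between knots) on which $s_n^C$ attains its local extreme values; $t_i^e(n,C)$ is the midpoint of $I_i^e(n,C)$; $|I|$ is the length of an interval $I$.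
   Formalization: The densities f and g are taken in versions whose value at each point lies between the lower and upper limits there and which are monotone on intervals containing no local extreme; without this, extremes that are approached but not attained make the claim false or vacuous. *)

theory Defs
  imports "HOL-Probability.Probability"
begin

section \<open>Local extreme values\<close>

text \<open>
  A local maximum may be attained on a plateau, so it is represented by the whole interval \<open>I\<close> on
  which it is attained; \<open>I\<close> is a singleton for a maximum attained at a point.  The strict inequality
  makes \<open>I\<close> a maximal interval of constancy.  Since \<open>I\<close> is bounded, the tails on which a
  density with bounded support vanishes are not local minima.
\<close>

definition local_max_interval :: "(real \<Rightarrow> real) \<Rightarrow> real set \<Rightarrow> bool" where
  "local_max_interval h I \<longleftrightarrow>
     is_interval I \<and> I \<noteq> {} \<and> bounded I \<and>
     (\<exists>c. (\<forall>x\<in>I. h x = c) \<and>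
          (\<exists>e>0. \<forall>x. x \<notin> I \<and> (\<exists>y\<in>I. \<bar>x - y\<bar> < e) \<longrightarrow> h x < c))"

definition local_min_interval :: "(real \<Rightarrow> real) \<Rightarrow> real set \<Rightarrow> bool" where
  "local_min_interval h I \<longleftrightarrow>
     is_interval I \<and> I \<noteq> {} \<and> bounded I \<and>
     (\<exists>c. (\<forall>x\<in>I. h x = c) \<and>
          (\<exists>e>0. \<forall>x. x \<notin> I \<and> (\<exists>y\<in>I. \<bar>x - y\<bar> < e) \<longrightarrow> c < h x))"

definition local_extreme_intervals :: "(real \<Rightarrow> real) \<Rightarrow> real set set" where
  "local_extreme_intervals h = {I. local_max_interval h I \<or> local_min_interval h I}"

text \<open>
  Densities need not be continuous and are determined only up to null sets.  Counting the local
  extreme values of a density is meaningful for versions satisfying the following convention.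
  The first clause excludes isolated values (such as a spike at a single point), which are artefacts
  of the choice of the version.  The second says that extremes are attained: where there is no local
  extreme, the function is monotone.  It excludes, for instance, a jump at which a local maximum or
  minimum is approached but not taken as a value; with such jumps every distribution function could
  be approximated by ones with a density attaining no local extreme value at all.
\<close>

definition regular_extremes :: "(real \<Rightarrow> real) \<Rightarrow> bool" where
  "regular_extremes h \<longleftrightarrow>
     (\<forall>x. Liminf (at x) (\<lambda>y. ereal (h y)) \<le> ereal (h x) \<and>
          ereal (h x) \<le> Limsup (at x) (\<lambda>y. ereal (h y))) \<and>
     (\<forall>a b. (\<forall>I\<in>local_extreme_intervals h. \<not> I \<subseteq> {a<..<b}) \<longrightarrow>
          mono_on {a..b} h \<or> antimono_on {a..b} h)"

definition has_local_extremes_at :: "(real \<Rightarrow> real) \<Rightarrow> nat \<Rightarrow> (nat \<Rightarrow> real) \<Rightarrow> bool" where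
  "has_local_extremes_at h k t \<longleftrightarrow>
     regular_extremes h \<and> strict_mono_on {1..k} t \<and>
     local_extreme_intervals h = (\<lambda>i. {t i}) ` {1..k}"

definition fewer_local_extremes_than :: "(real \<Rightarrow> real) \<Rightarrow> nat \<Rightarrow> bool" where
  "fewer_local_extremes_than h k \<longleftrightarrow>
     regular_extremes h \<and>
     finite (local_extreme_intervals h) \<and> card (local_extreme_intervals h) < k"

definition interval_length :: "real set \<Rightarrow> real" where
  "interval_length I = Sup I - Inf I"

definition midpoint_of :: "real set \<Rightarrow> real" where
  "midpoint_of I = (Inf I + Sup I) / 2"

text \<open>The \<open>i\<close>-th local extreme interval from the left, for \<open>i \<ge> 1\<close>.\<close>

definition nth_extreme_interval :: "(real \<Rightarrow> real) \<Rightarrow> nat \<Rightarrow> real set" where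
  "nth_extreme_interval h i =
     (THE I. I \<in> local_extreme_intervals h \<and>
             card {J \<in> local_extreme_intervals h. midpoint_of J \<le> midpoint_of I} = i)"


section \<open>Densities and distribution functions\<close>

definition is_density :: "(real \<Rightarrow> real) \<Rightarrow> bool" where
  "is_density f \<longleftrightarrow>
     f \<in> borel_measurable borel \<and> (\<forall>x. 0 \<le> f x) \<and> (\<integral>\<^sup>+x. ennreal (f x) \<partial>lborel) = 1"

definition density_cdf :: "(real \<Rightarrow> real) \<Rightarrow> real \<Rightarrow> real" where
  "density_cdf f = cdf (density lborel (\<lambda>x. ennreal (f x)))"

text \<open>The sample is \<open>x 0, \<dots>, x (n - 1)\<close>.\<close>

definition emp_cdf :: "nat \<Rightarrow> (nat \<Rightarrow> real) \<Rightarrow> real \<Rightarrow> real" where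
  "emp_cdf n x y = real (card {i. i < n \<and> x i \<le> y}) / real n"


section \<open>The taut string\<close>

definition curve_length :: "(real \<Rightarrow> 'a::metric_space) \<Rightarrow> ereal" where
  "curve_length \<gamma> =
     (SUP ts \<in> {ts. sorted ts \<and> set ts \<subseteq> {0..1}}.
        ereal (\<Sum>i<length ts - 1. dist (\<gamma> (ts ! i)) (\<gamma> (ts ! Suc i))))"

definition tube_curve ::
  "(real \<Rightarrow> real) \<Rightarrow> (real \<Rightarrow> real) \<Rightarrow> real \<times> real \<Rightarrow> real \<times> real \<Rightarrow> (real \<Rightarrow> real \<times> real) \<Rightarrow> bool" where
  "tube_curve l u p q \<gamma> \<longleftrightarrow>
     path \<gamma> \<and> pathstart \<gamma> = p \<and> pathfinish \<gamma> = q \<and>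
     path_image \<gamma> \<subseteq> {(x, y). fst p \<le> x \<and> x \<le> fst q \<and> l x \<le> y \<and> y \<le> u x}"

definition graph_curve :: "real \<Rightarrow> real \<Rightarrow> (real \<Rightarrow> real) \<Rightarrow> real \<Rightarrow> real \<times> real" where
  "graph_curve a b S = (\<lambda>r. (linepath a b r, S (linepath a b r)))"

definition is_taut_string ::
  "(real \<Rightarrow> real) \<Rightarrow> (real \<Rightarrow> real) \<Rightarrow> real \<times> real \<Rightarrow> real \<times> real \<Rightarrow> (real \<Rightarrow> real) \<Rightarrow> bool" where
  "is_taut_string l u p q S \<longleftrightarrow>
     tube_curve l u p q (graph_curve (fst p) (fst q) S) \<and>
     (\<forall>\<gamma>. tube_curve l u p q \<gamma> \<longrightarrow>
          curve_length (graph_curve (fst p) (fst q) S) \<le> curve_length \<gamma>)"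

abbreviation sample_min :: "nat \<Rightarrow> (nat \<Rightarrow> real) \<Rightarrow> real" where
  "sample_min n x \<equiv> Min (x ` {..<n})"

abbreviation sample_max :: "nat \<Rightarrow> (nat \<Rightarrow> real) \<Rightarrow> real" where
  "sample_max n x \<equiv> Max (x ` {..<n})"

abbreviation is_emp_taut_string ::
  "real \<Rightarrow> nat \<Rightarrow> (nat \<Rightarrow> real) \<Rightarrow> (real \<Rightarrow> real) \<Rightarrow> bool" where
  "is_emp_taut_string \<epsilon> n x S \<equiv>
     is_taut_string (\<lambda>y. emp_cdf n x y - \<epsilon>) (\<lambda>y. emp_cdf n x y + \<epsilon>)
       (sample_min n x, 0) (sample_max n x, 1) S"

text \<open>
  Only the values on \<open>[X\<^sub>(\<^sub>1\<^sub>), X\<^sub>(\<^sub>n\<^sub>)]\<close> matter, and there the string is unique when it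
  exists.  The value 0 is used when there is no string, e.g. because the end points are outside the
  tube; for a sample without ties and \<open>\<epsilon> = C / sqrt n\<close> this happens only for small \<open>n\<close>.
\<close>

definition emp_taut_string :: "real \<Rightarrow> nat \<Rightarrow> (nat \<Rightarrow> real) \<Rightarrow> real \<Rightarrow> real" where
  "emp_taut_string \<epsilon> n x =
     (if \<exists>S. is_emp_taut_string \<epsilon> n x S then SOME S. is_emp_taut_string \<epsilon> n x S else (\<lambda>_. 0))"

text \<open>
  The derivative is extended by 0 to a density on the real line.  Hence its first and last pieces
  are local maxima if they exceed their inner neighbour, and never local minima.
\<close>

definition string_deriv :: "real \<Rightarrow> nat \<Rightarrow> (nat \<Rightarrow> real) \<Rightarrow> real \<Rightarrow> real" where
  "string_deriv C n x y =
     (let S = emp_taut_string (C / sqrt (real n)) n x in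
      if y = sample_min n x then vector_derivative S (at_right y)
      else if sample_min n x < y \<and> y \<le> sample_max n x then vector_derivative S (at_left y)
      else 0)"

definition num_extremes :: "real \<Rightarrow> nat \<Rightarrow> (nat \<Rightarrow> real) \<Rightarrow> nat" where
  "num_extremes C n x = card (local_extreme_intervals (string_deriv C n x))"

definition extreme_interval :: "real \<Rightarrow> nat \<Rightarrow> (nat \<Rightarrow> real) \<Rightarrow> nat \<Rightarrow> real set" where
  "extreme_interval C n x i = nth_extreme_interval (string_deriv C n x) i"

definition extreme_midpoint :: "real \<Rightarrow> nat \<Rightarrow> (nat \<Rightarrow> real) \<Rightarrow> nat \<Rightarrow> real" where
  "extreme_midpoint C n x i = midpoint_of (extreme_interval C n x i)"

end

theory Submission
  imports Defs
begin

text \<open>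
  A taut string turns to the left only where it touches the upper boundary of the tube and to the right only
  where it touches the lower one, since otherwise it could be shortened.  Over an interval on which its
  slope is a local maximum it therefore rises by at most as much as any function in the tube with
  the same end points, and similarly for minima.  If the tube has twice the width needed to contain \<open>F\<close>,
  then \<open>F\<close> conditioned on the range of the sample is such a function; so the density \<open>f\<close> oscillates
  at least as often as the slope of the string, which gives \<open>k\<^sub>n \<le> k\<close>.  Conversely the
  string converges uniformly to \<open>F\<close>, and near each strict extreme of \<open>f\<close> the average slopes of \<open>F\<close> over
  three adjacent intervals are not monotone, which forces an extreme of the slope of the string there; this gives
  \<open>k\<^sub>n \<ge> k\<close> and locates the extremes.  That \<open>F\<close> lies in a tube of width \<open>D / sqrt n\<close> with
  probability at least \<open>1 - 8 / D\<^sup>2\<close> follows from Kolmogorov's maximal inequality.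
\<close>

section \<open>Local extremes\<close>

text \<open>The string runs from height 0 to height 1 over the range of the sample, and
  \<open>F\<close> does not. Normalising \<open>F\<close> to these end values moves it by at most
  the deviation \<open>d\<close> of the sample from \<open>F\<close>, which is why the tube needs
  \<open>2 * d\<close>, that is \<open>D = C / 2\<close>. The normalisation also rescales slopes,
  but by one common factor, which affects neither their order nor the number of their alternations.
  Two obstacles shape the rest. The string is a shortest curve among all curves in a tube with
  jumping boundaries, and these may even run backwards; before its slopes can be handled, it has to
  be identified with a minimiser over finitely many heights, one for each distinct observation. And
  containing a likely event bounds the \<open>measure\<close> of the event in question from below
  only once that event is known to be measurable, so the minimiser must be described by countable
  operations on the sample. Densities and step functions share the property of being monotone on
  intervals whose interior contains no extreme. \<open>monotone_off_extremes\<close> isolates it, so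
  that one theory of extremes serves both.\<close>

definition monotone_off_extremes :: "(real \<Rightarrow> real) \<Rightarrow> bool" where
  "monotone_off_extremes h \<longleftrightarrow>
     (\<forall>a b. (\<forall>I\<in>local_extreme_intervals h. \<not> I \<subseteq> {a<..<b}) \<longrightarrow>
          mono_on {a..b} h \<or> antimono_on {a..b} h)"

lemma monotone_off_extremesD:
  assumes "monotone_off_extremes h" "\<And>I. I \<in> local_extreme_intervals h \<Longrightarrow> \<not> I \<subseteq> {a<..<b}"
  shows "mono_on {a..b} h \<or> antimono_on {a..b} h"
  using assms unfolding monotone_off_extremes_def by blast

lemma mono_on_IccD:
  fixes h :: "real \<Rightarrow> real"
  shows "mono_on {a..b} h \<Longrightarrow> a \<le> x \<Longrightarrow> x \<le> y \<Longrightarrow> y \<le> b \<Longrightarrow> h x \<le> h y"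
  by (auto simp: monotone_on_def)

lemma antimono_on_IccD:
  fixes h :: "real \<Rightarrow> real"
  shows "antimono_on {a..b} h \<Longrightarrow> a \<le> x \<Longrightarrow> x \<le> y \<Longrightarrow> y \<le> b \<Longrightarrow> h y \<le> h x"
  by (auto simp: monotone_on_def)

section \<open>Symmetry of maxima and minima under negation\<close>

lemma local_max_interval_uminus: "local_max_interval (\<lambda>x. - h x) I \<longleftrightarrow> local_min_interval h I"
proof -
  have "(\<exists>c. (\<forall>x\<in>I. - h x = c) \<and> (\<exists>e>0. \<forall>x. x \<notin> I \<and> (\<exists>y\<in>I. \<bar>x - y\<bar> < e) \<longrightarrow> - h x < c)) \<longleftrightarrow>
        (\<exists>c. (\<forall>x\<in>I. h x = c) \<and> (\<exists>e>0. \<forall>x. x \<notin> I \<and> (\<exists>y\<in>I. \<bar>x - y\<bar> < e) \<longrightarrow> c < h x))"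
    (is "?A \<longleftrightarrow> ?B")
  proof
    assume ?A
    then obtain c where "(\<forall>x\<in>I. - h x = c) \<and> (\<exists>e>0. \<forall>x. x \<notin> I \<and> (\<exists>y\<in>I. \<bar>x - y\<bar> < e) \<longrightarrow> - h x < c)" ..
    then show ?B by (intro exI[of _ "- c"]) (auto simp: minus_less_iff)
  next
    assume ?B
    then obtain c where "(\<forall>x\<in>I. h x = c) \<and> (\<exists>e>0. \<forall>x. x \<notin> I \<and> (\<exists>y\<in>I. \<bar>x - y\<bar> < e) \<longrightarrow> c < h x)" ..
    then show ?A by (intro exI[of _ "- c"]) auto
  qed
  then show ?thesis
    unfolding local_max_interval_def local_min_interval_def by simp
qed

lemma local_min_interval_uminus: "local_min_interval (\<lambda>x. - h x) I \<longleftrightarrow> local_max_interval h I"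
  using local_max_interval_uminus[of "\<lambda>x. - h x" I] by simp

lemma local_extreme_intervals_uminus:
  "local_extreme_intervals (\<lambda>x. - h x) = local_extreme_intervals h"
  by (auto simp: local_extreme_intervals_def local_max_interval_uminus local_min_interval_uminus)

lemma mono_on_uminus: "mono_on A (\<lambda>x. - h x) \<longleftrightarrow> antimono_on A h" for h :: "real \<Rightarrow> real"
  unfolding monotone_on_def by auto

lemma antimono_on_uminus: "antimono_on A (\<lambda>x. - h x) \<longleftrightarrow> mono_on A h" for h :: "real \<Rightarrow> real"
  unfolding monotone_on_def by auto

lemma monotone_off_extremes_uminus:
  "monotone_off_extremes (\<lambda>x. - h x) \<longleftrightarrow> monotone_off_extremes h"
  unfolding monotone_off_extremes_def local_extreme_intervals_uminus mono_on_uminus antimono_on_uminus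
  by blast

text \<open>Walking from \<open>x\<close> to \<open>w\<close> in steps shorter than
  \<open>e\<close>, the first grid point outside \<open>J\<close> is within \<open>e\<close> of its
  predecessor, which is still in \<open>J\<close>; convexity keeps the walk in \<open>K\<close>. A
  finite walk works for open, closed and half-open \<open>J\<close> alike.\<close>

lemma interval_escape:
  fixes K J :: "real set"
  assumes "is_interval K" "x \<in> K" "x \<in> J" "w \<in> K" "w \<notin> J" "e > 0"
  shows "\<exists>y\<in>K - J. \<exists>y'\<in>J. \<bar>y - y'\<bar> < e"
proof -
  obtain N :: nat where N: "real N > \<bar>w - x\<bar> / e" using reals_Archimedean2 by blast
  with \<open>e > 0\<close> have "real N > 0" by (smt (verit) divide_nonneg_pos)
  define g where "g i = x + (real i / real N) * (w - x)" for i :: nat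
  have g0: "g 0 = x" and gN: "g N = w" using \<open>real N > 0\<close> by (auto simp: g_def)
  define i where "i = (LEAST i. g i \<notin> J)"
  have i: "g i \<notin> J" unfolding i_def by (rule LeastI[of _ N]) (simp add: gN assms)
  have iN: "i \<le> N" unfolding i_def by (rule Least_le) (simp add: gN assms)
  have "i \<noteq> 0" using i g0 assms by metis
  then have i': "g (i - 1) \<in> J" using not_less_Least[of "i - 1" "\<lambda>i. g i \<notin> J"] unfolding i_def by auto
  have "g i = (1 - real i / real N) *\<^sub>R x + (real i / real N) *\<^sub>R w"
    using \<open>real N > 0\<close> by (simp add: g_def field_simps)
  also have "\<dots> \<in> K"
    using assms(1) iN \<open>real N > 0\<close> by (intro convexD) (auto simp: is_interval_convex assms)
  finally have "g i \<in> K" .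
  have "g i - g (i - 1) = (real i - real (i - 1)) / real N * (w - x)"
    unfolding g_def by (simp add: diff_divide_distrib algebra_simps)
  also have "real i - real (i - 1) = 1" using \<open>i \<noteq> 0\<close> by simp
  finally have "\<bar>g i - g (i - 1)\<bar> = \<bar>w - x\<bar> / real N" using \<open>real N > 0\<close> by (simp add: abs_mult)
  also have "\<dots> < e" using N \<open>e > 0\<close> \<open>real N > 0\<close> by (simp add: field_simps)
  finally show ?thesis using i i' \<open>g i \<in> K\<close> by blast
qed

lemma local_max_intervalD:
  assumes "local_max_interval h I" "x \<in> I"
  shows "\<forall>y\<in>I. h y = h x" "\<exists>e>0. \<forall>u. u \<notin> I \<and> (\<exists>y\<in>I. \<bar>u - y\<bar> < e) \<longrightarrow> h u < h x"
  using assms unfolding local_max_interval_def by auto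

text \<open>Strictness at an extreme is only known within some distance \<open>e\<close> of
  \<open>I\<close>, and \<open>interval_escape\<close> supplies a point of \<open>K\<close> that
  close to \<open>I\<close>. This is the form in which strictness is used throughout: an interval
  that meets \<open>I\<close> and leaves it contains a smaller value.\<close>

lemma local_max_interval_escape:
  assumes "local_max_interval h I" "is_interval K" "x \<in> K" "x \<in> I" "w \<in> K" "w \<notin> I"
  obtains u where "u \<in> K" "u \<notin> I" "h u < h x"
proof -
  obtain e where e: "e > 0" "\<forall>u. u \<notin> I \<and> (\<exists>y\<in>I. \<bar>u - y\<bar> < e) \<longrightarrow> h u < h x"
    using local_max_intervalD(2)[OF assms(1,4)] by auto
  from interval_escape[OF assms(2,3,4,5,6) e(1)] show ?thesis using e(2) that by blast
qed

lemma local_min_interval_escape: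
  assumes "local_min_interval h I" "is_interval K" "x \<in> K" "x \<in> I" "w \<in> K" "w \<notin> I"
  obtains u where "u \<in> K" "u \<notin> I" "h x < h u"
  using local_max_interval_escape[of "\<lambda>x. - h x" I K x w] assms
  by (auto simp: local_max_interval_uminus)

lemma local_extreme_intervalsD:
  assumes "I \<in> local_extreme_intervals h"
  shows "is_interval I" "I \<noteq> {}" "bounded I"
  using assms
  by (auto simp: local_extreme_intervals_def local_max_interval_def local_min_interval_def)

lemma local_extreme_intervals_const:
  assumes "I \<in> local_extreme_intervals h" "x \<in> I" "y \<in> I"
  shows "h x = h y"
  using assms
  by (auto simp: local_extreme_intervals_def local_max_interval_def local_min_interval_def)

lemma local_extreme_intervals_escape:
  assumes "I \<in> local_extreme_intervals h" "is_interval K" "x \<in> K" "x \<in> I" "w \<in> K" "w \<notin> I"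
  obtains u where "u \<in> K" "u \<notin> I" "h u \<noteq> h x"
  using assms local_max_interval_escape[of h I K x w] local_min_interval_escape[of h I K x w]
  unfolding local_extreme_intervals_def by (metis less_irrefl mem_Collect_eq)

text \<open>If one of the intervals left the other, it would contain a point whose value differs
  from the common one, while it is itself an interval of constancy.\<close>

lemma local_extreme_intervals_disjoint:
  assumes "I \<in> local_extreme_intervals h" "J \<in> local_extreme_intervals h" "x \<in> I" "x \<in> J"
  shows "I = J"
proof -
  have sub: "I \<subseteq> J" if IJ: "I \<in> local_extreme_intervals h" "J \<in> local_extreme_intervals h" "x \<in> I" "x \<in> J" for I J
  proof
    fix w assume "w \<in> I"
    show "w \<in> J"
    proof (rule ccontr)
      assume "w \<notin> J"
      then obtain u where "u \<in> I" "u \<notin> J" "h u \<noteq> h x"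
        using local_extreme_intervals_escape[OF IJ(2) local_extreme_intervalsD(1)[OF IJ(1)] IJ(3,4) \<open>w \<in> I\<close>]
        by blast
      then show False using local_extreme_intervals_const[OF IJ(1)] IJ(3) by blast
    qed
  qed
  from sub[OF assms] sub[OF assms(2,1,4,3)] show ?thesis by blast
qed

text \<open>A bounded \<open>I\<close> has a complement, so there are points outside
  \<open>I\<close> arbitrarily close to it; close enough, they would lie both strictly below and
  strictly above the value on \<open>I\<close>.\<close>

lemma local_max_min_exclusive:
  assumes "local_max_interval h I" "local_min_interval h I"
  shows False
proof -
  obtain x where x: "x \<in> I" using assms(1) by (auto simp: local_max_interval_def)
  have "bounded I" using assms(1) by (simp add: local_max_interval_def)
  then obtain w where w: "w \<notin> I" by (metis UNIV_eq_I not_bounded_UNIV)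
  obtain e1 where e1: "e1 > 0" "\<forall>u. u \<notin> I \<and> (\<exists>y\<in>I. \<bar>u - y\<bar> < e1) \<longrightarrow> h u < h x"
    using local_max_intervalD(2)[OF assms(1) x] by auto
  obtain e2 where e2: "e2 > 0" "\<forall>u. u \<notin> I \<and> (\<exists>y\<in>I. \<bar>u - y\<bar> < e2) \<longrightarrow> h x < h u"
    using local_max_intervalD(2)[of "\<lambda>x. - h x" I x] assms(2) x by (auto simp: local_max_interval_uminus)
  have "\<exists>y\<in>UNIV - I. \<exists>y'\<in>I. \<bar>y - y'\<bar> < min e1 e2"
    using x w e1(1) e2(1) by (intro interval_escape[of _ x _ w]) auto
  then obtain y where "y \<notin> I" "\<exists>y'\<in>I. \<bar>y - y'\<bar> < min e1 e2" by blast
  then show False using e1(2) e2(2) by (metis less_asym min_less_iff_conj)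
qed

text \<open>The function is monotone between \<open>x\<close> and \<open>y\<close>. Strictness of
  the maximum rules out that it increases; hence it decreases, and a maximum at \<open>y\<close>
  would need a smaller value on the way.\<close>

lemma consecutive_extremes_alternate:
  assumes h: "monotone_off_extremes h"
    and I: "local_max_interval h I" and J: "J \<in> local_extreme_intervals h"
    and xy: "x \<in> I" "y \<in> J" "x < y" "I \<noteq> J"
    and gap: "\<And>K. K \<in> local_extreme_intervals h \<Longrightarrow> \<not> K \<subseteq> {x<..<y}"
  shows "local_min_interval h J \<and> h y < h x"
proof -
  have Ie: "I \<in> local_extreme_intervals h" using I by (simp add: local_extreme_intervals_def)
  have yI: "y \<notin> I" and xJ: "x \<notin> J"
    using local_extreme_intervals_disjoint[OF Ie J] xy by blast+
  obtain u where u: "u \<in> {x..y}" "h u < h x"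
    using local_max_interval_escape[OF I, of "{x..y}" x y] xy yI by auto
  from monotone_off_extremesD[OF h gap] have "antimono_on {x..y} h"
    using u xy mono_on_IccD[of x y h x u] by fastforce
  then have anti: "h v \<le> h x" "h y \<le> h v" if "v \<in> {x..y}" for v
    using that antimono_on_IccD[of x y h x v] antimono_on_IccD[of x y h v y] by auto
  have nmax: "\<not> local_max_interval h J"
  proof
    assume "local_max_interval h J"
    then obtain v where "v \<in> {x..y}" "h v < h y"
      using local_max_interval_escape[of h J "{x..y}" y x] xy xJ by auto
    with anti(2)[of v] show False by simp
  qed
  then have Jmin: "local_min_interval h J" using J by (simp add: local_extreme_intervals_def)
  then show ?thesis using anti u(1,2) by force
qed

lemma consecutive_extremes_alternate':
  assumes h: "monotone_off_extremes h"
    and I: "local_min_interval h I" and J: "J \<in> local_extreme_intervals h"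
    and xy: "x \<in> I" "y \<in> J" "x < y" "I \<noteq> J"
    and gap: "\<And>K. K \<in> local_extreme_intervals h \<Longrightarrow> \<not> K \<subseteq> {x<..<y}"
  shows "local_max_interval h J \<and> h x < h y"
  using consecutive_extremes_alternate[of "\<lambda>x. - h x" I J x y] assms
  by (simp add: local_max_interval_uminus local_min_interval_uminus
      local_extreme_intervals_uminus monotone_off_extremes_uminus)

text \<open>The function is monotone from the far left, where it vanishes, up to \<open>x\<close>.
  If the first extreme were a minimum, the function would decrease from 0 to a negative value, which
  \<open>min_nonneg\<close> excludes.\<close>

lemma first_extreme_max:
  assumes h: "monotone_off_extremes h"
    and zero: "\<And>u. u < A \<Longrightarrow> h u = 0"
    and min_nonneg: "\<And>K y. local_min_interval h K \<Longrightarrow> y \<in> K \<Longrightarrow> 0 \<le> h y"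
    and I: "I \<in> local_extreme_intervals h" "x \<in> I"
    and first: "\<And>K. K \<in> local_extreme_intervals h \<Longrightarrow> \<not> K \<subseteq> {..<x}"
  shows "local_max_interval h I \<and> 0 < h x"
proof -
  obtain B where B: "\<And>v. v \<in> I \<Longrightarrow> \<bar>v\<bar> \<le> B" using local_extreme_intervalsD(3)[OF I(1)]
    by (auto simp: bounded_iff)
  \<comment> \<open>A point to the left of \<open>I\<close> and within the region where
    \<open>h\<close> vanishes.\<close>
  define a where "a = min (A - 1) (- B - 1)"
  have "a \<notin> I" using B[of a] by (auto simp: a_def)
  have "h a = 0" using zero by (simp add: a_def)
  have "a < x" using B[OF I(2)] by (auto simp: a_def)
  have "\<not> K \<subseteq> {a<..<x}" if "K \<in> local_extreme_intervals h" for K using first[OF that] by auto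
  from monotone_off_extremesD[OF h this]
  have mono: "mono_on {a..x} h \<or> antimono_on {a..x} h" by blast
  show ?thesis
  proof (cases "local_max_interval h I")
    case True
    then obtain u where u: "u \<in> {a..x}" "h u < h x"
      using local_max_interval_escape[of h I "{a..x}" x a] I \<open>a < x\<close> \<open>a \<notin> I\<close> by auto
    then have "h a \<le> h u" using mono mono_on_IccD[of a x h a u] antimono_on_IccD[of a x h u x] by fastforce
    then show ?thesis using u True \<open>h a = 0\<close> by simp
  next
    case False
    then have Imin: "local_min_interval h I" using I by (simp add: local_extreme_intervals_def)
    then obtain u where u: "u \<in> {a..x}" "h x < h u"
      using local_min_interval_escape[of h I "{a..x}" x a] I \<open>a < x\<close> \<open>a \<notin> I\<close> by auto
    then have "h u \<le> h a" using mono mono_on_IccD[of a x h u x] antimono_on_IccD[of a x h a u] by fastforce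
    then show ?thesis using u min_nonneg[OF Imin I(2)] \<open>h a = 0\<close> by simp
  qed
qed

lemma last_extreme_max:
  assumes h: "monotone_off_extremes h"
    and zero: "\<And>u. u > A \<Longrightarrow> h u = 0"
    and min_nonneg: "\<And>K y. local_min_interval h K \<Longrightarrow> y \<in> K \<Longrightarrow> 0 \<le> h y"
    and I: "I \<in> local_extreme_intervals h" "x \<in> I"
    and last: "\<And>K. K \<in> local_extreme_intervals h \<Longrightarrow> \<not> K \<subseteq> {x<..}"
  shows "local_max_interval h I \<and> 0 < h x"
proof -
  obtain B where B: "\<And>v. v \<in> I \<Longrightarrow> \<bar>v\<bar> \<le> B" using local_extreme_intervalsD(3)[OF I(1)]
    by (auto simp: bounded_iff)
  define a where "a = max (A + 1) (B + 1)"
  have "a \<notin> I" using B[of a] by (auto simp: a_def)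
  have "h a = 0" using zero by (simp add: a_def)
  have "x < a" using B[OF I(2)] by (auto simp: a_def)
  have "\<not> K \<subseteq> {x<..<a}" if "K \<in> local_extreme_intervals h" for K using last[OF that] by auto
  from monotone_off_extremesD[OF h this]
  have mono: "mono_on {x..a} h \<or> antimono_on {x..a} h" by blast
  show ?thesis
  proof (cases "local_max_interval h I")
    case True
    then obtain u where u: "u \<in> {x..a}" "h u < h x"
      using local_max_interval_escape[of h I "{x..a}" x a] I \<open>x < a\<close> \<open>a \<notin> I\<close> by auto
    then have "h a \<le> h u" using mono antimono_on_IccD[of x a h u a] mono_on_IccD[of x a h x u] by fastforce
    then show ?thesis using u True \<open>h a = 0\<close> by simp
  next
    case False
    then have Imin: "local_min_interval h I" using I by (simp add: local_extreme_intervals_def)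
    then obtain u where u: "u \<in> {x..a}" "h x < h u"
      using local_min_interval_escape[of h I "{x..a}" x a] I \<open>x < a\<close> \<open>a \<notin> I\<close> by auto
    then have "h u \<le> h a" using mono antimono_on_IccD[of x a h x u] mono_on_IccD[of x a h u a] by fastforce
    then show ?thesis using u min_nonneg[OF Imin I(2)] \<open>h a = 0\<close> by simp
  qed
qed

section \<open>Enumerating extremes and counting them by alternations\<close>

lemma ex_strict_mono_enumeration:
  fixes A :: "'a::linorder set"
  assumes "finite A"
  obtains g where "bij_betw g {..<card A} A" "strict_mono_on {..<card A} g"
proof (rule that)
  let ?xs = "sorted_list_of_set A"
  show "bij_betw (nth ?xs) {..<card A} A"
    using assms by (intro bij_betw_nth) auto
  show "strict_mono_on {..<card A} (nth ?xs)"
    using assms by (auto simp: strict_mono_on_def intro!: sorted_wrt_nth_less[of "(<)"])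
qed

text \<open>The intervals are ordered through one representative point of each. Representatives of
  different intervals differ because the intervals are disjoint, so sorting the points enumerates
  the intervals.\<close>

lemma enumerate_extremes:
  assumes "finite (local_extreme_intervals h)" and "m = card (local_extreme_intervals h)"
  obtains p I where "strict_mono_on {1..m} p" "bij_betw I {1..m} (local_extreme_intervals h)"
    "\<And>j. j \<in> {1..m} \<Longrightarrow> p j \<in> I j"
proof -
  define E where "E = local_extreme_intervals h"
  define rep where "rep I = (SOME x. x \<in> I)" for I :: "real set"
  have rep: "rep I \<in> I" if "I \<in> E" for I
    using local_extreme_intervalsD(2)[of I h] that unfolding E_def rep_def by (simp add: some_in_eq)
  have inj: "inj_on rep E"
    using rep local_extreme_intervals_disjoint unfolding E_def inj_on_def by metis
  have fin: "finite (rep ` E)" using assms(1) by (simp add: E_def)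
  have "card (rep ` E) = m" using card_image[OF inj] by (simp add: assms E_def)
  then obtain g where g: "bij_betw g {..<m} (rep ` E)" "strict_mono_on {..<m} g"
    using ex_strict_mono_enumeration[OF fin] by metis
  define p where "p j = g (j - 1)" for j
  define I where "I j = inv_into E rep (p j)" for j
  have "bij_betw (\<lambda>j. j - 1) {1..m} {..<m}"
    by (rule bij_betwI[where g = Suc]) auto
  from bij_betw_trans[OF this g(1)] have bp: "bij_betw p {1..m} (rep ` E)"
    by (simp add: p_def[abs_def] o_def)
  have "bij_betw (inv_into E rep) (rep ` E) E"
    using inj by (intro bij_betw_inv_into) (simp add: inj_on_imp_bij_betw)
  from bij_betw_trans[OF bp this] have bI: "bij_betw I {1..m} E"
    by (simp add: I_def[abs_def] o_def)
  have "p j \<in> I j" if "j \<in> {1..m}" for j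
  proof -
    have "p j \<in> rep ` E" using bp that by (auto simp: bij_betw_def)
    then have "rep (I j) = p j" "I j \<in> E" unfolding I_def by (auto intro: f_inv_into_f inv_into_into)
    then show ?thesis using rep by metis
  qed
  moreover have "strict_mono_on {1..m} p"
    unfolding p_def by (rule strict_mono_onI, rule strict_mono_onD[OF g(2)]) auto
  ultimately show ?thesis using that bI unfolding E_def by blast
qed

text \<open>\<open>f\<close> may be discontinuous, so compactness does not provide a maximum on
  \<open>{p..r}\<close>. Instead the end points and the finitely many extremes between them are the
  only candidates, since \<open>f\<close> is monotone between neighbouring candidates. The best
  candidate is no end point because of \<open>q\<close>, and no minimum because it dominates its
  surroundings.\<close>

lemma peak_between:
  assumes f: "monotone_off_extremes f" and fin: "finite (local_extreme_intervals f)"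
    and sing: "\<And>I. I \<in> local_extreme_intervals f \<Longrightarrow> \<exists>x. I = {x}"
    and pqr: "p < q" "q < r" "f p < f q" "f r < f q"
  shows "\<exists>s\<in>{p<..<r}. local_max_interval f {s}"
proof -
  define T where "T = {s\<in>{p<..<r}. {s} \<in> local_extreme_intervals f}"
  have "finite ((\<lambda>s. {s}) ` T)" by (rule finite_subset[OF _ fin]) (auto simp: T_def)
  then have finT: "finite T" by (rule finite_imageD) simp
  define V where "V = insert p (insert r T)"
  have finV: "finite V" using finT by (simp add: V_def)
  have VV: "V \<subseteq> {p..r}" using pqr by (auto simp: V_def T_def)
  have bound: "\<exists>v\<in>V. f x \<le> f v" if x: "x \<in> {p..r}" for x
  proof -
    \<comment> \<open>\<open>a\<close> and \<open>b\<close> are the candidates next to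
      \<open>x\<close> on either side.\<close>
    define a where "a = Max {v\<in>V. v \<le> x}"
    define b where "b = Min {v\<in>V. x \<le> v}"
    have "p \<in> {v\<in>V. v \<le> x}" "r \<in> {v\<in>V. x \<le> v}" using x by (auto simp: V_def)
    then have ne: "{v\<in>V. v \<le> x} \<noteq> {}" "{v\<in>V. x \<le> v} \<noteq> {}" by blast+
    have a: "a \<in> V" "a \<le> x" using Max_in[OF _ ne(1)] finV by (auto simp: a_def)
    have b: "b \<in> V" "x \<le> b" using Min_in[OF _ ne(2)] finV by (auto simp: b_def)
    have "\<not> I \<subseteq> {a<..<b}" if I: "I \<in> local_extreme_intervals f" for I
    proof
      assume sub: "I \<subseteq> {a<..<b}"
      obtain s where s: "I = {s}" using sing[OF I] by blast
      have "s \<in> V" using sub a b VV I s by (auto simp: V_def T_def)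
      show False
      proof (cases "s \<le> x")
        case True
        then have "s \<le> a" unfolding a_def using \<open>s \<in> V\<close> finV by (intro Max_ge) auto
        then show False using sub s by auto
      next
        case False
        then have "b \<le> s" unfolding b_def using \<open>s \<in> V\<close> finV by (intro Min_le) auto
        then show False using sub s by auto
      qed
    qed
    from monotone_off_extremesD[OF f this] have "f x \<le> f a \<or> f x \<le> f b"
      using a b by (auto simp: monotone_on_def)
    then show ?thesis using a b by blast
  qed
  have finfV: "finite (f ` V)" using finV by simp
  have "V \<noteq> {}" by (simp add: V_def)
  then have "Max (f ` V) \<in> f ` V" using finfV by (intro Max_in) auto
  then obtain s where s: "s \<in> V" "Max (f ` V) = f s" by blast
  have s: "s \<in> V" "\<And>v. v \<in> V \<Longrightarrow> f v \<le> f s"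
    using Max_ge[OF finfV] s by auto
  have max: "f x \<le> f s" if "x \<in> {p..r}" for x using bound[OF that] s(2) by force
  have "s \<noteq> p" "s \<noteq> r" using max[of q] pqr by auto
  then have sT: "s \<in> T" using s(1) by (auto simp: V_def)
  then have ext: "{s} \<in> local_extreme_intervals f" "s \<in> {p<..<r}" by (auto simp: T_def)
  have "\<not> local_min_interval f {s}"
  proof
    assume "local_min_interval f {s}"
    then obtain u where "u \<in> {p..r}" "f s < f u"
      using local_min_interval_escape[of f "{s}" "{p..r}" s p] ext pqr \<open>s \<noteq> p\<close> by auto
    then show False using max by force
  qed
  then show ?thesis using ext by (auto simp: local_extreme_intervals_def)
qed

lemma trough_between:
  assumes f: "monotone_off_extremes f" and fin: "finite (local_extreme_intervals f)"
    and sing: "\<And>I. I \<in> local_extreme_intervals f \<Longrightarrow> \<exists>x. I = {x}"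
    and pqr: "p < q" "q < r" "f q < f p" "f q < f r"
  shows "\<exists>s\<in>{p<..<r}. local_min_interval f {s}"
  using peak_between[of "\<lambda>x. - f x" p q r] assms
  by (simp add: local_max_interval_uminus local_extreme_intervals_uminus monotone_off_extremes_uminus)

text \<open>Position \<open>j\<close> yields an extreme in \<open>{q (j - 1)<..<q (Suc j)}\<close>.
  Such ranges overlap only for neighbouring positions, where one extreme is a maximum and the other
  a minimum; so all of them are distinct.\<close>

lemma alternations_le_extremes:
  fixes q :: "nat \<Rightarrow> real"
  assumes f: "monotone_off_extremes f" and fin: "finite (local_extreme_intervals f)"
    and sing: "\<And>I. I \<in> local_extreme_intervals f \<Longrightarrow> \<exists>x. I = {x}"
    and q: "\<And>j. j \<le> m \<Longrightarrow> q j < q (Suc j)"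
    and alt: "\<And>j. j \<in> {1..m} \<Longrightarrow>
      f (q (j - 1)) < f (q j) \<and> f (q (Suc j)) < f (q j) \<and> odd j \<or>
      f (q j) < f (q (j - 1)) \<and> f (q j) < f (q (Suc j)) \<and> even j"
  shows "m \<le> card (local_extreme_intervals f)"
proof -
  have "\<exists>s. s \<in> {q (j - 1)<..<q (Suc j)} \<and>
      (odd j \<longrightarrow> local_max_interval f {s}) \<and> (even j \<longrightarrow> local_min_interval f {s})"
    if j: "j \<in> {1..m}" for j
  proof -
    have "q (j - 1) < q j" "q j < q (Suc j)" using q[of "j - 1"] q[of j] j by auto
    then show ?thesis
      using alt[OF j] peak_between[OF f fin sing, of "q (j - 1)" "q j" "q (Suc j)"]
        trough_between[OF f fin sing, of "q (j - 1)" "q j" "q (Suc j)"] by blast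
  qed
  then obtain s where s: "\<And>j. j \<in> {1..m} \<Longrightarrow> s j \<in> {q (j - 1)<..<q (Suc j)} \<and>
      (odd j \<longrightarrow> local_max_interval f {s j}) \<and> (even j \<longrightarrow> local_min_interval f {s j})"
    by metis
  have qmono: "q i \<le> q j" if "i \<le> j" "j \<le> Suc m" for i j
    using that(1,2)
  proof (induction j rule: dec_induct)
    case (step j)
    then show ?case using q[of j] by simp
  qed simp
  have neq: "s i \<noteq> s j" if "i < j" "i \<in> {1..m}" "j \<in> {1..m}" for i j
  proof (cases "j = Suc i")
    case True
    then show ?thesis using s[OF that(2)] s[OF that(3)] local_max_min_exclusive
      by (metis even_Suc)
  next
    case False
    then have "q (Suc i) \<le> q (j - 1)" using that by (intro qmono) auto
    then show ?thesis using s[OF that(2)] s[OF that(3)] by auto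
  qed
  have "inj_on (\<lambda>j. {s j}) {1..m}"
    by (rule inj_onI) (metis neq linorder_neqE_nat singleton_inject)
  moreover have "(\<lambda>j. {s j}) ` {1..m} \<subseteq> local_extreme_intervals f"
  proof (intro image_subsetI)
    fix j assume "j \<in> {1..m}"
    from s[OF this] show "{s j} \<in> local_extreme_intervals f"
      by (cases "odd j") (simp_all add: local_extreme_intervals_def)
  qed
  ultimately have "card {1..m} \<le> card (local_extreme_intervals f)"
    using fin by (metis card_image card_mono)
  then show ?thesis by simp
qed

definition slope_bounds :: "(real \<Rightarrow> real) \<Rightarrow> (real \<Rightarrow> real) \<Rightarrow> bool" where
  "slope_bounds F f \<longleftrightarrow> (\<forall>p q c. p < q \<longrightarrow>
     ((\<forall>x\<in>{p<..<q}. f x \<le> c) \<longrightarrow> F q - F p \<le> c * (q - p)) \<and>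
     ((\<forall>x\<in>{p<..<q}. c \<le> f x) \<longrightarrow> c * (q - p) \<le> F q - F p))"

lemma slope_bounds_le:
  assumes "slope_bounds F f" "p < q" "\<And>x. p < x \<Longrightarrow> x < q \<Longrightarrow> f x \<le> c"
  shows "F q - F p \<le> c * (q - p)"
  using assms unfolding slope_bounds_def by (metis greaterThanLessThan_iff)

lemma slope_bounds_ge:
  assumes "slope_bounds F f" "p < q" "\<And>x. p < x \<Longrightarrow> x < q \<Longrightarrow> c \<le> f x"
  shows "c * (q - p) \<le> F q - F p"
  using assms unfolding slope_bounds_def by (metis greaterThanLessThan_iff)

lemma slope_bounds_uminus: "slope_bounds (\<lambda>x. - F x) (\<lambda>x. - f x) \<longleftrightarrow> slope_bounds F f"
proof -
  have "slope_bounds (\<lambda>x. - F x) (\<lambda>x. - f x)" if F: "slope_bounds F f" for F f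
    unfolding slope_bounds_def
  proof (intro allI impI conjI)
    fix p q c :: real assume pq: "p < q"
    { assume "\<forall>x\<in>{p<..<q}. - f x \<le> c"
      then have "(- c) * (q - p) \<le> F q - F p" by (intro slope_bounds_ge[OF F pq]) force
      then show "- F q - - F p \<le> c * (q - p)" by simp }
    { assume "\<forall>x\<in>{p<..<q}. c \<le> - f x"
      then have "F q - F p \<le> (- c) * (q - p)" by (intro slope_bounds_le[OF F pq]) force
      then show "c * (q - p) \<le> - F q - - F p" by simp }
  qed
  from this[of F f] this[of "\<lambda>x. - F x" "\<lambda>x. - f x"] show ?thesis by auto
qed

text \<open>Over some interval near \<open>t\<close> the average slope of \<open>F\<close> is at
  least \<open>c'\<close>, and over two intervals further out, one on each side, it is at most
  \<open>c < c'\<close>. Uniform closeness transfers this to \<open>H\<close> with a level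
  \<open>c''\<close> in between, so \<open>h\<close> exceeds \<open>c''\<close> between two points
  where it is below and cannot be monotone. \<open>approached\<close> excludes that
  \<open>f t\<close> is an isolated spike, which averages would not notice.\<close>

lemma peak_stable:
  assumes f: "monotone_off_extremes f" and F: "slope_bounds F f"
    and t: "local_max_interval f {t}" and "r > 0"
    and isolated: "\<And>I. I \<in> local_extreme_intervals f \<Longrightarrow> I \<subseteq> {t - r<..<t + r} \<Longrightarrow> I = {t}"
    and approached: "\<And>c e. c < f t \<Longrightarrow> e > 0 \<Longrightarrow> \<exists>y. y \<noteq> t \<and> \<bar>y - t\<bar> < e \<and> c < f y"
  obtains \<tau> where "\<tau> > 0"
    "\<And>H h. slope_bounds H h \<Longrightarrow> monotone_off_extremes h \<Longrightarrow> (\<And>x. \<bar>H x - F x\<bar> \<le> \<tau>) \<Longrightarrow>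
       \<exists>J\<in>local_extreme_intervals h. J \<subseteq> {t - r<..<t + r}"
proof -
  have nosub: "\<not> I \<subseteq> {t - r<..<t}" "\<not> I \<subseteq> {t<..<t + r}" if "I \<in> local_extreme_intervals f" for I
    using isolated[OF that] local_extreme_intervalsD(2)[OF that] by fastforce+
  have left: "mono_on {t - r..t} f"
  proof -
    obtain u where "u \<in> {t - r..t}" "f u < f t"
      using local_max_interval_escape[OF t, of "{t - r..t}" t "t - r"] \<open>r > 0\<close> by auto
    with monotone_off_extremesD[OF f nosub(1)] show ?thesis
      using antimono_on_IccD[of "t - r" t f u t] by force
  qed
  have right: "antimono_on {t..t + r} f"
  proof -
    obtain u where "u \<in> {t..t + r}" "f u < f t"
      using local_max_interval_escape[OF t, of "{t..t + r}" t "t + r"] \<open>r > 0\<close> by auto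
    with monotone_off_extremesD[OF f nosub(2)] show ?thesis
      using mono_on_IccD[of t "t + r" f t u] by force
  qed
  define a where "a = t - r / 2"
  define b where "b = t + r / 2"
  have ab: "t - r < a" "a < t" "t < b" "b < t + r" using \<open>r > 0\<close> by (auto simp: a_def b_def)
  have fa: "f a < f t"
  proof -
    obtain u where "u \<in> {a..t}" "f u < f t"
      using local_max_interval_escape[OF t, of "{a..t}" t a] ab by auto
    moreover from this have "f a \<le> f u" using left ab by (auto simp: monotone_on_def)
    ultimately show ?thesis by simp
  qed
  have fb: "f b < f t"
  proof -
    obtain u where "u \<in> {t..b}" "f u < f t"
      using local_max_interval_escape[OF t, of "{t..b}" t b] ab by auto
    moreover from this have "f b \<le> f u" using right ab by (auto simp: monotone_on_def)
    ultimately show ?thesis by simp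
  qed
  define c where "c = max (f a) (f b)"
  define c' where "c' = (c + f t) / 2"
  have cc: "c < c'" "c' < f t" using fa fb by (auto simp: c_def c'_def)
  obtain y where y: "y \<noteq> t" "\<bar>y - t\<bar> < r / 2" "c' < f y" using approached[OF cc(2), of "r / 2"] \<open>r > 0\<close> by auto
  \<comment> \<open>One point \<open>y\<close> near \<open>t\<close> with \<open>c' < f y\<close>
    suffices: \<open>f\<close> rises towards \<open>t\<close> from either side, so it stays above
    \<open>c'\<close> between \<open>y\<close> and \<open>t\<close>.\<close>
  obtain p q where pq: "a \<le> p" "p < q" "q \<le> b" "c' * (q - p) \<le> F q - F p"
  proof (cases "y < t")
    case True
    have "c' * (t - y) \<le> F t - F y"
    proof (rule slope_bounds_ge[OF F True])
      fix x assume "y < x" "x < t"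
      then have "f y \<le> f x" using left y by (auto simp: monotone_on_def)
      then show "c' \<le> f x" using y by simp
    qed
    then show ?thesis using that[of y t] True y ab by (auto simp: a_def)
  next
    case False
    then have "t < y" using y by simp
    have "c' * (y - t) \<le> F y - F t"
    proof (rule slope_bounds_ge[OF F \<open>t < y\<close>])
      fix x assume "t < x" "x < y"
      then have "f y \<le> f x" using right y by (auto simp: monotone_on_def)
      then show "c' \<le> f x" using y by simp
    qed
    then show ?thesis using that[of t y] \<open>t < y\<close> y ab by (auto simp: b_def)
  qed
  have Fa: "F a - F (t - r) \<le> c * (a - (t - r))"
  proof (rule slope_bounds_le[OF F ab(1)])
    fix x assume "t - r < x" "x < a"
    then have "f x \<le> f a" using left ab by (auto simp: monotone_on_def)
    then show "f x \<le> c" by (simp add: c_def)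
  qed
  have Fb: "F (t + r) - F b \<le> c * (t + r - b)"
  proof (rule slope_bounds_le[OF F ab(4)])
    fix x assume "b < x" "x < t + r"
    then have "f x \<le> f b" using right ab by (auto simp: monotone_on_def)
    then show "f x \<le> c" by (simp add: c_def)
  qed
  define c'' where "c'' = (c + c') / 2"
  have c'': "c < c''" "c'' < c'" using cc by (auto simp: c''_def)
  \<comment> \<open>Replacing \<open>F\<close> by \<open>H\<close> changes an increment by at most
    \<open>2 * \<tau>\<close>, and both gaps are at least \<open>4 * \<tau>\<close>. The outer
    intervals have length \<open>r / 2\<close>.\<close>
  define \<tau> where "\<tau> = min ((c' - c'') * (q - p) / 4) ((c'' - c) * r / 8)"
  have "\<tau> > 0" using c'' pq \<open>r > 0\<close> by (simp add: \<tau>_def)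
  have t1: "4 * \<tau> \<le> (c' - c'') * (q - p)" and t2: "4 * \<tau> \<le> (c'' - c) * (r / 2)"
    unfolding \<tau>_def by auto
  have "\<exists>J\<in>local_extreme_intervals h. J \<subseteq> {t - r<..<t + r}"
    if H: "slope_bounds H h" and h: "monotone_off_extremes h" and close: "\<And>x. \<bar>H x - F x\<bar> \<le> \<tau>" for H h
  proof (rule ccontr)
    assume "\<not> ?thesis"
    then have mono: "mono_on {t - r..t + r} h \<or> antimono_on {t - r..t + r} h"
      using monotone_off_extremesD[OF h] by blast
    have "\<exists>x. p < x \<and> x < q \<and> c'' < h x"
    proof (rule ccontr)
      assume "\<not> ?thesis"
      then have "H q - H p \<le> c'' * (q - p)" by (intro slope_bounds_le[OF H pq(2)]) (meson not_less)
      then show False using pq(4) close[of q] close[of p] t1 \<open>\<tau> > 0\<close> by (simp add: algebra_simps)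
    qed
    then obtain x where x: "p < x" "x < q" "c'' < h x" by blast
    have "\<exists>x. t - r < x \<and> x < a \<and> h x < c''"
    proof (rule ccontr)
      assume "\<not> ?thesis"
      then have "c'' * (a - (t - r)) \<le> H a - H (t - r)" by (intro slope_bounds_ge[OF H ab(1)]) (meson not_less)
      moreover have "a - (t - r) = r / 2" by (simp add: a_def)
      ultimately have "c'' * (r / 2) \<le> H a - H (t - r)" "F a - F (t - r) \<le> c * (r / 2)" using Fa by metis+
      then show False using close[of a] close[of "t - r"] t2[unfolded left_diff_distrib] \<open>\<tau> > 0\<close> by linarith
    qed
    then obtain x1 where x1: "t - r < x1" "x1 < a" "h x1 < c''" by blast
    have "\<exists>x. b < x \<and> x < t + r \<and> h x < c''"
    proof (rule ccontr)
      assume "\<not> ?thesis"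
      then have "c'' * (t + r - b) \<le> H (t + r) - H b" by (intro slope_bounds_ge[OF H ab(4)]) (meson not_less)
      moreover have "t + r - b = r / 2" by (simp add: b_def)
      ultimately have "c'' * (r / 2) \<le> H (t + r) - H b" "F (t + r) - F b \<le> c * (r / 2)" using Fb by metis+
      then show False using close[of b] close[of "t + r"] t2[unfolded left_diff_distrib] \<open>\<tau> > 0\<close> by linarith
    qed
    then obtain x2 where x2: "b < x2" "x2 < t + r" "h x2 < c''" by blast
    have "x1 < x" "x < x2" using x x1 x2 pq by auto
    then have "h x1 \<le> h x \<and> h x \<le> h x2 \<or> h x \<le> h x1 \<and> h x2 \<le> h x"
      using mono x1 x2 by (auto simp: monotone_on_def)
    then show False using x x1 x2 by auto
  qed
  then show ?thesis using that \<open>\<tau> > 0\<close> by blast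
qed

lemma trough_stable:
  assumes f: "monotone_off_extremes f" and F: "slope_bounds F f"
    and t: "local_min_interval f {t}" and "r > 0"
    and isolated: "\<And>I. I \<in> local_extreme_intervals f \<Longrightarrow> I \<subseteq> {t - r<..<t + r} \<Longrightarrow> I = {t}"
    and approached: "\<And>c e. f t < c \<Longrightarrow> e > 0 \<Longrightarrow> \<exists>y. y \<noteq> t \<and> \<bar>y - t\<bar> < e \<and> f y < c"
  obtains \<tau> where "\<tau> > 0"
    "\<And>H h. slope_bounds H h \<Longrightarrow> monotone_off_extremes h \<Longrightarrow> (\<And>x. \<bar>H x - F x\<bar> \<le> \<tau>) \<Longrightarrow>
       \<exists>J\<in>local_extreme_intervals h. J \<subseteq> {t - r<..<t + r}"
proof -
  have approached': "\<exists>y. y \<noteq> t \<and> \<bar>y - t\<bar> < e \<and> c < - f y" if "c < - f t" "e > 0" for c e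
    using approached[of "- c" e] that by (auto simp: less_minus_iff)
  obtain \<tau> where \<tau>: "\<tau> > 0" "\<And>H h. slope_bounds H h \<Longrightarrow> monotone_off_extremes h \<Longrightarrow>
       (\<And>x. \<bar>H x - - F x\<bar> \<le> \<tau>) \<Longrightarrow> \<exists>J\<in>local_extreme_intervals h. J \<subseteq> {t - r<..<t + r}"
    using peak_stable[of "\<lambda>x. - f x" "\<lambda>x. - F x" t r] f F t \<open>r > 0\<close> isolated approached'
    by (auto simp: local_max_interval_uminus local_extreme_intervals_uminus
        monotone_off_extremes_uminus slope_bounds_uminus)
  show ?thesis
  proof (rule that[OF \<tau>(1)])
    fix H h assume H: "slope_bounds H h" "monotone_off_extremes h" "\<And>x. \<bar>H x - F x\<bar> \<le> \<tau>"
    have "\<bar>- H x - - F x\<bar> \<le> \<tau>" for x using H(3)[of x] by simp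
    with \<tau>(2)[of "\<lambda>x. - H x" "\<lambda>x. - h x"] H
    show "\<exists>J\<in>local_extreme_intervals h. J \<subseteq> {t - r<..<t + r}"
      by (simp add: local_extreme_intervals_uminus monotone_off_extremes_uminus slope_bounds_uminus)
  qed
qed

section \<open>Ranks of extreme intervals\<close>

lemma bij_betw_rank:
  fixes g :: "'a \<Rightarrow> 'b::linorder"
  assumes "finite A" "inj_on g A"
  shows "bij_betw (\<lambda>a. card {b\<in>A. g b \<le> g a}) A {1..card A}"
proof -
  let ?r = "\<lambda>a. card {b\<in>A. g b \<le> g a}"
  have less: "?r a < ?r b" if "a \<in> A" "b \<in> A" "g a < g b" for a b
  proof (rule psubset_card_mono)
    have "b \<in> {c\<in>A. g c \<le> g b}" "b \<notin> {c\<in>A. g c \<le> g a}" using that by auto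
    moreover have "{c\<in>A. g c \<le> g a} \<subseteq> {c\<in>A. g c \<le> g b}" using that by auto
    ultimately show "{c\<in>A. g c \<le> g a} \<subset> {c\<in>A. g c \<le> g b}" by blast
  qed (use assms in auto)
  have inj: "inj_on ?r A"
  proof (rule inj_onI)
    fix a b assume "a \<in> A" "b \<in> A" "?r a = ?r b"
    then have "g a = g b" using less[of a b] less[of b a] by force
    then show "a = b" using assms(2) \<open>a \<in> A\<close> \<open>b \<in> A\<close> by (simp add: inj_on_def)
  qed
  have "?r a \<in> {1..card A}" if "a \<in> A" for a
  proof -
    have "?r a \<le> card A" using assms by (intro card_mono) auto
    moreover have "?r a \<noteq> 0" using assms that by auto
    ultimately show ?thesis by simp
  qed
  then have "?r ` A \<subseteq> {1..card A}" by blast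
  moreover have "card (?r ` A) = card {1..card A}" using card_image[OF inj] by simp
  ultimately have "?r ` A = {1..card A}" by (intro card_subset_eq) auto
  with inj show ?thesis by (simp add: bij_betw_def)
qed

text \<open>With distinct midpoints, ranking by midpoints is a bijection onto the indices from 1,
  which gives the definite description in \<open>nth_extreme_interval\<close> its meaning.
  Afterwards one can speak of all intervals and their ranks instead of the i-th interval.\<close>

lemma all_nth_extreme_interval:
  assumes fin: "finite (local_extreme_intervals h)"
    and inj: "inj_on midpoint_of (local_extreme_intervals h)"
  shows "(\<forall>i\<in>{1..card (local_extreme_intervals h)}. Q (nth_extreme_interval h i) i) \<longleftrightarrow>
    (\<forall>I\<in>local_extreme_intervals h.
       Q I (card {J \<in> local_extreme_intervals h. midpoint_of J \<le> midpoint_of I}))"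
proof -
  define E where "E = local_extreme_intervals h"
  define rk where "rk I = card {J \<in> E. midpoint_of J \<le> midpoint_of I}" for I
  have bij: "bij_betw rk E {1..card E}"
    unfolding rk_def using bij_betw_rank[of E midpoint_of] fin inj by (simp add: E_def)
  have nth: "nth_extreme_interval h (rk I) = I" if "I \<in> E" for I
  proof -
    have "(THE J. J \<in> E \<and> rk J = rk I) = I"
      using bij that by (intro the_equality) (auto simp: bij_betw_def inj_on_def)
    then show ?thesis by (simp add: nth_extreme_interval_def rk_def E_def)
  qed
  have "(\<forall>i\<in>{1..card E}. Q (nth_extreme_interval h i) i) \<longleftrightarrow> (\<forall>I\<in>E. Q (nth_extreme_interval h (rk I)) (rk I))"
    using bij unfolding bij_betw_def by (metis (no_types, lifting) image_iff)
  also have "\<dots> \<longleftrightarrow> (\<forall>I\<in>E. Q I (rk I))" using nth by simp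
  finally show ?thesis by (simp add: E_def rk_def)
qed

section \<open>Step functions and polygons\<close>

text \<open>Piece \<open>j\<close> is the interval from \<open>z (j - 1)\<close> to
  \<open>z j\<close>, open on the left and closed on the right as suits left-hand derivatives. The
  indices 0 and \<open>Suc m\<close> stand for the tails outside the knots. The first knot is moved
  from the left tail into piece 1, in accordance with the right-hand derivative taken there.\<close>

definition piece_index :: "nat \<Rightarrow> (nat \<Rightarrow> real) \<Rightarrow> real \<Rightarrow> nat" where
  "piece_index m z u = (if u = z 0 then 1 else card {j. j \<le> m \<and> z j < u})"

definition step_fun :: "nat \<Rightarrow> (nat \<Rightarrow> real) \<Rightarrow> (nat \<Rightarrow> real) \<Rightarrow> real \<Rightarrow> real" where
  "step_fun m z w u = w (piece_index m z u)"

definition block :: "nat \<Rightarrow> (nat \<Rightarrow> real) \<Rightarrow> nat \<times> nat \<Rightarrow> real set" where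
  "block m z p = {u. fst p \<le> piece_index m z u \<and> piece_index m z u \<le> snd p}"

text \<open>The discrete counterpart of \<open>local_max_interval\<close>: a maximal run of equal
  values, given by its first and last index. The neighbours \<open>a - 1\<close> and
  \<open>Suc b\<close> may be the tail indices 0 and \<open>Suc m\<close>, which take part in the
  comparison but never belong to a run.\<close>

definition max_blocks :: "nat \<Rightarrow> (nat \<Rightarrow> real) \<Rightarrow> (nat \<times> nat) set" where
  "max_blocks m w = {(a, b). 1 \<le> a \<and> a \<le> b \<and> b \<le> m \<and> (\<forall>j\<in>{a..b}. w j = w a) \<and>
     w (a - 1) < w a \<and> w (Suc b) < w a}"

definition extreme_blocks :: "nat \<Rightarrow> (nat \<Rightarrow> real) \<Rightarrow> (nat \<times> nat) set" where
  "extreme_blocks m w = max_blocks m w \<union> max_blocks m (\<lambda>j. - w j)"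

lemma max_blocksD:
  assumes "(a, b) \<in> max_blocks m w"
  shows "1 \<le> a" "a \<le> b" "b \<le> m" "w (a - 1) < w a" "w (Suc b) < w a"
    and "j \<in> {a..b} \<Longrightarrow> w j = w a"
  using assms unfolding max_blocks_def by blast+

lemma extreme_blocksD:
  assumes "(a, b) \<in> extreme_blocks m w"
  shows "1 \<le> a" "a \<le> b" "b \<le> m"
  using assms max_blocksD unfolding extreme_blocks_def by blast+

lemma finite_extreme_blocks: "finite (extreme_blocks m w)"
proof (rule finite_subset[of _ "{..m} \<times> {..m}"])
  show "extreme_blocks m w \<subseteq> {..m} \<times> {..m}" using extreme_blocksD by fastforce
qed simp

lemma step_fun_uminus: "step_fun m z (\<lambda>j. - w j) = (\<lambda>u. - step_fun m z w u)"
  by (simp add: step_fun_def fun_eq_iff)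

text \<open>A largest value between \<open>i\<close> and \<open>k\<close> is not attained at these
  two ends. Around a position of it, the nearest indices with a different value,
  \<open>Max A\<close> and \<open>Min B\<close>, delimit the run.\<close>

lemma max_blocks_exists:
  assumes "i < (l::nat)" "l < k" "k \<le> Suc m" "w i < w l" "w k < (w l :: real)"
  shows "\<exists>(a, b)\<in>max_blocks m w. i < a \<and> b < k"
proof -
  have "w ` {i..k} \<noteq> {}" using assms by simp
  then have "Max (w ` {i..k}) \<in> w ` {i..k}" by (intro Max_in) auto
  then obtain j where j: "j \<in> {i..k}" "Max (w ` {i..k}) = w j" by auto
  have wj: "w x \<le> w j" if "x \<in> {i..k}" for x
    using that unfolding j(2)[symmetric] by (intro Max_ge) auto
  define A where "A = {x. i \<le> x \<and> x < j \<and> w x \<noteq> w j}"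
  define B where "B = {x. j < x \<and> x \<le> k \<and> w x \<noteq> w j}"
  have fin: "finite A" "finite B" by (auto simp: A_def B_def)
  have "i \<noteq> j" "k \<noteq> j" using wj[of l] assms by auto
  have "w i \<noteq> w j" "w k \<noteq> w j" using wj[of l] assms by auto
  then have iA: "i \<in> A" and kB: "k \<in> B"
    using j \<open>i \<noteq> j\<close> \<open>k \<noteq> j\<close> by (auto simp: A_def B_def)
  define a where "a = Suc (Max A)"
  define b where "b = Min B - 1"
  have MA: "Max A \<in> A" and MB: "Min B \<in> B" using iA kB fin by (intro Max_in Min_in; auto)+
  have "i \<le> Max A" "Max A < j" "w (Max A) \<noteq> w j" using MA by (auto simp: A_def)
  have "Min B \<le> k" "j < Min B" "w (Min B) \<noteq> w j" using MB by (auto simp: B_def)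
  have ab: "i < a" "a \<le> j" "j \<le> b" "b < k" "Suc b = Min B"
    using \<open>i \<le> Max A\<close> \<open>Max A < j\<close> \<open>Min B \<le> k\<close> \<open>j < Min B\<close> by (auto simp: a_def b_def)
  have const: "w x = w j" if "x \<in> {a..b}" for x
  proof (rule ccontr)
    assume "w x \<noteq> w j"
    then consider "x < j" | "j < x" by (metis linorder_neqE_nat)
    then show False
    proof cases
      case 1
      then have "x \<in> A" using that ab \<open>w x \<noteq> w j\<close> by (auto simp: A_def)
      then have "x \<le> Max A" using fin by simp
      then show False using that by (simp add: a_def)
    next
      case 2
      then have "x \<in> B" using that ab \<open>w x \<noteq> w j\<close> by (auto simp: B_def)
      then have "Min B \<le> x" using fin by simp
      then show False using that ab by simp
    qed
  qed
  have "w (a - 1) < w j" using wj[of "Max A"] \<open>w (Max A) \<noteq> w j\<close> \<open>i \<le> Max A\<close> \<open>Max A < j\<close> j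
    by (simp add: a_def)
  moreover have "w (Suc b) < w j"
    using wj[of "Min B"] \<open>w (Min B) \<noteq> w j\<close> \<open>j < Min B\<close> \<open>Min B \<le> k\<close> j ab(5) by simp
  moreover have "w a = w j" using ab by (intro const) auto
  moreover have "1 \<le> a" "a \<le> b" "b \<le> m" using ab assms by auto
  ultimately have "(a, b) \<in> max_blocks m w"
    using const unfolding max_blocks_def by (simp only: mem_Collect_eq case_prod_conv) blast
  then show ?thesis using ab by auto
qed

text \<open>The descent and the ascent may lie anywhere relative to each other. If
  \<open>h a \<le> h b\<close>, the descent from \<open>p\<close> to \<open>q\<close> forms a zigzag
  with \<open>a\<close> or with \<open>b\<close>, since otherwise the value at \<open>a\<close>
  would be at least that at \<open>p\<close>, hence larger than that at \<open>q\<close> and so than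
  that at \<open>b\<close>. In the other case the ascent does.\<close>

lemma not_monotone_zigzag:
  fixes h :: "real \<Rightarrow> real"
  assumes "\<not> mono_on {a..b} h" "\<not> antimono_on {a..b} h"
  shows "\<exists>x y z. a \<le> x \<and> x < y \<and> y < z \<and> z \<le> b \<and>
           (h x < h y \<and> h z < h y \<or> h y < h x \<and> h y < h z)"
proof -
  obtain p q where pq: "a \<le> p" "p < q" "q \<le> b" "h q < h p"
    using assms(1) unfolding monotone_on_def
    by (metis atLeastAtMost_iff le_less not_le order_refl)
  obtain p' q' where pq': "a \<le> p'" "p' < q'" "q' \<le> b" "h p' < h q'"
    using assms(2) unfolding monotone_on_def
    by (metis atLeastAtMost_iff le_less not_le order_refl)
  show ?thesis
  proof (cases "h a \<le> h b")
    case True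
    show ?thesis
    proof (cases "h a < h p")
      case True
      then have "a < p" using pq by (metis le_less less_irrefl)
      then show ?thesis using pq True by blast
    next
      case False
      then have "h q < h b" using pq True by simp
      then have "q < b" using pq by (metis le_less less_irrefl)
      then show ?thesis using pq \<open>h q < h b\<close> by blast
    qed
  next
    case False
    show ?thesis
    proof (cases "h p' < h a")
      case True
      then have "a < p'" using pq' by (metis le_less less_irrefl)
      then show ?thesis using pq' True by blast
    next
      case f: False
      then have "h b < h q'" using pq' False by simp
      then have "q' < b" using pq' by (metis le_less less_irrefl)
      then show ?thesis using pq' \<open>h b < h q'\<close> by blast
    qed
  qed
qed

section \<open>Pieces and blocks between knots\<close>

context
  fixes m :: nat and z :: "nat \<Rightarrow> real"
  assumes z: "strict_mono_on {..m} z"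
begin

lemma knots_less: "i < j \<Longrightarrow> j \<le> m \<Longrightarrow> z i < z j"
  using strict_mono_onD[OF z, of i j] by simp

lemma knots_le: "i \<le> j \<Longrightarrow> j \<le> m \<Longrightarrow> z i \<le> z j"
  using knots_less[of i j] by (cases "i = j") auto

text \<open>The working characterisation of \<open>piece_index\<close>, by comparison with single
  knots. The exceptional alternative records that \<open>z 0\<close> belongs to piece 1.\<close>

lemma less_piece_index: "j \<le> m \<Longrightarrow> j < piece_index m z u \<longleftrightarrow> z j < u \<or> j = 0 \<and> u = z 0"
proof (cases "u = z 0")
  case True
  assume j: "j \<le> m"
  then show ?thesis using True knots_le[of 0 j] by (auto simp: piece_index_def)
next
  case False
  assume j: "j \<le> m"
  show ?thesis
  proof (cases "z j < u")
    case True
    have "{..j} \<subseteq> {i. i \<le> m \<and> z i < u}" using knots_le[of _ j] j True by fastforce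
    then have "card {..j} \<le> card {i. i \<le> m \<and> z i < u}" by (intro card_mono) auto
    then show ?thesis using True False by (simp add: piece_index_def)
  next
    case F: False
    have "i < j" if "i \<le> m" "z i < u" for i
      using knots_le[of j i] that F by (cases "i < j") auto
    then have "{i. i \<le> m \<and> z i < u} \<subseteq> {..<j}" by auto
    then have "card {i. i \<le> m \<and> z i < u} \<le> card {..<j}" by (intro card_mono) auto
    then show ?thesis using F False by (simp add: piece_index_def)
  qed
qed

lemma piece_index_le: "piece_index m z u \<le> Suc m"
proof -
  have "card {j. j \<le> m \<and> z j < u} \<le> card {..m}" by (intro card_mono) auto
  then show ?thesis by (simp add: piece_index_def)
qed

lemma piece_index_mono: "u \<le> v \<Longrightarrow> piece_index m z u \<le> piece_index m z v"
proof (rule ccontr)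
  assume uv: "u \<le> v" and "\<not> piece_index m z u \<le> piece_index m z v"
  then have less: "piece_index m z v < piece_index m z u" by simp
  then have "piece_index m z v \<le> m" using piece_index_le[of u] by simp
  from less_piece_index[OF this, of u] less_piece_index[OF this, of v] less uv show False by auto
qed

lemma piece_index_mono_iff: "piece_index m z u < piece_index m z v \<Longrightarrow> u < v"
  using piece_index_mono[of v u] by (metis not_less)

lemma piece_index_eq: "1 \<le> j \<Longrightarrow> j \<le> m \<Longrightarrow> z (j - 1) < u \<Longrightarrow> u \<le> z j \<Longrightarrow> piece_index m z u = j"
  using less_piece_index[of "j - 1" u] less_piece_index[of j u] by force

lemma piece_index_eq_0_iff: "piece_index m z u = 0 \<longleftrightarrow> u < z 0"
  using less_piece_index[of 0 u] by auto

lemma piece_index_eq_Suc_iff: "1 \<le> m \<Longrightarrow> piece_index m z u = Suc m \<longleftrightarrow> z m < u"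
  using less_piece_index[of m u] piece_index_le[of u] by auto

lemma piece_index_surj: "1 \<le> m \<Longrightarrow> j \<le> Suc m \<Longrightarrow> \<exists>u. piece_index m z u = j"
proof -
  assume m: "1 \<le> m" and j: "j \<le> Suc m"
  consider "j = 0" | "1 \<le> j" "j \<le> m" | "j = Suc m" using j by linarith
  then show ?thesis
  proof cases
    case 1 then show ?thesis using piece_index_eq_0_iff[of "z 0 - 1"] by auto
  next
    case 2 then show ?thesis using piece_index_eq[of j "z j"] knots_less[of "j - 1" j] by auto
  next
    case 3 then show ?thesis using piece_index_eq_Suc_iff[of "z m + 1"] m by auto
  qed
qed

text \<open>Two inclusions instead of an equality, because the left end point belongs to the block
  exactly if \<open>a = 1\<close>. Infimum and supremum are the same in both cases.\<close>

lemma block_bounds: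
  assumes "1 \<le> a" "a \<le> b" "b \<le> m"
  shows "{z (a - 1)<..z b} \<subseteq> block m z (a, b)" "block m z (a, b) \<subseteq> {z (a - 1)..z b}"
proof -
  have 1: "a \<le> piece_index m z u \<longleftrightarrow> z (a - 1) < u \<or> a = 1 \<and> u = z 0" for u
    using less_piece_index[of "a - 1" u] assms by (auto simp: Suc_le_eq[symmetric])
  have 2: "piece_index m z u \<le> b \<longleftrightarrow> u \<le> z b" for u
    using less_piece_index[of b u] assms by auto
  show "{z (a - 1)<..z b} \<subseteq> block m z (a, b)" "block m z (a, b) \<subseteq> {z (a - 1)..z b}"
    unfolding block_def fst_conv snd_conv 1 2 using assms by auto
qed

lemma Inf_Sup_block:
  assumes "1 \<le> a" "a \<le> b" "b \<le> m"
  shows "Inf (block m z (a, b)) = z (a - 1)" "Sup (block m z (a, b)) = z b"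
proof -
  have less: "z (a - 1) < z b" using assms knots_less by simp
  note b = block_bounds[OF assms]
  have ne: "block m z (a, b) \<noteq> {}" using b less by fastforce
  have bdd: "bdd_below (block m z (a, b))" "bdd_above (block m z (a, b))"
    using bdd_below_mono[OF _ b(2)] bdd_above_mono[OF _ b(2)] by simp_all
  have "Inf (block m z (a, b)) \<le> Inf {z (a - 1)<..z b}"
    using b(1) less bdd by (intro cInf_superset_mono) auto
  moreover have "z (a - 1) \<le> Inf (block m z (a, b))" using b(2) ne by (intro cInf_greatest) auto
  ultimately show "Inf (block m z (a, b)) = z (a - 1)" using less by simp
  have "Sup {z (a - 1)<..z b} \<le> Sup (block m z (a, b))"
    using b(1) less bdd by (intro cSup_subset_mono) auto
  moreover have "Sup (block m z (a, b)) \<le> z b" using b(2) ne by (intro cSup_least) auto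
  ultimately show "Sup (block m z (a, b)) = z b" using less by simp
qed

lemma is_interval_block: "is_interval (block m z p)"
  unfolding is_interval_1 block_def
  using piece_index_mono by (auto intro: order_trans)

text \<open>From blocks to maxima, \<open>e\<close> is the shortest distance between adjacent knots,
  so that a point outside the block but within \<open>e\<close> of it lies in one of the two
  adjacent pieces. Conversely a maximum that meets a piece contains all of it, since no smaller
  value occurs in the piece; being bounded, it avoids both tails, and as an interval it consists of
  consecutive pieces.\<close>

lemma local_max_interval_step_fun:
  assumes "1 \<le> m"
  shows "local_max_interval (step_fun m z w) I \<longleftrightarrow> I \<in> block m z ` max_blocks m w"
proof
  assume "I \<in> block m z ` max_blocks m w"
  then obtain a b where ab: "(a, b) \<in> max_blocks m w" and I: "I = block m z (a, b)" by auto
  have ab': "1 \<le> a" "a \<le> b" "b \<le> m" and const: "\<And>j. j \<in> {a..b} \<Longrightarrow> w j = w a"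
    and less: "w (a - 1) < w a" "w (Suc b) < w a"
    using max_blocksD[OF ab] by blast+
  have zb: "z (a - 1) < z b" using ab' knots_less by simp
  define e where "e = Min ((\<lambda>j. z (Suc j) - z j) ` {..<m})"
  have "e > 0" unfolding e_def using assms knots_less[of _ "Suc _"] by (subst Min_gr_iff) (auto simp: lessThan_empty_iff)
  have e: "e \<le> z j - z i" if "i < j" "j \<le> m" for i j
  proof -
    have "e \<le> z (Suc i) - z i" unfolding e_def using that by (intro Min_le) auto
    also have "\<dots> \<le> z j - z i" using that knots_le[of "Suc i" j] by simp
    finally show ?thesis .
  qed
  have "step_fun m z w x < w a" if "x \<notin> I" "y \<in> I" "\<bar>x - y\<bar> < e" for x y
  proof -
    have y: "z (a - 1) \<le> y" "y \<le> z b" "a \<le> piece_index m z y" "piece_index m z y \<le> b"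
      using block_bounds(2)[OF ab'] that(2) unfolding I by (auto simp: block_def)
    have "piece_index m z x < a \<or> b < piece_index m z x"
      using that(1) unfolding I by (auto simp: block_def)
    then consider "piece_index m z x < a" | "b < piece_index m z x" by blast
    then have "piece_index m z x = a - 1 \<or> piece_index m z x = Suc b"
    proof cases
      case 1
      have "a - 2 < piece_index m z x" if "2 \<le> a"
      proof -
        have "a - 2 < a - 1" using that by simp
        then have "e \<le> z (a - 1) - z (a - 2)" using ab' by (intro e) auto
        with \<open>\<bar>x - y\<bar> < e\<close> y have "z (a - 2) < x" by linarith
        then show ?thesis using less_piece_index[of "a - 2" x] ab' by simp
      qed
      then show ?thesis using 1 by linarith
    next
      case 2
      have "\<not> Suc b < piece_index m z x" if "Suc b \<le> m"
      proof -
        have "b < Suc b" by simp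
        from e[OF this that] \<open>\<bar>x - y\<bar> < e\<close> y have "x \<le> z (Suc b)" by (simp add: abs_if split: if_splits)
        then show ?thesis using less_piece_index[OF that, of x] by simp
      qed
      then show ?thesis using 2 piece_index_le[of x] by linarith
    qed
    then show ?thesis using less by (auto simp: step_fun_def)
  qed
  moreover have "step_fun m z w x = w a" if "x \<in> I" for x
    using that const[of "piece_index m z x"] unfolding I block_def step_fun_def by simp
  moreover have "I \<noteq> {}" using block_bounds(1)[OF ab'] zb unfolding I by fastforce
  moreover have "bounded I" using block_bounds(2)[OF ab'] bounded_subset unfolding I
    by (metis bounded_closed_interval)
  ultimately show "local_max_interval (step_fun m z w) I"
    using is_interval_block \<open>e > 0\<close> unfolding local_max_interval_def I by blast
next
  assume L: "local_max_interval (step_fun m z w) I"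
  let ?h = "step_fun m z w" and ?i = "piece_index m z"
  have int: "is_interval I" "I \<noteq> {}" "bounded I" using L by (auto simp: local_max_interval_def)
  have escape: "\<exists>v. ?i v \<in> {i..j} \<and> v \<notin> I \<and> ?h v < ?h x"
    if "x \<in> I" "?i x \<in> {i..j}" "?i u \<in> {i..j}" "u \<notin> I" for x u i j
    using local_max_interval_escape[OF L is_interval_block[of "(i, j)"], of x u] that
    by (auto simp: block_def)
  have sat: "u \<in> I" if "x \<in> I" "?i u = ?i x" for x u
  proof (rule ccontr)
    assume "u \<notin> I"
    with escape[OF that(1), of "?i x" "?i x" u] that(2)
    obtain v where "?i v \<in> {?i x..?i x}" "?h v < ?h x" by auto
    then show False by (simp add: step_fun_def)
  qed
  obtain B where B: "\<And>u. u \<in> I \<Longrightarrow> \<bar>u\<bar> \<le> B" using int(3) by (auto simp: bounded_iff)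
  have not0: "?i x \<noteq> 0" if "x \<in> I" for x
  proof
    assume "?i x = 0"
    then have "x < z 0" by (simp add: piece_index_eq_0_iff)
    then have "?i (min x (- B - 1)) = 0" by (simp add: piece_index_eq_0_iff)
    then have "?i (min x (- B - 1)) = ?i x" using \<open>?i x = 0\<close> by simp
    from B[OF sat[OF that this]] show False by simp
  qed
  have notm: "?i x \<noteq> Suc m" if "x \<in> I" for x
  proof
    assume "?i x = Suc m"
    then have "z m < x" by (simp add: piece_index_eq_Suc_iff[OF assms])
    then have "?i (max x (B + 1)) = Suc m" by (simp add: piece_index_eq_Suc_iff[OF assms])
    then have "?i (max x (B + 1)) = ?i x" using \<open>?i x = Suc m\<close> by simp
    from B[OF sat[OF that this]] show False by simp
  qed
  define A where "A = ?i ` I"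
  have AA: "A \<subseteq> {1..m}" using not0 notm piece_index_le by (fastforce simp: A_def le_Suc_eq)
  then have finA: "finite A" by (rule finite_subset) simp
  have "A \<noteq> {}" using int by (simp add: A_def)
  define a where "a = Min A"
  define b where "b = Max A"
  have "a \<in> A" "b \<in> A" using finA \<open>A \<noteq> {}\<close> by (auto simp: a_def b_def)
  have ab: "1 \<le> a" "a \<le> b" "b \<le> m" using \<open>a \<in> A\<close> \<open>b \<in> A\<close> AA finA \<open>A \<noteq> {}\<close>
    by (auto simp: a_def b_def)
  obtain xa xb where xa: "xa \<in> I" "?i xa = a" and xb: "xb \<in> I" "?i xb = b"
    using \<open>a \<in> A\<close> \<open>b \<in> A\<close> by (auto simp: A_def)
  have I: "I = block m z (a, b)"
  proof
    show "I \<subseteq> block m z (a, b)" using finA by (auto simp: block_def a_def b_def A_def)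
    show "block m z (a, b) \<subseteq> I"
    proof
      fix u assume "u \<in> block m z (a, b)"
      then have u: "a \<le> ?i u" "?i u \<le> b" by (auto simp: block_def)
      show "u \<in> I"
      proof (cases "?i u = a \<or> ?i u = b")
        case True
        then show ?thesis using sat xa xb by metis
      next
        case False
        then have "xa < u" "u < xb" using u xa xb piece_index_mono_iff by (metis le_neq_implies_less)+
        then show ?thesis using int(1) xa xb by (meson is_interval_1 less_imp_le)
      qed
    qed
  qed
  have const: "?h u = w a" if "u \<in> I" for u
    using local_max_intervalD(1)[OF L xa(1)] that xa by (simp add: step_fun_def)
  have c: "w j = w a" if "j \<in> {a..b}" for j
  proof -
    have "j \<le> Suc m" using that ab by simp
    then obtain u where "?i u = j" using piece_index_surj[OF assms] by blast
    then show ?thesis using const[of u] that unfolding I by (auto simp: block_def step_fun_def)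
  qed
  have l1: "w (a - 1) < w a"
  proof -
    have "a - 1 \<le> Suc m" using ab by simp
    then obtain u where u: "?i u = a - 1" using piece_index_surj[OF assms] by blast
    then have "u \<notin> I" using ab unfolding I by (auto simp: block_def)
    then obtain v where v: "?i v \<in> {a - 1..a}" "v \<notin> I" "?h v < w a"
      using escape[OF xa(1), of "a - 1" a u] u xa const[OF xa(1)] by auto
    then have "?i v \<noteq> a" using sat xa by metis
    then have "?i v = a - 1" using v(1) by auto
    then show ?thesis using v(3) by (simp add: step_fun_def)
  qed
  have l2: "w (Suc b) < w a"
  proof -
    have "Suc b \<le> Suc m" using ab by simp
    then obtain u where u: "?i u = Suc b" using piece_index_surj[OF assms] by blast
    then have "u \<notin> I" using ab unfolding I by (auto simp: block_def)
    then obtain v where v: "?i v \<in> {b..Suc b}" "v \<notin> I" "?h v < w a"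
      using escape[OF xb(1), of b "Suc b" u] u xb const[OF xb(1)] by auto
    then have "?i v \<noteq> b" using sat xb by metis
    then have "?i v = Suc b" using v(1) by auto
    then show ?thesis using v(3) by (simp add: step_fun_def)
  qed
  have "(a, b) \<in> max_blocks m w"
    using ab c l1 l2 unfolding max_blocks_def by (simp only: mem_Collect_eq case_prod_conv) blast
  then show "I \<in> block m z ` max_blocks m w" using I by blast
qed

lemma local_min_interval_step_fun:
  assumes "1 \<le> m"
  shows "local_min_interval (step_fun m z w) I \<longleftrightarrow> I \<in> block m z ` max_blocks m (\<lambda>j. - w j)"
  using local_max_interval_step_fun[OF assms, of "\<lambda>j. - w j" I]
  by (simp add: step_fun_uminus local_max_interval_uminus)

lemma local_extreme_intervals_step_fun:
  assumes "1 \<le> m"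
  shows "local_extreme_intervals (step_fun m z w) = block m z ` extreme_blocks m w"
  by (auto simp: local_extreme_intervals_def extreme_blocks_def image_Un
      local_max_interval_step_fun[OF assms] local_min_interval_step_fun[OF assms])

text \<open>A zigzag of values is one of indices, because the function factors through
  \<open>piece_index\<close>. A block strictly between the outer indices lies strictly between the
  outer points.\<close>

lemma monotone_off_extremes_step_fun:
  assumes "1 \<le> m"
  shows "monotone_off_extremes (step_fun m z w)"
  unfolding monotone_off_extremes_def
proof (intro allI impI, rule ccontr)
  fix a b
  assume no: "\<forall>I\<in>local_extreme_intervals (step_fun m z w). \<not> I \<subseteq> {a<..<b}"
    and "\<not> (mono_on {a..b} (step_fun m z w) \<or> antimono_on {a..b} (step_fun m z w))"
  then obtain x y v where xyv: "a \<le> x" "x < y" "y < v" "v \<le> b"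
    and alt: "step_fun m z w x < step_fun m z w y \<and> step_fun m z w v < step_fun m z w y \<or>
      step_fun m z w y < step_fun m z w x \<and> step_fun m z w y < step_fun m z w v"
    using not_monotone_zigzag[of a b "step_fun m z w"] by blast
  let ?i = "piece_index m z"
  have le: "?i x \<le> ?i y" "?i y \<le> ?i v" using xyv by (auto intro: piece_index_mono)
  have ne: "?i x \<noteq> ?i y" "?i y \<noteq> ?i v" using alt by (auto simp: step_fun_def)
  have "\<exists>(c, d)\<in>extreme_blocks m w. ?i x < c \<and> d < ?i v"
    using alt
  proof
    assume "step_fun m z w x < step_fun m z w y \<and> step_fun m z w v < step_fun m z w y"
    then show ?thesis
      using max_blocks_exists[of "?i x" "?i y" "?i v" m w] le ne piece_index_le[of v]
      unfolding extreme_blocks_def step_fun_def by fastforce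
  next
    assume "step_fun m z w y < step_fun m z w x \<and> step_fun m z w y < step_fun m z w v"
    then show ?thesis
      using max_blocks_exists[of "?i x" "?i y" "?i v" m "\<lambda>j. - w j"] le ne piece_index_le[of v]
      unfolding extreme_blocks_def step_fun_def by fastforce
  qed
  then obtain c d where cd: "(c, d) \<in> extreme_blocks m w" "?i x < c" "d < ?i v" by auto
  have "block m z (c, d) \<subseteq> {a<..<b}"
  proof
    fix u assume "u \<in> block m z (c, d)"
    then have "?i x < ?i u" "?i u < ?i v" using cd by (auto simp: block_def)
    then show "u \<in> {a<..<b}" using piece_index_mono_iff xyv by fastforce
  qed
  then show False using no cd(1) local_extreme_intervals_step_fun[OF assms, of w] by blast
qed

end

section \<open>Polygons and their slopes\<close>

definition slope_seq :: "nat \<Rightarrow> (nat \<Rightarrow> real) \<Rightarrow> (nat \<Rightarrow> real) \<Rightarrow> nat \<Rightarrow> real" where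
  "slope_seq m z y j = (if 1 \<le> j \<and> j \<le> m then (y j - y (j - 1)) / (z j - z (j - 1)) else 0)"

text \<open>The length of the part of piece \<open>j\<close> to the left of \<open>u\<close>.
  Written as a sum over all pieces, the polygon is visibly continuous, constant outside the knots,
  and has increments that need no case distinction on the pieces of the two points.\<close>

definition progress :: "(nat \<Rightarrow> real) \<Rightarrow> nat \<Rightarrow> real \<Rightarrow> real" where
  "progress z j u = max 0 (min (u - z (j - 1)) (z j - z (j - 1)))"

definition polygon :: "nat \<Rightarrow> (nat \<Rightarrow> real) \<Rightarrow> (nat \<Rightarrow> real) \<Rightarrow> real \<Rightarrow> real" where
  "polygon m z y u = y 0 + (\<Sum>j=1..m. slope_seq m z y j * progress z j u)"

lemma sum_telescope_nat: "(\<Sum>j=1..i. y j - y (j - 1)) = y i - y 0" for y :: "nat \<Rightarrow> real"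
  by (induction i) auto

context
  fixes m :: nat and z :: "nat \<Rightarrow> real"
  assumes z: "strict_mono_on {..m} z"
begin

text \<open>Earlier pieces have been traversed completely and later ones not at all. The
  coefficients are arbitrary because the formula serves for heights, with slopes as coefficients,
  and for lengths, with coefficient 1.\<close>

lemma sum_progress_piece:
  assumes "1 \<le> i" "i \<le> m" "z (i - 1) \<le> u" "u \<le> z i"
  shows "(\<Sum>j=1..m. c j * progress z j u) =
    (\<Sum>j=1..i-1. c j * (z j - z (j - 1))) + c i * (u - z (i - 1))"
proof -
  have "{1..m} = {1..i-1} \<union> {i} \<union> {i+1..m}" using assms by auto
  then have "(\<Sum>j=1..m. c j * progress z j u) =
    (\<Sum>j\<in>{1..i-1}. c j * progress z j u) + c i * progress z i u + (\<Sum>j\<in>{i+1..m}. c j * progress z j u)"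
    using assms by (simp add: sum.union_disjoint)
  moreover have "progress z i u = u - z (i - 1)" using assms by (simp add: progress_def)
  moreover have "progress z j u = z j - z (j - 1)" if "j \<in> {1..i-1}" for j
  proof -
    have "z j \<le> z (i - 1)" using that assms by (intro knots_le[OF z]) auto
    moreover have "z (j - 1) \<le> z j" using that assms by (intro knots_le[OF z]) auto
    ultimately show ?thesis using assms by (simp add: progress_def)
  qed
  moreover have "progress z j u = 0" if "j \<in> {i+1..m}" for j
  proof -
    have "z i \<le> z (j - 1)" using that assms by (intro knots_le[OF z]) auto
    then show ?thesis using assms by (simp add: progress_def)
  qed
  ultimately show ?thesis by simp
qed

lemma slope_seq_mult: "1 \<le> j \<Longrightarrow> j \<le> m \<Longrightarrow> slope_seq m z y j * (z j - z (j - 1)) = y j - y (j - 1)"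
  using knots_less[OF z, of "j - 1" j] by (simp add: slope_seq_def)

lemma polygon_piece:
  assumes "1 \<le> i" "i \<le> m" "z (i - 1) \<le> u" "u \<le> z i"
  shows "polygon m z y u = y (i - 1) + slope_seq m z y i * (u - z (i - 1))"
proof -
  have "(\<Sum>j=1..i-1. slope_seq m z y j * (z j - z (j - 1))) = (\<Sum>j=1..i-1. y j - y (j - 1))"
    using assms by (intro sum.cong refl slope_seq_mult) auto
  then show ?thesis
    unfolding polygon_def sum_progress_piece[OF assms] using sum_telescope_nat[of y "i - 1"] by simp
qed

lemma progress_left:
  assumes "u \<le> z 0" "1 \<le> j" "j \<le> m"
  shows "progress z j u = 0"
proof -
  have "z 0 \<le> z (j - 1)" using assms by (intro knots_le[OF z]) auto
  then show ?thesis using assms by (simp add: progress_def)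
qed

lemma polygon_knot:
  assumes "i \<le> m"
  shows "polygon m z y (z i) = y i"
proof (cases "i = 0")
  case True
  have "progress z j (z 0) = 0" if "j \<in> {1..m}" for j
    using progress_left that by simp
  then show ?thesis using True by (simp add: polygon_def)
next
  case False
  then show ?thesis using polygon_piece[of i "z i" y] assms knots_le[OF z, of "i - 1" i]
    slope_seq_mult[of i y] by simp
qed

lemma polygon_left: "u \<le> z 0 \<Longrightarrow> polygon m z y u = y 0"
proof -
  assume "u \<le> z 0"
  then have "progress z j u = 0" if "j \<in> {1..m}" for j
    using progress_left that by simp
  then show ?thesis by (simp add: polygon_def)
qed

lemma polygon_right:
  assumes "z m \<le> u"
  shows "polygon m z y u = y m"
proof -
  have "progress z j u = progress z j (z m)" if "j \<in> {1..m}" for j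
    using knots_le[OF z, of j m] knots_le[OF z, of "j - 1" j] that assms by (auto simp: progress_def)
  then have "polygon m z y u = polygon m z y (z m)" by (simp add: polygon_def)
  then show ?thesis using polygon_knot[of m] by simp
qed

lemma progress_mono: "p \<le> q \<Longrightarrow> progress z j p \<le> progress z j q"
  by (auto simp: progress_def)

lemma polygon_diff:
  "polygon m z y q - polygon m z y p =
     (\<Sum>j=1..m. slope_seq m z y j * (progress z j q - progress z j p))"
  by (simp add: polygon_def sum_subtractf algebra_simps)

text \<open>The line is decomposed into the left tail, the pieces and the right tail, so that a
  bound \<open>c * (q - p)\<close> can be distributed over them.\<close>

lemma sum_progress:
  "u = z 0 + min (u - z 0) 0 + (\<Sum>j=1..m. progress z j u) + max (u - z m) 0"
proof -
  consider "u < z 0" | "u = z 0" | "z 0 < u" "u \<le> z m" | "z m < u" by linarith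
  then show ?thesis
  proof cases
    case 1
    then have "progress z j u = 0" if "j \<in> {1..m}" for j
      using progress_left that by simp
    moreover have "u \<le> z m" using 1 knots_le[OF z, of 0 m] by simp
    ultimately show ?thesis using 1 by simp
  next
    case 2
    then have "progress z j u = 0" if "j \<in> {1..m}" for j
      using progress_left that by simp
    moreover have "u \<le> z m" using 2 knots_le[OF z, of 0 m] by simp
    ultimately show ?thesis using 2 by simp
  next
    case 3
    define i where "i = piece_index m z u"
    have "z (i - 1) < u" "u \<le> z i" "1 \<le> i" "i \<le> m"
    proof -
      show "1 \<le> i" using less_piece_index[OF z, of 0 u] 3 by (simp add: i_def)
      show "i \<le> m" using less_piece_index[OF z, of m u] 3 by (simp add: i_def)
      then show "u \<le> z i" using less_piece_index[OF z, of i u] by (simp add: i_def)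
      show "z (i - 1) < u" using less_piece_index[OF z, of "i - 1" u] \<open>1 \<le> i\<close> \<open>i \<le> m\<close> 3
        by (auto simp: i_def)
    qed
    then show ?thesis
      using sum_progress_piece[of i u "\<lambda>_. 1"] 3 sum_telescope_nat[of z "i - 1"] by simp
  next
    case 4
    have "progress z j u = z j - z (j - 1)" if "j \<in> {1..m}" for j
      using knots_le[OF z, of j m] knots_le[OF z, of "j - 1" j] that 4 by (auto simp: progress_def)
    moreover have "z 0 \<le> u" using 4 knots_le[OF z, of 0 m] by simp
    ultimately show ?thesis using 4 sum_telescope_nat[of z m] by simp
  qed
qed

text \<open>Every piece that contributes to the increment overlaps \<open>{p<..<q}\<close> in
  positive length and so has an inner point at which the bound on the slope applies. A tail that
  overlaps it forces \<open>0 \<le> c\<close>, as the slope there is 0.\<close>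

lemma polygon_slope_le:
  assumes m: "1 \<le> m" and pq: "p < q"
    and le: "\<And>x. p < x \<Longrightarrow> x < q \<Longrightarrow> step_fun m z (slope_seq m z y) x \<le> c"
  shows "polygon m z y q - polygon m z y p \<le> c * (q - p)"
proof -
  have inner: "slope_seq m z y j * (progress z j q - progress z j p) \<le> c * (progress z j q - progress z j p)"
    if j: "j \<in> {1..m}" for j
  proof (cases "progress z j q = progress z j p")
    case False
    then have less: "progress z j p < progress z j q" using progress_mono[of p q j] pq by simp
    have zz: "z (j - 1) < z j" using j knots_less[OF z, of "j - 1" j] by simp
    define x where "x = (max p (z (j - 1)) + min q (z j)) / 2"
    have "max p (z (j - 1)) < min q (z j)" using less pq zz by (auto simp: progress_def)
    then have x: "p < x" "x < q" "z (j - 1) < x" "x \<le> z j" unfolding x_def by auto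
    then have "step_fun m z (slope_seq m z y) x = slope_seq m z y j"
      using piece_index_eq[OF z, of j x] j by (simp add: step_fun_def)
    then have "slope_seq m z y j \<le> c" using le[of x] x by simp
    then show ?thesis using less by (simp add: mult_right_mono)
  qed simp
  have left: "0 \<le> c * (min (q - z 0) 0 - min (p - z 0) 0)"
  proof (cases "p < z 0")
    case True
    define x where "x = (p + min q (z 0)) / 2"
    have x: "p < x" "x < q" "x < z 0" unfolding x_def using True pq by auto
    then have "step_fun m z (slope_seq m z y) x = 0"
      using piece_index_eq_0_iff[OF z, of x] by (simp add: step_fun_def slope_seq_def)
    then have "0 \<le> c" using le[of x] x by simp
    then show ?thesis using pq by (intro mult_nonneg_nonneg) auto
  qed (use pq in auto)
  have right: "0 \<le> c * (max (q - z m) 0 - max (p - z m) 0)"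
  proof (cases "z m < q")
    case True
    define x where "x = (max p (z m) + q) / 2"
    have x: "p < x" "x < q" "z m < x" unfolding x_def using True pq by auto
    then have "step_fun m z (slope_seq m z y) x = 0"
      using piece_index_eq_Suc_iff[OF z, of x] m by (simp add: step_fun_def slope_seq_def)
    then have "0 \<le> c" using le[of x] x by simp
    then show ?thesis using pq by (intro mult_nonneg_nonneg) auto
  qed (use pq in auto)
  have "polygon m z y q - polygon m z y p \<le> (\<Sum>j=1..m. c * (progress z j q - progress z j p))"
    unfolding polygon_diff using inner by (intro sum_mono) auto
  also have "\<dots> \<le> (\<Sum>j=1..m. c * (progress z j q - progress z j p))
     + c * (min (q - z 0) 0 - min (p - z 0) 0) + c * (max (q - z m) 0 - max (p - z m) 0)"
    using left right by simp
  also have "\<dots> = c * (((\<Sum>j=1..m. progress z j q) + min (q - z 0) 0 + max (q - z m) 0) -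
     ((\<Sum>j=1..m. progress z j p) + min (p - z 0) 0 + max (p - z m) 0))"
    by (simp add: sum_distrib_left[symmetric] sum_subtractf algebra_simps)
  also have "\<dots> = c * (q - p)" proof -
    have "((\<Sum>j=1..m. progress z j q) + min (q - z 0) 0 + max (q - z m) 0) -
     ((\<Sum>j=1..m. progress z j p) + min (p - z 0) 0 + max (p - z m) 0) = q - p"
      using sum_progress[of q] sum_progress[of p] by linarith
    then show ?thesis by (rule arg_cong)
  qed
  finally show ?thesis .
qed

lemma slope_seq_uminus: "slope_seq m z (\<lambda>j. - y j) = (\<lambda>j. - slope_seq m z y j)"
  by (auto simp: slope_seq_def fun_eq_iff minus_divide_left)

lemma slope_bounds_polygon:
  assumes m: "1 \<le> m"
  shows "slope_bounds (polygon m z y) (step_fun m z (slope_seq m z y))"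
  unfolding slope_bounds_def
proof (intro allI impI conjI)
  fix p q c :: real assume pq: "p < q"
  show "polygon m z y q - polygon m z y p \<le> c * (q - p)"
    if "\<forall>x\<in>{p<..<q}. step_fun m z (slope_seq m z y) x \<le> c"
    using that by (intro polygon_slope_le m pq) auto
  assume "\<forall>x\<in>{p<..<q}. c \<le> step_fun m z (slope_seq m z y) x"
  then have "polygon m z (\<lambda>j. - y j) q - polygon m z (\<lambda>j. - y j) p \<le> (- c) * (q - p)"
    by (intro polygon_slope_le m pq) (auto simp: slope_seq_uminus step_fun_uminus)
  then show "c * (q - p) \<le> polygon m z y q - polygon m z y p"
    by (simp add: polygon_def slope_seq_uminus sum_negf)
qed

end

section \<open>Taut polygons\<close>

definition polygon_length :: "nat \<Rightarrow> (nat \<Rightarrow> real) \<Rightarrow> (nat \<Rightarrow> real) \<Rightarrow> real" where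
  "polygon_length m z y = (\<Sum>j=1..m. norm (z j - z (j - 1), y j - y (j - 1)))"

text \<open>Heights beyond index \<open>m\<close> are fixed at 0; this makes minimisers unique as
  functions and the set of admissible heights compact.\<close>

definition through_gates :: "nat \<Rightarrow> (nat \<Rightarrow> real) \<Rightarrow> (nat \<Rightarrow> real) \<Rightarrow> (nat \<Rightarrow> real) \<Rightarrow> bool" where
  "through_gates m lo hi y \<longleftrightarrow> (\<forall>j\<le>m. lo j \<le> y j \<and> y j \<le> hi j) \<and> (\<forall>j>m. y j = 0)"

definition taut_polygon ::
  "nat \<Rightarrow> (nat \<Rightarrow> real) \<Rightarrow> (nat \<Rightarrow> real) \<Rightarrow> (nat \<Rightarrow> real) \<Rightarrow> (nat \<Rightarrow> real) \<Rightarrow> bool" where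
  "taut_polygon m z lo hi y \<longleftrightarrow> through_gates m lo hi y \<and>
     (\<forall>y'. through_gates m lo hi y' \<longrightarrow> polygon_length m z y \<le> polygon_length m z y')"

lemma taut_polygonD:
  assumes "taut_polygon m z lo hi y"
  shows "j \<le> m \<Longrightarrow> lo j \<le> y j" "j \<le> m \<Longrightarrow> y j \<le> hi j" "through_gates m lo hi y"
    "through_gates m lo hi y' \<Longrightarrow> polygon_length m z y \<le> polygon_length m z y'"
  using assms unfolding taut_polygon_def through_gates_def by auto

lemma polygon_length_uminus: "polygon_length m z (\<lambda>j. - y j) = polygon_length m z y"
proof -
  have "norm (z j - z (j - 1), - y j - - y (j - 1)) = norm (z j - z (j - 1), y j - y (j - 1))" for j
    unfolding norm_Pair by (simp add: power2_commute)
  then show ?thesis by (simp add: polygon_length_def)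
qed

lemma through_gates_uminus:
  "through_gates m (\<lambda>j. - hi j) (\<lambda>j. - lo j) (\<lambda>j. - y j) \<longleftrightarrow> through_gates m lo hi y"
  unfolding through_gates_def by auto

lemma taut_polygon_uminus:
  assumes "taut_polygon m z lo hi y"
  shows "taut_polygon m z (\<lambda>j. - hi j) (\<lambda>j. - lo j) (\<lambda>j. - y j)"
  unfolding taut_polygon_def
proof (intro conjI allI impI)
  show "through_gates m (\<lambda>j. - hi j) (\<lambda>j. - lo j) (\<lambda>j. - y j)"
    using taut_polygonD(3)[OF assms] by (simp add: through_gates_uminus)
  fix y' assume "through_gates m (\<lambda>j. - hi j) (\<lambda>j. - lo j) y'"
  then have "through_gates m lo hi (\<lambda>j. - y' j)"
    using through_gates_uminus[of m hi lo "\<lambda>j. - y' j"] by simp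
  from taut_polygonD(4)[OF assms this]
  show "polygon_length m z (\<lambda>j. - y j) \<le> polygon_length m z y'"
    by (simp add: polygon_length_uminus)
qed

text \<open>Each height belongs to at most two sides, whence the factor 2. The estimate serves to
  approximate the minimal length by polygons with rational parameters.\<close>

lemma polygon_length_lipschitz:
  "\<bar>polygon_length m z y - polygon_length m z y'\<bar> \<le> 2 * (\<Sum>j\<le>m. \<bar>y j - y' j\<bar>)"
proof -
  have "\<bar>norm (a, b) - norm (a, c)\<bar> \<le> \<bar>b - c\<bar>" for a b c :: real
    using norm_triangle_ineq3[of "(a, b)" "(a, c)"] by (simp add: norm_Pair)
  then have 1: "\<bar>norm (z j - z (j - 1), y j - y (j - 1)) - norm (z j - z (j - 1), y' j - y' (j - 1))\<bar>
      \<le> \<bar>y j - y' j\<bar> + \<bar>y (j - 1) - y' (j - 1)\<bar>" for j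
    by (rule order_trans) simp
  have "\<bar>polygon_length m z y - polygon_length m z y'\<bar> \<le>
      (\<Sum>j=1..m. \<bar>y j - y' j\<bar> + \<bar>y (j - 1) - y' (j - 1)\<bar>)"
    unfolding polygon_length_def sum_subtractf[symmetric]
    by (rule order_trans[OF sum_abs]) (rule sum_mono, rule 1)
  also have "\<dots> = (\<Sum>j=1..m. \<bar>y j - y' j\<bar>) + (\<Sum>j<m. \<bar>y j - y' j\<bar>)"
    by (simp add: sum.distrib) (rule sum.reindex_bij_witness[of _ Suc "\<lambda>j. j - 1"], auto)
  also have "\<dots> \<le> (\<Sum>j\<le>m. \<bar>y j - y' j\<bar>) + (\<Sum>j\<le>m. \<bar>y j - y' j\<bar>)"
    by (intro add_mono sum_mono2) auto
  finally show ?thesis by simp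
qed

lemma continuous_on_polygon_length: "continuous_on A (\<lambda>y. polygon_length m z y)"
proof -
  have "continuous_on UNIV (\<lambda>y::nat \<Rightarrow> real. y j)" for j by simp
  then have "continuous_on A (\<lambda>y::nat \<Rightarrow> real. y j)" for j using continuous_on_subset by blast
  then show ?thesis
    unfolding polygon_length_def norm_Pair by (intro continuous_intros)
qed

text \<open>A product of compact sets is compact, the coordinates beyond \<open>m\<close> ranging
  over a single point, and the length is continuous in the product topology.\<close>

lemma taut_polygon_exists:
  assumes "\<And>j. j \<le> m \<Longrightarrow> lo j \<le> hi j"
  obtains y where "taut_polygon m z lo hi y"
proof -
  define S where "S j = (if j \<le> m then {lo j..hi j} else {0::real})" for j
  define K where "K = Pi\<^sub>E UNIV S"
  have K: "K = {y. through_gates m lo hi y}"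
    by (auto simp: K_def S_def through_gates_def PiE_UNIV_domain Pi_iff split: if_splits)
  have "compactin (product_topology (\<lambda>_. euclidean) UNIV) K"
    unfolding K_def compactin_PiE by (auto simp: S_def)
  then have "compact K" by (metis compactin_euclidean_iff euclidean_product_topology)
  moreover have "K \<noteq> {}" using assms by (simp add: K_def PiE_eq_empty_iff S_def)
  ultimately obtain y where "y \<in> K" "\<forall>y'\<in>K. polygon_length m z y \<le> polygon_length m z y'"
    using continuous_attains_inf[OF _ _ continuous_on_polygon_length] by blast
  then show ?thesis using that unfolding K taut_polygon_def by blast
qed

text \<open>Equality in the triangle inequality would make \<open>(a, b)\<close> and
  \<open>(a, c)\<close> parallel; having the same first coordinate \<open>a \<noteq> 0\<close>, they
  would be equal.\<close>

lemma norm_midpoint_less: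
  fixes a b c :: real
  assumes "a \<noteq> 0" "b \<noteq> c"
  shows "norm (a, (b + c) / 2) < (norm (a, b) + norm (a, c)) / 2"
proof -
  have eq: "norm (a, (b + c) / 2) = norm ((a, b) + (a, c)) / 2"
  proof -
    have "(a, (b + c) / 2) = (1 / 2) *\<^sub>R ((a, b) + (a, c))" by simp
    then show ?thesis by (simp only: norm_scaleR)
  qed
  have "norm ((a, b) + (a, c)) \<noteq> norm (a, b) + norm (a, c)"
  proof
    assume "norm ((a, b) + (a, c)) = norm (a, b) + norm (a, c)"
    then have *: "norm (a, b) *\<^sub>R (a, c) = norm (a, c) *\<^sub>R (a, b)" by (simp only: norm_triangle_eq)
    then have "norm (a, b) = norm (a, c)" using assms by simp
    moreover have "norm (a, b) \<noteq> 0" using assms by (simp add: zero_prod_def)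
    ultimately show False using * assms by simp
  qed
  with norm_triangle_ineq[of "(a, b)" "(a, c)"]
  have "norm ((a, b) + (a, c)) < norm (a, b) + norm (a, c)" by (simp only: less_le) blast
  then show ?thesis unfolding eq by (rule divide_strict_right_mono) simp
qed

lemma norm_midpoint_le:
  fixes a b c :: real
  shows "norm (a, (b + c) / 2) \<le> (norm (a, b) + norm (a, c)) / 2"
proof -
  have "(a, (b + c) / 2) = (1 / 2) *\<^sub>R ((a, b) + (a, c))" by simp
  then have "norm (a, (b + c) / 2) = \<bar>1 / 2\<bar> * norm ((a, b) + (a, c))" by (simp only: norm_scaleR)
  also have "\<dots> \<le> \<bar>1 / 2\<bar> * (norm (a, b) + norm (a, c))"
    by (intro mult_left_mono norm_triangle_ineq) simp
  finally show ?thesis by simp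
qed

lemma through_gates_midpoint:
  assumes "through_gates m lo hi y" "through_gates m lo hi y'"
  shows "through_gates m lo hi (\<lambda>j. (y j + y' j) / 2)"
proof -
  have "lo j \<le> (y j + y' j) / 2 \<and> (y j + y' j) / 2 \<le> hi j" if "j \<le> m" for j
  proof -
    have "lo j \<le> y j" "y j \<le> hi j" "lo j \<le> y' j" "y' j \<le> hi j"
      using assms that unfolding through_gates_def by auto
    then show ?thesis by simp
  qed
  then show ?thesis using assms unfolding through_gates_def by simp
qed

text \<open>The average of two minimisers is admissible and, by convexity, not longer. It is
  strictly shorter on the side that ends at the first index where they differ, because the two sides
  start at a common point. \<open>lo 0 = hi 0\<close> ensures that this index is positive.\<close>

lemma taut_polygon_unique:
  assumes z: "strict_mono_on {..m} z" and start: "lo 0 = hi 0"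
    and y: "taut_polygon m z lo hi y" and y': "taut_polygon m z lo hi y'"
  shows "y = y'"
proof (rule ccontr)
  assume "y \<noteq> y'"
  then obtain i where "y i \<noteq> y' i" by auto
  define j where "j = (LEAST i. y i \<noteq> y' i)"
  have j: "y j \<noteq> y' j" unfolding j_def by (rule LeastI) fact
  have "j \<le> m"
    using taut_polygonD(3)[OF y] taut_polygonD(3)[OF y'] j unfolding through_gates_def
    by (metis not_le)
  have "y 0 = y' 0" using taut_polygonD(1,2)[OF y, of 0] taut_polygonD(1,2)[OF y', of 0] start by simp
  then have "1 \<le> j" using j by (cases j) auto
  have "y (j - 1) = y' (j - 1)"
    using not_less_Least[of "j - 1" "\<lambda>i. y i \<noteq> y' i"] \<open>1 \<le> j\<close> unfolding j_def[symmetric] by auto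
  define y2 where "y2 = (\<lambda>j. (y j + y' j) / 2)"
  have y2: "through_gates m lo hi y2"
    unfolding y2_def using taut_polygonD(3)[OF y] taut_polygonD(3)[OF y'] by (rule through_gates_midpoint)
  have *: "(z i - z (i - 1), y2 i - y2 (i - 1)) =
      (z i - z (i - 1), ((y i - y (i - 1)) + (y' i - y' (i - 1))) / 2)" for i
    by (simp add: y2_def field_simps)
  have "polygon_length m z y2 < (\<Sum>i=1..m. (norm (z i - z (i - 1), y i - y (i - 1)) +
      norm (z i - z (i - 1), y' i - y' (i - 1))) / 2)"
    unfolding polygon_length_def *
  proof (rule sum_strict_mono_ex1)
    show "\<forall>i\<in>{1..m}. norm (z i - z (i - 1), (y i - y (i - 1) + (y' i - y' (i - 1))) / 2)
      \<le> (norm (z i - z (i - 1), y i - y (i - 1)) + norm (z i - z (i - 1), y' i - y' (i - 1))) / 2"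
      using norm_midpoint_le by blast
    have "norm (z j - z (j - 1), (y j - y (j - 1) + (y' j - y' (j - 1))) / 2)
      < (norm (z j - z (j - 1), y j - y (j - 1)) + norm (z j - z (j - 1), y' j - y' (j - 1))) / 2"
      using knots_less[OF z, of "j - 1" j] \<open>1 \<le> j\<close> \<open>j \<le> m\<close> j \<open>y (j - 1) = y' (j - 1)\<close>
      by (intro norm_midpoint_less) auto
    then show "\<exists>i\<in>{1..m}. norm (z i - z (i - 1), (y i - y (i - 1) + (y' i - y' (i - 1))) / 2)
      < (norm (z i - z (i - 1), y i - y (i - 1)) + norm (z i - z (i - 1), y' i - y' (i - 1))) / 2"
      using \<open>1 \<le> j\<close> \<open>j \<le> m\<close> by auto
  qed simp
  also have "\<dots> = (polygon_length m z y + polygon_length m z y') / 2"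
    unfolding polygon_length_def sum.distrib[symmetric] sum_divide_distrib by simp
  also have "polygon_length m z y' \<le> polygon_length m z y"
    using taut_polygonD(4)[OF y' taut_polygonD(3)[OF y]] .
  finally show False using taut_polygonD(4)[OF y y2] by simp
qed

lemma polygon_length_update:
  assumes "0 < j" "j < m"
  shows "polygon_length m z (y(j := w)) - polygon_length m z y =
    (norm (z j - z (j - 1), w - y (j - 1)) + norm (z (Suc j) - z j, y (Suc j) - w)) -
    (norm (z j - z (j - 1), y j - y (j - 1)) + norm (z (Suc j) - z j, y (Suc j) - y j))"
proof -
  define R where "R = {1..m} - {j} - {Suc j}"
  have len: "polygon_length m z x = norm (z j - z (j - 1), x j - x (j - 1)) +
      (norm (z (Suc j) - z j, x (Suc j) - x j) + (\<Sum>i\<in>R. norm (z i - z (i - 1), x i - x (i - 1))))" for x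
    unfolding polygon_length_def R_def using assms
    by (subst sum.remove[of _ j], simp, simp, subst sum.remove[of _ "Suc j"]) auto
  have "(\<Sum>i\<in>R. norm (z i - z (i - 1), (y(j := w)) i - (y(j := w)) (i - 1))) =
      (\<Sum>i\<in>R. norm (z i - z (i - 1), y i - y (i - 1)))"
    using assms by (intro sum.cong refl) (auto simp: R_def)
  moreover have "j - 1 \<noteq> j" using assms by simp
  ultimately show ?thesis unfolding len using assms by simp
qed

text \<open>At a convex kink the string could be shortened by moving it up towards the chord.\<close>

lemma taut_polygon_convex_kink:
  assumes z: "strict_mono_on {..m} z" and start: "lo 0 = hi 0"
    and y: "taut_polygon m z lo hi y" and j: "0 < j" "j < m"
    and kink: "slope_seq m z y j < slope_seq m z y (Suc j)"
  shows "y j = hi j"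
proof (rule ccontr)
  assume "y j \<noteq> hi j"
  then have less: "y j < hi j" using taut_polygonD(2)[OF y, of j] j by simp
  define \<alpha> where "\<alpha> = z j - z (j - 1)"
  define \<beta> where "\<beta> = z (Suc j) - z j"
  have pos: "\<alpha> > 0" "\<beta> > 0"
    using knots_less[OF z, of "j - 1" j] knots_less[OF z, of j "Suc j"] j by (auto simp: \<alpha>_def \<beta>_def)
  \<comment> \<open>The height above \<open>z j\<close> of the chord joining the two neighbouring
    vertices.\<close>
  define c where "c = y (j - 1) + (y (Suc j) - y (j - 1)) * \<alpha> / (\<alpha> + \<beta>)"
  have "(y j - y (j - 1)) / \<alpha> < (y (Suc j) - y j) / \<beta>"
    using kink j by (simp add: slope_seq_def \<alpha>_def \<beta>_def)
  then have "(y j - y (j - 1)) * \<beta> < (y (Suc j) - y j) * \<alpha>" using pos by (simp add: field_simps)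
  then have "y j * (\<alpha> + \<beta>) < y (j - 1) * (\<alpha> + \<beta>) + (y (Suc j) - y (j - 1)) * \<alpha>"
    by (simp add: algebra_simps)
  then have yc: "y j < c" using pos by (simp add: c_def field_simps)
  \<comment> \<open>The fraction of the way to the chord that the gate permits.\<close>
  define \<theta> where "\<theta> = min 1 ((hi j - y j) / (c - y j))"
  have \<theta>: "0 < \<theta>" "\<theta> \<le> 1" "\<theta> * (c - y j) \<le> hi j - y j"
  proof -
    show "0 < \<theta>" "\<theta> \<le> 1" using less yc by (auto simp: \<theta>_def)
    have "\<theta> * (c - y j) \<le> (hi j - y j) / (c - y j) * (c - y j)"
      using yc by (intro mult_right_mono) (auto simp: \<theta>_def)
    then show "\<theta> * (c - y j) \<le> hi j - y j" using yc by simp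
  qed
  define w where "w = y j + \<theta> * (c - y j)"
  have "y j < w" "w \<le> hi j" using \<theta> yc by (auto simp: w_def)
  define \<phi> where "\<phi> v = norm (\<alpha>, v - y (j - 1)) + norm (\<beta>, y (Suc j) - v)" for v
  have convex1: "norm (\<alpha>, w - y (j - 1)) \<le> (1 - \<theta>) * norm (\<alpha>, y j - y (j - 1)) + \<theta> * norm (\<alpha>, c - y (j - 1))"
  proof -
    have "(\<alpha>, w - y (j - 1)) = (1 - \<theta>) *\<^sub>R (\<alpha>, y j - y (j - 1)) + \<theta> *\<^sub>R (\<alpha>, c - y (j - 1))"
      by (simp add: w_def algebra_simps)
    also have "norm \<dots> \<le> norm ((1 - \<theta>) *\<^sub>R (\<alpha>, y j - y (j - 1))) + norm (\<theta> *\<^sub>R (\<alpha>, c - y (j - 1)))"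
      by (rule norm_triangle_ineq)
    finally show ?thesis using \<theta> by (simp only: norm_scaleR; simp)
  qed
  have convex2: "norm (\<beta>, y (Suc j) - w) \<le> (1 - \<theta>) * norm (\<beta>, y (Suc j) - y j) + \<theta> * norm (\<beta>, y (Suc j) - c)"
  proof -
    have "(\<beta>, y (Suc j) - w) = (1 - \<theta>) *\<^sub>R (\<beta>, y (Suc j) - y j) + \<theta> *\<^sub>R (\<beta>, y (Suc j) - c)"
      by (simp add: w_def algebra_simps)
    also have "norm \<dots> \<le> norm ((1 - \<theta>) *\<^sub>R (\<beta>, y (Suc j) - y j)) + norm (\<theta> *\<^sub>R (\<beta>, y (Suc j) - c))"
      by (rule norm_triangle_ineq)
    finally show ?thesis using \<theta> by (simp only: norm_scaleR; simp)
  qed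
  \<comment> \<open>The knot divides the chord in the ratio of \<alpha> to \<beta>, so the two parts
    add up to its length, which is at most that of the two sides by the triangle inequality.\<close>
  have chord: "\<phi> c \<le> \<phi> (y j)"
  proof -
    have s: "\<alpha> / (\<alpha> + \<beta>) + \<beta> / (\<alpha> + \<beta>) = 1" using pos by (simp add: add_divide_distrib[symmetric])
    define d where "d = y (Suc j) - y (j - 1)"
    have "(\<alpha>, c - y (j - 1)) = (\<alpha> / (\<alpha> + \<beta>)) *\<^sub>R (\<alpha> + \<beta>, d)"
      using pos by (simp add: c_def d_def)
    then have n1: "norm (\<alpha>, c - y (j - 1)) = \<alpha> / (\<alpha> + \<beta>) * norm (\<alpha> + \<beta>, d)"
      using pos by (simp only: norm_scaleR; simp)
    have "y (Suc j) - c = d - \<alpha> / (\<alpha> + \<beta>) * d" by (simp add: c_def d_def)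
    also have "\<dots> = \<beta> / (\<alpha> + \<beta>) * d" using pos by (simp add: field_simps)
    finally have "(\<beta>, y (Suc j) - c) = (\<beta> / (\<alpha> + \<beta>)) *\<^sub>R (\<alpha> + \<beta>, d)"
      using pos by simp
    then have n2: "norm (\<beta>, y (Suc j) - c) = \<beta> / (\<alpha> + \<beta>) * norm (\<alpha> + \<beta>, d)"
      using pos by (simp only: norm_scaleR; simp)
    have "\<phi> c = (\<alpha> / (\<alpha> + \<beta>) + \<beta> / (\<alpha> + \<beta>)) * norm (\<alpha> + \<beta>, d)"
      unfolding \<phi>_def n1 n2 by (simp only: distrib_right)
    also have "\<dots> = norm (\<alpha> + \<beta>, d)" unfolding s by simp
    also have "(\<alpha> + \<beta>, d) = (\<alpha>, y j - y (j - 1)) + (\<beta>, y (Suc j) - y j)" by (simp add: d_def)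
    also have "norm \<dots> \<le> \<phi> (y j)" unfolding \<phi>_def by (rule norm_triangle_ineq)
    finally show ?thesis .
  qed
  have "\<phi> w \<le> (1 - \<theta>) * \<phi> (y j) + \<theta> * \<phi> c"
    using convex1 convex2 unfolding \<phi>_def distrib_left by linarith
  also have "\<dots> \<le> (1 - \<theta>) * \<phi> (y j) + \<theta> * \<phi> (y j)" using chord \<theta> by simp
  also have "\<dots> = \<phi> (y j)" by (simp add: algebra_simps)
  finally have "polygon_length m z (y(j := w)) \<le> polygon_length m z y"
    using polygon_length_update[OF j, of z y w] by (simp add: \<phi>_def \<alpha>_def \<beta>_def)
  moreover have "through_gates m lo hi (y(j := w))"
    using taut_polygonD(3)[OF y] \<open>y j < w\<close> \<open>w \<le> hi j\<close> j unfolding through_gates_def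
    by (auto intro: order_trans less_imp_le)
  \<comment> \<open>Only a weak inequality between the lengths has been obtained. It makes the moved
    polygon another minimiser, which uniqueness excludes.\<close>
  ultimately have "taut_polygon m z lo hi (y(j := w))"
    using y unfolding taut_polygon_def by (meson order_trans)
  from taut_polygon_unique[OF z start y this] have "y j = (y(j := w)) j" by (rule fun_cong)
  then show False using \<open>y j < w\<close> by simp
qed

lemma taut_polygon_concave_kink:
  assumes z: "strict_mono_on {..m} z" and start: "lo 0 = hi 0"
    and y: "taut_polygon m z lo hi y" and j: "0 < j" "j < m"
    and kink: "slope_seq m z y (Suc j) < slope_seq m z y j"
  shows "y j = lo j"
  using taut_polygon_convex_kink[OF z _ taut_polygon_uminus[OF y] j] start kink
  by (simp add: slope_seq_uminus[OF z])

section \<open>The taut string is a polygon\<close>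

text \<open>The knots enumerate the distinct observations, of which there are \<open>Suc m\<close>;
  ties are thereby allowed, and \<open>m = 0\<close> means that all observations coincide.\<close>

definition sample_knots :: "nat \<Rightarrow> (nat \<Rightarrow> real) \<Rightarrow> nat \<Rightarrow> (nat \<Rightarrow> real) \<Rightarrow> bool" where
  "sample_knots n x m z \<longleftrightarrow> strict_mono_on {..m} z \<and> z ` {..m} = x ` {..<n}"

text \<open>
  The empirical distribution function jumps at the knots.  By continuity a curve in the tube is, when
  it first reaches a knot, still below the upper boundary to the left of the knot.  The end points
  of the string are fixed.
\<close>

definition gate_lo :: "nat \<Rightarrow> (nat \<Rightarrow> real) \<Rightarrow> nat \<Rightarrow> (nat \<Rightarrow> real) \<Rightarrow> real \<Rightarrow> nat \<Rightarrow> real" where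
  "gate_lo n x m z \<epsilon> j = (if j = 0 then 0 else if j = m then 1 else emp_cdf n x (z j) - \<epsilon>)"

definition gate_hi :: "nat \<Rightarrow> (nat \<Rightarrow> real) \<Rightarrow> nat \<Rightarrow> (nat \<Rightarrow> real) \<Rightarrow> real \<Rightarrow> nat \<Rightarrow> real" where
  "gate_hi n x m z \<epsilon> j = (if j = 0 then 0 else if j = m then 1 else emp_cdf n x (z (j - 1)) + \<epsilon>)"

text \<open>The inner gates are nonempty and the fixed end points are compatible with the boundaries
  next to them. For positive \<epsilon> this turns out to be equivalent to the existence of a
  string.\<close>

definition gates_open :: "nat \<Rightarrow> (nat \<Rightarrow> real) \<Rightarrow> nat \<Rightarrow> (nat \<Rightarrow> real) \<Rightarrow> real \<Rightarrow> bool" where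
  "gates_open n x m z \<epsilon> \<longleftrightarrow> 1 \<le> m \<and> emp_cdf n x (z 0) \<le> \<epsilon> \<and> 1 \<le> emp_cdf n x (z (m - 1)) + \<epsilon> \<and>
     (\<forall>j\<in>{1..<m}. emp_cdf n x (z j) - \<epsilon> \<le> emp_cdf n x (z (j - 1)) + \<epsilon>)"

lemma emp_cdf_mono: "y \<le> y' \<Longrightarrow> emp_cdf n x y \<le> emp_cdf n x y'"
  unfolding emp_cdf_def by (intro divide_right_mono of_nat_mono card_mono) auto

lemma emp_cdf_nonneg: "0 \<le> emp_cdf n x y"
  by (simp add: emp_cdf_def)

lemma emp_cdf_le_1: "emp_cdf n x y \<le> 1"
proof -
  have "card {i. i < n \<and> x i \<le> y} \<le> card {..<n}" by (intro card_mono) auto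
  then show ?thesis by (cases "n = 0") (simp_all add: emp_cdf_def)
qed

lemma curve_length_ge:
  assumes "\<And>i j. i \<le> j \<Longrightarrow> j \<le> N \<Longrightarrow> \<rho> i \<le> \<rho> j" "\<And>i. i \<le> N \<Longrightarrow> \<rho> i \<in> {0..1}"
  shows "ereal (\<Sum>i<N. dist (\<gamma> (\<rho> i)) (\<gamma> (\<rho> (Suc i)))) \<le> curve_length \<gamma>"
proof -
  define ts where "ts = map \<rho> [0..<Suc N]"
  have len: "length ts = Suc N" by (simp add: ts_def)
  have nth: "ts ! i = \<rho> i" if "i \<le> N" for i
    unfolding ts_def using that by (subst nth_map) (simp_all del: upt_Suc)
  have "sorted ts"
    unfolding sorted_iff_nth_mono using assms(1) nth len by simp
  moreover have "set ts \<subseteq> {0..1}"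
    using assms(2) unfolding ts_def by (auto simp del: upt_Suc)
  moreover have "(\<Sum>i<length ts - 1. dist (\<gamma> (ts ! i)) (\<gamma> (ts ! Suc i))) =
      (\<Sum>i<N. dist (\<gamma> (\<rho> i)) (\<gamma> (\<rho> (Suc i))))"
    using len nth by simp
  ultimately show ?thesis
    unfolding curve_length_def by (intro SUP_upper2[of ts]) auto
qed

lemma polygon_length_dist:
  "polygon_length m z y = (\<Sum>i<m. dist (z i, y i) (z (Suc i), y (Suc i)))"
proof -
  have "dist (z (j - 1), y (j - 1)) (z j, y j) = norm (z j - z (j - 1), y j - y (j - 1))" for j
    by (simp add: dist_norm norm_Pair power2_commute)
  then show ?thesis
    unfolding polygon_length_def
    by (intro sum.reindex_bij_witness[of _ Suc "\<lambda>j. j - 1"]) auto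
qed

lemma tube_curve_imp:
  assumes "tube_curve l u p q \<gamma>"
  shows "continuous_on {0..1} \<gamma>" "\<gamma> 0 = p" "\<gamma> 1 = q"
    "r \<in> {0..1} \<Longrightarrow> fst p \<le> fst (\<gamma> r) \<and> fst (\<gamma> r) \<le> fst q \<and>
       l (fst (\<gamma> r)) \<le> snd (\<gamma> r) \<and> snd (\<gamma> r) \<le> u (fst (\<gamma> r))"
proof -
  show "continuous_on {0..1} \<gamma>" "\<gamma> 0 = p" "\<gamma> 1 = q"
    using assms by (auto simp: tube_curve_def path_def pathstart_def pathfinish_def)
  assume "r \<in> {0..1}"
  then have "\<gamma> r \<in> path_image \<gamma>" by (auto simp: path_image_def)
  then show "fst p \<le> fst (\<gamma> r) \<and> fst (\<gamma> r) \<le> fst q \<and>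
       l (fst (\<gamma> r)) \<le> snd (\<gamma> r) \<and> snd (\<gamma> r) \<le> u (fst (\<gamma> r))"
    using assms unfolding tube_curve_def by (auto split: prod.splits)
qed

section \<open>Curves in the tube of the empirical distribution function\<close>

context
  fixes n :: nat and x :: "nat \<Rightarrow> real" and m :: nat and z :: "nat \<Rightarrow> real"
  assumes n: "0 < n" and knots: "sample_knots n x m z"
begin

lemma sample_knots_mono: "strict_mono_on {..m} z"
  using knots by (simp add: sample_knots_def)

lemma sample_in_knots: "i < n \<Longrightarrow> \<exists>j\<le>m. x i = z j"
proof -
  assume "i < n"
  then have "x i \<in> z ` {..m}" using knots unfolding sample_knots_def by auto
  then show ?thesis by auto
qed

lemma sample_min_knots: "sample_min n x = z 0"
proof (rule Min_eqI)
  fix y assume "y \<in> x ` {..<n}"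
  then show "z 0 \<le> y" using sample_in_knots knots_le[OF sample_knots_mono, of 0] by fastforce
next
  show "z 0 \<in> x ` {..<n}" using knots unfolding sample_knots_def by auto
qed simp

lemma sample_max_knots: "sample_max n x = z m"
proof (rule Max_eqI)
  fix y assume "y \<in> x ` {..<n}"
  then show "y \<le> z m" using sample_in_knots knots_le[OF sample_knots_mono, of _ m] by fastforce
next
  show "z m \<in> x ` {..<n}" using knots unfolding sample_knots_def by auto
qed simp

lemma emp_cdf_piece:
  assumes "j < m" "z j \<le> y" "y < z (Suc j)"
  shows "emp_cdf n x y = emp_cdf n x (z j)"
proof -
  have "x i \<le> y \<longleftrightarrow> x i \<le> z j" if "i < n" for i
  proof -
    obtain k where k: "k \<le> m" "x i = z k" using sample_in_knots[OF \<open>i < n\<close>] by blast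
    show ?thesis
    proof (cases "k \<le> j")
      case True
      then show ?thesis using knots_le[OF sample_knots_mono, of k j] assms k by simp
    next
      case False
      then have "z (Suc j) \<le> z k" using k by (intro knots_le[OF sample_knots_mono]) auto
      then show ?thesis using assms k by simp
    qed
  qed
  then have "{i. i < n \<and> x i \<le> y} = {i. i < n \<and> x i \<le> z j}" by auto
  then show ?thesis by (simp add: emp_cdf_def)
qed

lemma emp_cdf_left: "y < z 0 \<Longrightarrow> emp_cdf n x y = 0"
proof -
  assume "y < z 0"
  have "\<not> x i \<le> y" if i: "i < n" for i
  proof -
    obtain k where k: "k \<le> m" "x i = z k" using sample_in_knots[OF i] by blast
    then show ?thesis using knots_le[OF sample_knots_mono, of 0 k] \<open>y < z 0\<close> by simp
  qed
  then have "{i. i < n \<and> x i \<le> y} = {}" by auto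
  then show ?thesis by (simp add: emp_cdf_def)
qed

lemma emp_cdf_right: "z m \<le> y \<Longrightarrow> emp_cdf n x y = 1"
proof -
  assume "z m \<le> y"
  have "x i \<le> y" if i: "i < n" for i
  proof -
    obtain k where k: "k \<le> m" "x i = z k" using sample_in_knots[OF i] by blast
    then show ?thesis using knots_le[OF sample_knots_mono, of k m] \<open>z m \<le> y\<close> by simp
  qed
  then have "{i. i < n \<and> x i \<le> y} = {..<n}" by auto
  then show ?thesis using n by (simp add: emp_cdf_def)
qed

lemma emp_cdf_left_of_knot:
  assumes "1 \<le> j" "j \<le> m" "z (j - 1) \<le> y" "y < z j"
  shows "emp_cdf n x y = emp_cdf n x (z (j - 1))"
  using emp_cdf_piece[of "j - 1" y] assms by simp

context
  fixes \<epsilon> :: real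
  assumes eps: "0 < \<epsilon>"
begin

private abbreviation "lo \<equiv> gate_lo n x m z \<epsilon>"
private abbreviation "hi \<equiv> gate_hi n x m z \<epsilon>"
private abbreviation "in_tube \<equiv> tube_curve (\<lambda>y. emp_cdf n x y - \<epsilon>) (\<lambda>y. emp_cdf n x y + \<epsilon>) (z 0, 0) (z m, 1)"

lemma below_left_boundary:
  assumes \<gamma>: "in_tube \<gamma>" and r: "r \<in> {0..1}" and j: "1 \<le> j" "j \<le> m"
    and hit: "fst (\<gamma> r) = z j" and before: "\<And>s. 0 \<le> s \<Longrightarrow> s < r \<Longrightarrow> fst (\<gamma> s) < z j"
  shows "snd (\<gamma> r) \<le> emp_cdf n x (z (j - 1)) + \<epsilon>"
proof (rule ccontr)
  let ?c = "emp_cdf n x (z (j - 1)) + \<epsilon>"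
  assume above: "\<not> snd (\<gamma> r) \<le> ?c"
  have "z 0 < z j" using knots_less[OF sample_knots_mono, of 0 j] j by simp
  then have "r \<noteq> 0" using hit tube_curve_imp(2)[OF \<gamma>] by auto
  \<comment> \<open>Within this distance of \<open>\<gamma> r\<close> the curve is still right of
    the previous knot and above the upper boundary over the piece in between.\<close>
  define d where "d = min (z j - z (j - 1)) (snd (\<gamma> r) - ?c)"
  have "d > 0" using above knots_less[OF sample_knots_mono, of "j - 1" j] j by (simp add: d_def)
  then obtain e where e: "e > 0" "\<And>s. s \<in> {0..1} \<Longrightarrow> dist s r < e \<Longrightarrow> dist (\<gamma> s) (\<gamma> r) < d"
    using tube_curve_imp(1)[OF \<gamma>] r unfolding continuous_on_iff by blast
  define s where "s = max 0 (r - e / 2)"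
  have s: "0 \<le> s" "s < r" "s \<in> {0..1}" "dist s r < e"
    using r \<open>r \<noteq> 0\<close> e(1) by (auto simp: s_def dist_real_def)
  have "dist (\<gamma> s) (\<gamma> r) < d" by (rule e(2)[OF s(3,4)])
  then have "\<bar>fst (\<gamma> s) - z j\<bar> < z j - z (j - 1)" "\<bar>snd (\<gamma> s) - snd (\<gamma> r)\<bar> < snd (\<gamma> r) - ?c"
    using dist_fst_le[of "\<gamma> s" "\<gamma> r"] dist_snd_le[of "\<gamma> s" "\<gamma> r"] hit
    by (simp_all add: d_def dist_real_def)
  then have "z (j - 1) \<le> fst (\<gamma> s)" "?c < snd (\<gamma> s)" by linarith+
  moreover have "fst (\<gamma> s) < z j" using before s by simp
  ultimately show False
    using emp_cdf_left_of_knot[OF j, of "fst (\<gamma> s)"] tube_curve_imp(4)[OF \<gamma> s(3)] by simp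
qed

text \<open>The curve need not be a graph, so knot \<open>j\<close> is represented by the first time
  at which the abscissa reaches \<open>z j\<close>. First times are ordered like the knots, and
  before them the curve is strictly left of \<open>z j\<close>, as
  \<open>below_left_boundary\<close> requires. The polygon inscribed at these times is no longer
  than the curve.\<close>

lemma in_tube_length_ge:
  assumes m: "1 \<le> m" and \<gamma>: "in_tube \<gamma>"
  shows "\<exists>y. through_gates m lo hi y \<and> ereal (polygon_length m z y) \<le> curve_length \<gamma>"
proof -
  define T where "T j = {r \<in> {0..1}. z j \<le> fst (\<gamma> r)}" for j
  define r where "r j = Inf (T j)" for j
  note cont = tube_curve_imp(1)[OF \<gamma>]
  have contf: "continuous_on {0..1} (\<lambda>r. fst (\<gamma> r))" using cont by (intro continuous_intros)
  have T: "closed (T j)" "1 \<in> T j" "bdd_below (T j)" if "j \<le> m" for j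
  proof -
    show "closed (T j)" unfolding T_def
      using continuous_closed_preimage[OF contf, of "{z j..}"]
      by (simp add: vimage_def Int_def conj_commute)
    show "1 \<in> T j" using tube_curve_imp(3)[OF \<gamma>] knots_le[OF sample_knots_mono, of j m] that by (simp add: T_def)
    show "bdd_below (T j)" by (rule bdd_belowI[of _ 0]) (simp add: T_def)
  qed
  have r: "r j \<in> T j" if "j \<le> m" for j
    unfolding r_def using T[OF that] by (intro closed_contains_Inf) auto
  have r01: "r j \<in> {0..1}" if "j \<le> m" for j using r[OF that] by (simp add: T_def)
  have before: "fst (\<gamma> s) < z j" if "j \<le> m" "0 \<le> s" "s < r j" for j s
  proof (rule ccontr)
    assume "\<not> fst (\<gamma> s) < z j"
    then have "s \<in> T j" using that r01[OF that(1)] by (simp add: T_def)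
    then have "r j \<le> s" unfolding r_def using T[OF that(1)] by (intro cInf_lower)
    then show False using that by simp
  qed
  have hit: "fst (\<gamma> (r j)) = z j" if jm: "j \<le> m" for j
  proof (rule ccontr)
    assume ne: "fst (\<gamma> (r j)) \<noteq> z j"
    have ge: "z j \<le> fst (\<gamma> (r j))" using r[OF that] by (simp add: T_def)
    have "fst (\<gamma> 0) \<le> z j" using tube_curve_imp(2)[OF \<gamma>] knots_le[OF sample_knots_mono, of 0 j] that by simp
    moreover have "continuous_on {0..r j} (\<lambda>r. fst (\<gamma> r))"
      using contf r01[OF that] by (auto intro: continuous_on_subset)
    ultimately obtain s where s: "0 \<le> s" "s \<le> r j" "fst (\<gamma> s) = z j"
      using IVT'[of "\<lambda>r. fst (\<gamma> r)" 0 "z j" "r j"] ge r01[OF jm] by auto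
    then have "s < r j" using ne by (cases "s = r j") auto
    with before[OF that s(1) this] s show False by simp
  qed
  have rmono: "r i \<le> r j" if "i \<le> j" "j \<le> m" for i j
    unfolding r_def using T[of i] T[of j] that knots_le[OF sample_knots_mono, of i j]
    by (intro cInf_superset_mono) (auto simp: T_def)
  \<comment> \<open>The curve may reach the abscissa of the last knot before it ends, but the
    inscribed polygon must end in \<open>(z m, 1)\<close>.\<close>
  define \<rho> where "\<rho> j = (if j = m then 1 else r j)" for j
  define y where "y j = (if j \<le> m then snd (\<gamma> (\<rho> j)) else 0)" for j
  have \<gamma>\<rho>: "\<gamma> (\<rho> j) = (z j, y j)" if "j \<le> m" for j
    using that hit[OF that] tube_curve_imp(3)[OF \<gamma>] by (auto simp: \<rho>_def y_def prod_eq_iff)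
  have "r 0 = 0"
  proof (rule antisym)
    have "0 \<in> T 0" using tube_curve_imp(2)[OF \<gamma>] by (simp add: T_def)
    then show "r 0 \<le> 0" unfolding r_def using T[of 0] by (intro cInf_lower) auto
    show "0 \<le> r 0" using r01[of 0] by simp
  qed
  then have y0: "y 0 = 0" using m tube_curve_imp(2)[OF \<gamma>] by (simp add: y_def \<rho>_def)
  have ym: "y m = 1" using tube_curve_imp(3)[OF \<gamma>] by (simp add: y_def \<rho>_def)
  have "lo j \<le> y j \<and> y j \<le> hi j" if j: "j \<le> m" for j
  proof -
    consider "j = 0" | "j = m" | "1 \<le> j" "j < m" using j by linarith
    then show ?thesis
    proof cases
      case 3
      then have yj: "y j = snd (\<gamma> (r j))" by (simp add: y_def \<rho>_def)
      have "snd (\<gamma> (r j)) \<le> emp_cdf n x (z (j - 1)) + \<epsilon>"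
        using below_left_boundary[OF \<gamma> r01[OF j] 3(1) j hit[OF j]] before[OF j] by simp
      moreover have "emp_cdf n x (z j) - \<epsilon> \<le> snd (\<gamma> (r j))"
        using tube_curve_imp(4)[OF \<gamma> r01[OF j]] hit[OF j] by simp
      ultimately show ?thesis using 3 yj by (simp add: gate_lo_def gate_hi_def)
    qed (use m y0 ym in \<open>auto simp: gate_lo_def gate_hi_def\<close>)
  qed
  then have "through_gates m lo hi y" by (simp add: through_gates_def y_def)
  moreover have "ereal (polygon_length m z y) \<le> curve_length \<gamma>"
  proof -
    have "ereal (\<Sum>i<m. dist (\<gamma> (\<rho> i)) (\<gamma> (\<rho> (Suc i)))) \<le> curve_length \<gamma>"
    proof (rule curve_length_ge)
      show "\<rho> i \<in> {0..1}" if "i \<le> m" for i using r01[OF that] by (simp add: \<rho>_def)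
      show "\<rho> i \<le> \<rho> j" if "i \<le> j" "j \<le> m" for i j
        using that rmono[OF that] r01[of i] by (auto simp: \<rho>_def)
    qed
    moreover have "(\<Sum>i<m. dist (\<gamma> (\<rho> i)) (\<gamma> (\<rho> (Suc i)))) = polygon_length m z y"
      unfolding polygon_length_dist by (intro sum.cong refl) (simp add: \<gamma>\<rho>)
    ultimately show ?thesis by simp
  qed
  ultimately show ?thesis by blast
qed

text \<open>The abscissa of a graph moves strictly to the right, so
  \<open>below_left_boundary\<close> applies at every knot after the first. Its instance at the last
  knot yields the end clause of \<open>gates_open\<close>.\<close>

lemma graph_in_tube_gates:
  assumes m: "1 \<le> m" and S: "in_tube (graph_curve (z 0) (z m) S)"
  shows "S (z 0) = 0" "S (z m) = 1" "j \<le> m \<Longrightarrow> emp_cdf n x (z j) - \<epsilon> \<le> S (z j)"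
    "1 \<le> j \<Longrightarrow> j \<le> m \<Longrightarrow> S (z j) \<le> emp_cdf n x (z (j - 1)) + \<epsilon>"
proof -
  show "S (z 0) = 0" using tube_curve_imp(2)[OF S] by (simp add: graph_curve_def linepath_def)
  show "S (z m) = 1" using tube_curve_imp(3)[OF S] by (simp add: graph_curve_def linepath_def)
  have less: "z 0 < z m" using knots_less[OF sample_knots_mono, of 0 m] m by simp
  define \<tau> where "\<tau> u = (u - z 0) / (z m - z 0)" for u
  have lp: "linepath (z 0) (z m) r = z 0 + r * (z m - z 0)" for r by (simp add: linepath_def algebra_simps)
  have \<tau>: "linepath (z 0) (z m) (\<tau> u) = u" for u using less by (simp add: lp \<tau>_def)
  have \<tau>01: "\<tau> (z j) \<in> {0..1}" if "j \<le> m" for j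
    using less knots_le[OF sample_knots_mono, of 0 j] knots_le[OF sample_knots_mono, of j m] that by (simp add: \<tau>_def)
  show "emp_cdf n x (z j) - \<epsilon> \<le> S (z j)" if "j \<le> m"
    using tube_curve_imp(4)[OF S \<tau>01[OF that]] by (simp add: graph_curve_def \<tau>)
  show "S (z j) \<le> emp_cdf n x (z (j - 1)) + \<epsilon>" if "1 \<le> j" "j \<le> m"
  proof -
    have "fst (graph_curve (z 0) (z m) S s) < z j" if "s < \<tau> (z j)" for s
    proof -
      have "s * (z m - z 0) < \<tau> (z j) * (z m - z 0)" using that less by simp
      then show ?thesis using less by (simp add: graph_curve_def lp \<tau>_def)
    qed
    then show ?thesis
      using below_left_boundary[OF S \<tau>01[OF that(2)] that] by (simp add: graph_curve_def \<tau>)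
  qed
qed

lemma gates_openI:
  assumes "1 \<le> m" and "S (z 0) = (0::real)" "S (z m) = 1"
    and "\<And>j. j \<le> m \<Longrightarrow> emp_cdf n x (z j) - \<epsilon> \<le> S (z j)"
    and "\<And>j. 1 \<le> j \<Longrightarrow> j \<le> m \<Longrightarrow> S (z j) \<le> emp_cdf n x (z (j - 1)) + \<epsilon>"
  shows "gates_open n x m z \<epsilon>"
  unfolding gates_open_def
proof (intro conjI ballI)
  show "emp_cdf n x (z 0) \<le> \<epsilon>" using assms(2) assms(4)[of 0] by simp
  show "1 \<le> emp_cdf n x (z (m - 1)) + \<epsilon>" using assms(1,3) assms(5)[of m] by simp
  show "emp_cdf n x (z j) - \<epsilon> \<le> emp_cdf n x (z (j - 1)) + \<epsilon>" if "j \<in> {1..<m}" for j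
    using assms(4)[of j] assms(5)[of j] that by simp
qed fact

lemma through_gates_ends:
  assumes "1 \<le> m" "through_gates m lo hi y"
  shows "y 0 = 0" "y m = 1"
  using assms unfolding through_gates_def gate_lo_def gate_hi_def by force+

text \<open>At the end knots the gates are single points and say nothing about the boundaries; there
  the bounds come from \<open>gates_open\<close> and \<open>emp_cdf_le_1\<close>.\<close>

lemma through_gates_bounds:
  assumes "gates_open n x m z \<epsilon>" "through_gates m lo hi y" "j \<le> m"
  shows "emp_cdf n x (z j) - \<epsilon> \<le> y j" "1 \<le> j \<Longrightarrow> y j \<le> emp_cdf n x (z (j - 1)) + \<epsilon>"
proof -
  have m: "1 \<le> m" using assms(1) by (simp add: gates_open_def)
  note ends = through_gates_ends[OF m assms(2)]
  have g: "lo j \<le> y j" "y j \<le> hi j" using assms(2,3) by (auto simp: through_gates_def)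
  show "emp_cdf n x (z j) - \<epsilon> \<le> y j"
    using assms(1) g(1) ends emp_cdf_le_1[of n x "z m"] eps
    by (cases "j = 0"; cases "j = m") (auto simp: gates_open_def gate_lo_def)
  show "y j \<le> emp_cdf n x (z (j - 1)) + \<epsilon>" if "1 \<le> j"
    using assms(1) g(2) ends that
    by (cases "j = m") (auto simp: gates_open_def gate_hi_def)
qed

text \<open>Over a piece the empirical distribution function is constant, so it is enough that the
  heights at both ends satisfy the bounds for this constant. On the right, the upper bound is the
  gate with its left limit; the other bounds come from the gates too, partly by
  monotonicity.\<close>

lemma polygon_in_tube_bounds:
  assumes "gates_open n x m z \<epsilon>" "through_gates m lo hi y" "z 0 \<le> u" "u \<le> z m"
  shows "\<bar>polygon m z y u - emp_cdf n x u\<bar> \<le> \<epsilon>"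
proof (cases "u = z m")
  case True
  have "1 \<le> m" using assms(1) by (simp add: gates_open_def)
  then show ?thesis using True polygon_knot[OF sample_knots_mono, of m y] through_gates_ends(2)[OF _ assms(2)]
    emp_cdf_right[of "z m"] eps by simp
next
  case False
  have m: "1 \<le> m" using assms(1) by (simp add: gates_open_def)
  define k where "k = Max {j. j \<le> m \<and> z j \<le> u}"
  have "0 \<in> {j. j \<le> m \<and> z j \<le> u}" using assms by simp
  then have "k \<in> {j. j \<le> m \<and> z j \<le> u}" unfolding k_def by (intro Max_in) auto
  then have k: "k \<le> m" "z k \<le> u" by auto
  have "k < m"
  proof (rule ccontr)
    assume "\<not> k < m" then have "k = m" using k by simp
    then show False using k False assms by simp
  qed
  have "u < z (Suc k)"
  proof (rule ccontr)
    assume "\<not> u < z (Suc k)"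
    then have "Suc k \<in> {j. j \<le> m \<and> z j \<le> u}" using \<open>k < m\<close> by simp
    then have "Suc k \<le> k" unfolding k_def by (intro Max_ge) auto
    then show False by simp
  qed
  let ?P = "\<lambda>j. emp_cdf n x (z j)"
  have E: "emp_cdf n x u = ?P k" using emp_cdf_piece[OF \<open>k < m\<close> k(2) \<open>u < z (Suc k)\<close>] .
  have pu: "polygon m z y u = y k + slope_seq m z y (Suc k) * (u - z k)"
    using polygon_piece[OF sample_knots_mono, of "Suc k" u y] \<open>k < m\<close> k \<open>u < z (Suc k)\<close> by simp
  have zz: "z k < z (Suc k)" using knots_less[OF sample_knots_mono, of k "Suc k"] \<open>k < m\<close> by simp
  define \<theta> where "\<theta> = (u - z k) / (z (Suc k) - z k)"
  have \<theta>: "0 \<le> \<theta>" "\<theta> \<le> 1" using k \<open>u < z (Suc k)\<close> zz by (auto simp: \<theta>_def)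
  have pu: "polygon m z y u = (1 - \<theta>) * y k + \<theta> * y (Suc k)"
  proof -
    have "slope_seq m z y (Suc k) * (u - z k) = \<theta> * (y (Suc k) - y k)"
      using \<open>k < m\<close> by (simp add: slope_seq_def \<theta>_def)
    then show ?thesis unfolding pu by (simp add: algebra_simps)
  qed
  have yk: "?P k - \<epsilon> \<le> y k" "?P k - \<epsilon> \<le> y (Suc k)" "y k \<le> ?P k + \<epsilon>" "y (Suc k) \<le> ?P k + \<epsilon>"
  proof -
    show "?P k - \<epsilon> \<le> y k" using through_gates_bounds(1)[OF assms(1,2) k(1)] .
    have "?P k \<le> ?P (Suc k)" using zz by (intro emp_cdf_mono) simp
    then show "?P k - \<epsilon> \<le> y (Suc k)" using through_gates_bounds(1)[OF assms(1,2), of "Suc k"] \<open>k < m\<close> by simp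
    show "y (Suc k) \<le> ?P k + \<epsilon>" using through_gates_bounds(2)[OF assms(1,2), of "Suc k"] \<open>k < m\<close> by simp
    show "y k \<le> ?P k + \<epsilon>"
    proof (cases "k = 0")
      case True
      then show ?thesis using through_gates_ends(1)[OF m assms(2)] eps emp_cdf_nonneg[of n x "z k"] by simp
    next
      case False
      have "?P (k - 1) \<le> ?P k" using knots_le[OF sample_knots_mono, of "k - 1" k] k by (intro emp_cdf_mono) simp
      then show ?thesis using through_gates_bounds(2)[OF assms(1,2) k(1)] False by simp
    qed
  qed
  have "(1 - \<theta>) * (?P k - \<epsilon>) + \<theta> * (?P k - \<epsilon>) \<le> polygon m z y u"
    unfolding pu using yk \<theta> by (intro add_mono mult_left_mono) auto
  moreover have "polygon m z y u \<le> (1 - \<theta>) * (?P k + \<epsilon>) + \<theta> * (?P k + \<epsilon>)"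
    unfolding pu using yk \<theta> by (intro add_mono mult_left_mono) auto
  ultimately show ?thesis unfolding E by (simp add: algebra_simps)
qed

lemma polygon_in_tube:
  assumes "gates_open n x m z \<epsilon>" "through_gates m lo hi y"
  shows "in_tube (graph_curve (z 0) (z m) (polygon m z y))"
proof -
  have m: "1 \<le> m" using assms(1) by (simp add: gates_open_def)
  have le: "z 0 \<le> z m" using knots_le[OF sample_knots_mono, of 0 m] by simp
  have "continuous_on {0..1} (graph_curve (z 0) (z m) (polygon m z y))"
    unfolding graph_curve_def polygon_def progress_def linepath_def
    by (intro continuous_intros)
  moreover have "z 0 \<le> linepath (z 0) (z m) r" "linepath (z 0) (z m) r \<le> z m" if "r \<in> {0..1}" for r
  proof -
    have "linepath (z 0) (z m) r \<in> closed_segment (z 0) (z m)"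
      using that by (intro linepath_in_path) auto
    then show "z 0 \<le> linepath (z 0) (z m) r" "linepath (z 0) (z m) r \<le> z m"
      using le by (auto simp: closed_segment_eq_real_ivl)
  qed
  moreover have "emp_cdf n x u - \<epsilon> \<le> polygon m z y u" "polygon m z y u \<le> emp_cdf n x u + \<epsilon>"
    if "z 0 \<le> u" "u \<le> z m" for u
    using polygon_in_tube_bounds[OF assms that] by linarith+
  ultimately show ?thesis
    unfolding tube_curve_def path_def pathstart_def pathfinish_def path_image_def
    using polygon_knot[OF sample_knots_mono, of 0 y] polygon_knot[OF sample_knots_mono, of m y] through_gates_ends[OF m assms(2)]
    by (auto simp: graph_curve_def linepath_0' linepath_1')
qed

end

text \<open>The increments of the arc length function \<open>A\<close> majorise the distances
  between points of the graph, and they telescope along any partition.\<close>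

lemma graph_polygon_length_le:
  "curve_length (graph_curve (z 0) (z m) (polygon m z y)) \<le> ereal (polygon_length m z y)"
proof -
  define v where "v = slope_seq m z y"
  \<comment> \<open>The length of the part of the polygon to the left of \<open>u\<close>: a piece
    of slope \<open>v j\<close> contributes \<open>norm (1, v j)\<close> per unit of
    progress.\<close>
  define A where "A u = (\<Sum>j=1..m. norm (1 :: real, v j) * progress z j u)" for u
  define \<gamma> where "\<gamma> = graph_curve (z 0) (z m) (polygon m z y)"
  define L where "L = linepath (z 0) (z m)"
  have le: "z 0 \<le> z m" using knots_le[OF sample_knots_mono, of 0 m] by simp
  have L: "L r \<in> {z 0..z m}" if "r \<in> {0..1}" for r
  proof -
    have "L r \<in> closed_segment (z 0) (z m)" unfolding L_def using that by (intro linepath_in_path) auto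
    then show ?thesis using le by (auto simp: closed_segment_eq_real_ivl)
  qed
  have Lmono: "L r \<le> L s" if "r \<le> s" for r s
  proof -
    have "L s - L r = (s - r) * (z m - z 0)" by (simp add: L_def linepath_def algebra_simps)
    moreover have "0 \<le> (s - r) * (z m - z 0)" using that le by (intro mult_nonneg_nonneg) auto
    ultimately show ?thesis by linarith
  qed
  have id: "u = z 0 + (\<Sum>j=1..m. progress z j u)" if "u \<in> {z 0..z m}" for u
    using sum_progress[OF sample_knots_mono, of u] that by simp
  have dist_le: "dist (\<gamma> r) (\<gamma> s) \<le> A (L s) - A (L r)" if "r \<in> {0..1}" "s \<in> {0..1}" "r \<le> s" for r s
  proof -
    have "L s - L r = (\<Sum>j=1..m. progress z j (L s) - progress z j (L r))"
      using id[OF L[OF that(1)]] id[OF L[OF that(2)]] by (simp add: sum_subtractf)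
    then have eq: "\<gamma> s - \<gamma> r = (\<Sum>j=1..m. (progress z j (L s) - progress z j (L r)) *\<^sub>R (1 :: real, v j))"
      using polygon_diff[OF sample_knots_mono, of y "L s" "L r"]
      by (simp add: \<gamma>_def graph_curve_def L_def[symmetric] v_def prod_eq_iff fst_sum snd_sum mult.commute)
    have "dist (\<gamma> r) (\<gamma> s) = norm (\<gamma> s - \<gamma> r)"
      by (subst dist_commute) (rule dist_norm)
    also note eq
    also have "norm (\<Sum>j=1..m. (progress z j (L s) - progress z j (L r)) *\<^sub>R (1 :: real, v j)) \<le> (\<Sum>j=1..m. norm ((progress z j (L s) - progress z j (L r)) *\<^sub>R (1 :: real, v j)))"
      by (rule norm_sum)
    also have "\<dots> = (\<Sum>j=1..m. (progress z j (L s) - progress z j (L r)) * norm (1 :: real, v j))"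
      using progress_mono[OF sample_knots_mono Lmono[OF that(3)]] by (intro sum.cong refl) (simp only: norm_scaleR, simp)
    also have "\<dots> = A (L s) - A (L r)"
      by (simp add: A_def sum_subtractf algebra_simps)
    finally show ?thesis .
  qed
  have Amono: "A p \<le> A q" if "p \<le> q" for p q
    unfolding A_def using progress_mono[OF sample_knots_mono that] by (intro sum_mono mult_left_mono) auto
  have total: "A (z m) - A (z 0) = polygon_length m z y"
  proof -
    have "norm (1 :: real, v j) * progress z j (z m) - norm (1 :: real, v j) * progress z j (z 0) =
        norm (z j - z (j - 1), y j - y (j - 1))" if "j \<in> {1..m}" for j
    proof -
      have j: "1 \<le> j" "j \<le> m" using that by auto
      have zj: "z (j - 1) \<le> z j" "z j \<le> z m" using j by (auto intro!: knots_le[OF sample_knots_mono])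
      have "(z j - z (j - 1), y j - y (j - 1)) = (z j - z (j - 1)) *\<^sub>R (1 :: real, v j)"
        using slope_seq_mult[OF sample_knots_mono j, of y] by (simp add: v_def mult.commute)
      then have "norm (z j - z (j - 1), y j - y (j - 1)) = (z j - z (j - 1)) * norm (1 :: real, v j)"
        using zj by (simp only: norm_scaleR; simp)
      moreover have "progress z j (z m) = z j - z (j - 1)" using zj by (simp add: progress_def)
      moreover have "progress z j (z 0) = 0" using progress_left[OF sample_knots_mono _ j] by simp
      ultimately show ?thesis by simp
    qed
    then show ?thesis unfolding A_def polygon_length_def sum_subtractf[symmetric]
      by (intro sum.cong refl) auto
  qed
  have "(\<Sum>i<length ts - 1. dist (\<gamma> (ts ! i)) (\<gamma> (ts ! Suc i))) \<le> polygon_length m z y"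
    if "sorted ts" "set ts \<subseteq> {0..1}" for ts
  proof (cases "length ts - 1")
    case 0
    then show ?thesis by (simp add: polygon_length_def sum_nonneg)
  next
    case (Suc N)
    have ts: "ts ! i \<in> {0..1}" if "i \<le> Suc N" for i
    proof -
      have "ts ! i \<in> set ts" using that Suc by (intro nth_mem) linarith
      then show ?thesis using \<open>set ts \<subseteq> {0..1}\<close> by blast
    qed
    have "dist (\<gamma> (ts ! i)) (\<gamma> (ts ! Suc i)) \<le> A (L (ts ! Suc i)) - A (L (ts ! i))" if "i < Suc N" for i
      using that Suc \<open>sorted ts\<close> by (intro dist_le ts) (auto simp: sorted_iff_nth_mono)
    then have "(\<Sum>i<Suc N. dist (\<gamma> (ts ! i)) (\<gamma> (ts ! Suc i))) \<le>
        (\<Sum>i<Suc N. A (L (ts ! Suc i)) - A (L (ts ! i)))" by (intro sum_mono) simp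
    also have "\<dots> = A (L (ts ! Suc N)) - A (L (ts ! 0))" by (rule sum_lessThan_telescope)
    also have "\<dots> \<le> A (z m) - A (z 0)"
      using L[OF ts[of "Suc N"]] L[OF ts[of 0]] by (intro diff_mono Amono) auto
    finally show ?thesis using total Suc by simp
  qed
  then show ?thesis
    unfolding curve_length_def \<gamma>_def[symmetric] by (intro SUP_least) auto
qed

text \<open>The heights of \<open>S\<close> at the knots form a polygon no longer than the graph,
  hence a minimiser, and so equal \<open>y\<close>. The polygon with the point above
  \<open>u\<close> as an additional vertex is still no longer than the graph; so equality holds in
  the triangle inequality, and the point lies on a side of the polygon.\<close>

lemma in_tube_graph_taut:
  assumes eps: "0 < \<epsilon>" and m: "1 \<le> m" and y: "taut_polygon m z (gate_lo n x m z \<epsilon>) (gate_hi n x m z \<epsilon>) y"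
    and S: "tube_curve (\<lambda>y. emp_cdf n x y - \<epsilon>) (\<lambda>y. emp_cdf n x y + \<epsilon>) (z 0, 0) (z m, 1)
      (graph_curve (z 0) (z m) S)"
    and len: "curve_length (graph_curve (z 0) (z m) S) \<le> ereal (polygon_length m z y)"
    and u: "z 0 \<le> u" "u \<le> z m"
  shows "S u = polygon m z y u"
proof -
  let ?\<gamma> = "graph_curve (z 0) (z m) S"
  have less: "z 0 < z m" using knots_less[OF sample_knots_mono, of 0 m] m by simp
  define \<tau> where "\<tau> v = (v - z 0) / (z m - z 0)" for v
  have \<tau>: "?\<gamma> (\<tau> v) = (v, S v)" for v
  proof -
    have "linepath (z 0) (z m) (\<tau> v) = z 0 + \<tau> v * (z m - z 0)" by (simp add: linepath_def algebra_simps)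
    also have "\<dots> = v" using less by (simp add: \<tau>_def)
    finally show ?thesis by (simp add: graph_curve_def)
  qed
  have \<tau>01: "\<tau> v \<in> {0..1}" if "z 0 \<le> v" "v \<le> z m" for v
    using less that by (simp add: \<tau>_def)
  have \<tau>mono: "\<tau> v \<le> \<tau> w" if "v \<le> w" for v w
    using less that by (simp add: \<tau>_def divide_right_mono)
  have length_ge: "(\<Sum>i<N. dist (\<sigma> i, S (\<sigma> i)) (\<sigma> (Suc i), S (\<sigma> (Suc i)))) \<le> polygon_length m z y"
    if "\<And>i j. i \<le> j \<Longrightarrow> j \<le> N \<Longrightarrow> \<sigma> i \<le> \<sigma> j" "\<And>i. i \<le> N \<Longrightarrow> z 0 \<le> \<sigma> i \<and> \<sigma> i \<le> z m" for N \<sigma>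
  proof -
    have "ereal (\<Sum>i<N. dist (?\<gamma> (\<tau> (\<sigma> i))) (?\<gamma> (\<tau> (\<sigma> (Suc i))))) \<le> curve_length ?\<gamma>"
      using that by (intro curve_length_ge[of N "\<lambda>i. \<tau> (\<sigma> i)"] \<tau>01 \<tau>mono) auto
    also note len
    finally show ?thesis by (simp add: \<tau>)
  qed
  define y' where "y' j = (if j \<le> m then S (z j) else 0)" for j
  note gates = graph_in_tube_gates[OF eps m S]
  have y': "through_gates m (gate_lo n x m z \<epsilon>) (gate_hi n x m z \<epsilon>) y'"
    using gates m by (auto simp: through_gates_def y'_def gate_lo_def gate_hi_def)
  have "polygon_length m z y' \<le> polygon_length m z y"
    using length_ge[of m z] knots_le[OF sample_knots_mono] by (simp add: polygon_length_dist y'_def)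
  then have "taut_polygon m z (gate_lo n x m z \<epsilon>) (gate_hi n x m z \<epsilon>) y'"
    using y y' unfolding taut_polygon_def by (meson order_trans)
  then have yy': "y = y'"
    using taut_polygon_unique[OF sample_knots_mono _ y] by (simp add: gate_lo_def gate_hi_def)
  have ySz: "y j = S (z j)" if "j \<le> m" for j using that by (simp add: yy' y'_def)
  define j where "j = piece_index m z u"
  have j: "1 \<le> j" "j \<le> m"
    using less_piece_index[OF sample_knots_mono, of 0 u] less_piece_index[OF sample_knots_mono, of m u] u m less by (auto simp: j_def)
  have "j - 1 \<le> m" "j - 1 < j" using j by auto
  then have zu: "z (j - 1) \<le> u" "u \<le> z j"
    using less_piece_index[OF sample_knots_mono, of "j - 1" u] less_piece_index[OF sample_knots_mono, of j u] j
    unfolding j_def[symmetric] by auto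
  define i where "i = j - 1"
  have ij: "j = Suc i" "i < m" using j by (auto simp: i_def)
  \<comment> \<open>The knots with \<open>u\<close> inserted after position \<open>i\<close>; later
    knots are shifted by one.\<close>
  define \<sigma> where "\<sigma> k = (if k \<le> i then z k else if k = Suc i then u else z (k - 1))" for k
  have "(\<Sum>k<Suc m. dist (\<sigma> k, S (\<sigma> k)) (\<sigma> (Suc k), S (\<sigma> (Suc k)))) \<le> polygon_length m z y"
  proof (rule length_ge)
    have step: "\<sigma> k \<le> \<sigma> (Suc k)" if "k \<le> m" for k
    proof -
      consider "k < i" | "k = i" | "k = Suc i" | "Suc i < k" by (meson not_less_eq linorder_neqE_nat)
      then show ?thesis
      proof cases
        case 1 then show ?thesis using that ij knots_le[OF sample_knots_mono, of k "Suc k"] by (simp add: \<sigma>_def)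
      next
        case 2 then show ?thesis using ij zu by (simp add: \<sigma>_def)
      next
        case 3 then show ?thesis using ij zu by (simp add: \<sigma>_def)
      next
        case 4 then show ?thesis using that knots_le[OF sample_knots_mono, of "k - 1" k] by (simp add: \<sigma>_def)
      qed
    qed
    show "\<sigma> k \<le> \<sigma> l" if "k \<le> l" "l \<le> Suc m" for k l
      using that
    proof (induction l rule: dec_induct)
      case (step l)
      then show ?case using \<open>\<And>k. k \<le> m \<Longrightarrow> \<sigma> k \<le> \<sigma> (Suc k)\<close>[of l] by simp
    qed simp
    show "z 0 \<le> \<sigma> k \<and> \<sigma> k \<le> z m" if "k \<le> Suc m" for k
      using that ij u knots_le[OF sample_knots_mono, of 0 k] knots_le[OF sample_knots_mono, of k m]
        knots_le[OF sample_knots_mono, of 0 "k - 1"] knots_le[OF sample_knots_mono, of "k - 1" m]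
      by (auto simp: \<sigma>_def)
  qed
  moreover have "(\<Sum>k<Suc m. dist (\<sigma> k, S (\<sigma> k)) (\<sigma> (Suc k), S (\<sigma> (Suc k)))) =
     (\<Sum>k<i. dist (z k, y k) (z (Suc k), y (Suc k))) +
     (dist (z i, y i) (u, S u) + dist (u, S u) (z j, y j)) +
     (\<Sum>k\<in>{Suc i..<m}. dist (z k, y k) (z (Suc k), y (Suc k)))"
  proof -
    let ?d = "\<lambda>k. dist (\<sigma> k, S (\<sigma> k)) (\<sigma> (Suc k), S (\<sigma> (Suc k)))"
    have "{..<Suc m} = {..<i} \<union> {i, Suc i} \<union> {Suc (Suc i)..<Suc m}" using ij by auto
    then have "(\<Sum>k<Suc m. ?d k) = sum ?d ({..<i} \<union> {i, Suc i} \<union> {Suc (Suc i)..<Suc m})"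
      by (rule arg_cong)
    also have "\<dots> = sum ?d ({..<i} \<union> {i, Suc i}) + sum ?d {Suc (Suc i)..<Suc m}"
      by (rule sum.union_disjoint) auto
    also have "sum ?d ({..<i} \<union> {i, Suc i}) = (\<Sum>k<i. ?d k) + sum ?d {i, Suc i}"
      by (rule sum.union_disjoint) auto
    also have "sum ?d {i, Suc i} = ?d i + ?d (Suc i)" by simp
    also have "(\<Sum>k\<in>{Suc (Suc i)..<Suc m}. ?d k) = (\<Sum>k\<in>{Suc i..<m}. ?d (Suc k))"
      by (rule sum.shift_bounds_Suc_ivl)
    also have "(\<Sum>k\<in>{Suc i..<m}. ?d (Suc k)) = (\<Sum>k\<in>{Suc i..<m}. dist (z k, y k) (z (Suc k), y (Suc k)))"
      by (intro sum.cong refl) (auto simp: \<sigma>_def ySz)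
    also have "(\<Sum>k<i. ?d k) = (\<Sum>k<i. dist (z k, y k) (z (Suc k), y (Suc k)))"
      using ij by (intro sum.cong refl) (auto simp: \<sigma>_def ySz)
    also have "?d i = dist (z i, y i) (u, S u)" using ij by (simp add: \<sigma>_def ySz)
    also have "?d (Suc i) = dist (u, S u) (z j, y j)" using ij by (simp add: \<sigma>_def ySz)
    finally show ?thesis .
  qed
  moreover have "polygon_length m z y =
     (\<Sum>k<i. dist (z k, y k) (z (Suc k), y (Suc k))) + dist (z i, y i) (z j, y j) +
     (\<Sum>k\<in>{Suc i..<m}. dist (z k, y k) (z (Suc k), y (Suc k)))"
  proof -
    let ?d = "\<lambda>k. dist (z k, y k) (z (Suc k), y (Suc k))"
    have "{..<m} = {..<Suc i} \<union> {Suc i..<m}" using ij by auto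
    then have "sum ?d {..<m} = sum ?d ({..<Suc i} \<union> {Suc i..<m})" by (rule arg_cong)
    also have "\<dots> = sum ?d {..<Suc i} + sum ?d {Suc i..<m}" by (rule sum.union_disjoint) auto
    finally show ?thesis unfolding polygon_length_dist ij(1) by simp
  qed
  ultimately have "dist (z i, y i) (u, S u) + dist (u, S u) (z j, y j) \<le> dist (z i, y i) (z j, y j)"
    by linarith
  then have "dist (z i, y i) (z j, y j) = dist (z i, y i) (u, S u) + dist (u, S u) (z j, y j)"
    using dist_triangle[of "(z i, y i)" "(z j, y j)" "(u, S u)"] by linarith
  then have "(u, S u) \<in> closed_segment (z i, y i) (z j, y j)"
    unfolding between_mem_segment[symmetric] between .
  then obtain s where s: "u = (1 - s) * z i + s * z j" "S u = (1 - s) * y i + s * y j"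
    by (auto simp: closed_segment_def)
  have zz: "z i < z j" using knots_less[OF sample_knots_mono, of i j] ij by simp
  have "u - z i = s * (z j - z i)" unfolding s(1) by (simp add: algebra_simps)
  then have "(y j - y i) / (z j - z i) * (u - z i) = s * (y j - y i)" using zz by simp
  then show ?thesis
    using polygon_piece[OF sample_knots_mono j zu, of y] j s(2) by (simp add: slope_seq_def i_def algebra_simps)
qed

text \<open>The string is a choice among shortest graphs. The polygon is one of them, since every
  curve in the tube has an inscribed polygon through the gates; and all of them agree with it over
  the range of the sample.\<close>

lemma emp_taut_string_polygon:
  assumes eps: "0 < \<epsilon>" and open_gates: "gates_open n x m z \<epsilon>"
    and y: "taut_polygon m z (gate_lo n x m z \<epsilon>) (gate_hi n x m z \<epsilon>) y"
    and u: "z 0 \<le> u" "u \<le> z m"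
  shows "emp_taut_string \<epsilon> n x u = polygon m z y u"
proof -
  have m: "1 \<le> m" using open_gates by (simp add: gates_open_def)
  let ?P = "polygon m z y"
  have "is_emp_taut_string \<epsilon> n x ?P"
    unfolding is_taut_string_def sample_min_knots sample_max_knots fst_conv
  proof (intro conjI allI impI)
    show "tube_curve (\<lambda>y. emp_cdf n x y - \<epsilon>) (\<lambda>y. emp_cdf n x y + \<epsilon>) (z 0, 0) (z m, 1)
      (graph_curve (z 0) (z m) ?P)"
      by (rule polygon_in_tube[OF eps open_gates taut_polygonD(3)[OF y]])
    fix \<gamma> assume "tube_curve (\<lambda>y. emp_cdf n x y - \<epsilon>) (\<lambda>y. emp_cdf n x y + \<epsilon>) (z 0, 0) (z m, 1) \<gamma>"
    from in_tube_length_ge[OF eps m this] obtain y' where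
      y': "through_gates m (gate_lo n x m z \<epsilon>) (gate_hi n x m z \<epsilon>) y'"
        "ereal (polygon_length m z y') \<le> curve_length \<gamma>" by blast
    have "curve_length (graph_curve (z 0) (z m) ?P) \<le> ereal (polygon_length m z y)"
      by (rule graph_polygon_length_le)
    also have "\<dots> \<le> ereal (polygon_length m z y')" using taut_polygonD(4)[OF y y'(1)] by simp
    also note y'(2)
    finally show "curve_length (graph_curve (z 0) (z m) ?P) \<le> curve_length \<gamma>" .
  qed
  then have ex: "\<exists>S. is_emp_taut_string \<epsilon> n x S" by (rule exI[of _ ?P])
  define S where "S = emp_taut_string \<epsilon> n x"
  have "S = (SOME S. is_emp_taut_string \<epsilon> n x S)" unfolding S_def emp_taut_string_def using ex by simp
  then have S: "is_emp_taut_string \<epsilon> n x S" using someI_ex[OF ex] by simp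
  then have Stube: "tube_curve (\<lambda>y. emp_cdf n x y - \<epsilon>) (\<lambda>y. emp_cdf n x y + \<epsilon>) (z 0, 0) (z m, 1)
      (graph_curve (z 0) (z m) S)"
    unfolding is_taut_string_def sample_min_knots sample_max_knots by simp
  have "curve_length (graph_curve (z 0) (z m) S) \<le> curve_length (graph_curve (z 0) (z m) ?P)"
    using S polygon_in_tube[OF eps open_gates taut_polygonD(3)[OF y]]
    unfolding is_taut_string_def sample_min_knots sample_max_knots by simp
  also have "\<dots> \<le> ereal (polygon_length m z y)" by (rule graph_polygon_length_le)
  finally show ?thesis using in_tube_graph_taut[OF eps m y Stube _ u] by (simp add: S_def)
qed

lemma no_emp_taut_string:
  assumes eps: "0 < \<epsilon>" and "\<not> gates_open n x m z \<epsilon>"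
  shows "emp_taut_string \<epsilon> n x = (\<lambda>_. 0)"
proof -
  have "\<not> is_emp_taut_string \<epsilon> n x S" for S
  proof
    assume "is_emp_taut_string \<epsilon> n x S"
    then have S: "tube_curve (\<lambda>y. emp_cdf n x y - \<epsilon>) (\<lambda>y. emp_cdf n x y + \<epsilon>) (z 0, 0) (z m, 1)
      (graph_curve (z 0) (z m) S)"
      unfolding is_taut_string_def sample_min_knots sample_max_knots by simp
    \<comment> \<open>With a single distinct observation the curve would have to be at heights 0 and
      1 above the same point.\<close>
    have "m \<noteq> 0"
    proof
      assume "m = 0"
      then show False using tube_curve_imp(2,3)[OF S] by (simp add: graph_curve_def)
    qed
    then have m: "1 \<le> m" by simp
    note g = graph_in_tube_gates[OF eps m S]
    have "gates_open n x m z \<epsilon>" by (rule gates_openI[OF eps m g])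
    with assms(2) show False by simp
  qed
  then show ?thesis by (simp add: emp_taut_string_def)
qed

text \<open>Nothing is known about the chosen string outside the range of the sample. So derivatives
  are taken within a closed interval that lies in one piece and on one side of \<open>u\<close>;
  near \<open>u\<close> it determines the one-sided filter.\<close>

lemma string_deriv_step_fun:
  assumes "0 < C / sqrt n" and open_gates: "gates_open n x m z (C / sqrt n)"
    and y: "taut_polygon m z (gate_lo n x m z (C / sqrt n)) (gate_hi n x m z (C / sqrt n)) y"
  shows "string_deriv C n x = step_fun m z (slope_seq m z y)"
proof
  fix u
  define S where "S = emp_taut_string (C / sqrt n) n x"
  have m: "1 \<le> m" using open_gates by (simp add: gates_open_def)
  have SP: "S v = polygon m z y v" if "z 0 \<le> v" "v \<le> z m" for v
    unfolding S_def using emp_taut_string_polygon[OF assms that] .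
  have deriv: "(S has_vector_derivative slope_seq m z y j) (at u within A)"
    if j: "1 \<le> j" "j \<le> m" and A: "A \<subseteq> {z (j - 1)..z j}" "u \<in> A" for j A
  proof -
    have Sv: "S v = y (j - 1) + slope_seq m z y j * (v - z (j - 1))" if "v \<in> A" for v
    proof -
      have v: "z (j - 1) \<le> v" "v \<le> z j" using that A by auto
      moreover have "z 0 \<le> z (j - 1)" "z j \<le> z m" using j by (auto intro!: knots_le[OF sample_knots_mono])
      ultimately show ?thesis using SP[of v] polygon_piece[OF sample_knots_mono j v, of y] by simp
    qed
    have "((\<lambda>v. y (j - 1) + slope_seq m z y j * (v - z (j - 1))) has_vector_derivative slope_seq m z y j) (at u within A)"
      by (auto intro!: derivative_eq_intros simp flip: has_real_derivative_iff_has_vector_derivative)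
    then show ?thesis
      by (rule has_vector_derivative_transform[OF A(2), rotated]) (rule Sv)
  qed
  have unfold: "string_deriv C n x u = (if u = z 0 then vector_derivative S (at_right u)
      else if z 0 < u \<and> u \<le> z m then vector_derivative S (at_left u) else 0)"
    unfolding string_deriv_def sample_min_knots sample_max_knots S_def Let_def ..
  consider "u = z 0" | "z 0 < u" "u \<le> z m" | "u < z 0" | "z m < u" by linarith
  then show "string_deriv C n x u = step_fun m z (slope_seq m z y) u"
  proof cases
    case 1
    have z01: "z 0 < z 1" using knots_less[OF sample_knots_mono, of 0 1] m by simp
    have "(S has_vector_derivative slope_seq m z y 1) (at u within {z 0..z 1})"
      using deriv[of 1 "{z 0..z 1}"] m 1 z01 by simp
    then have "(S has_vector_derivative slope_seq m z y 1) (at_right u)"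
      unfolding 1 using at_within_Icc_at_right[OF z01] by simp
    then have "vector_derivative S (at_right u) = slope_seq m z y 1"
      by (intro vector_derivative_within) auto
    then show ?thesis unfolding unfold using 1 by (simp add: step_fun_def piece_index_def)
  next
    case 2
    define j where "j = piece_index m z u"
    have j: "1 \<le> j" "j \<le> m"
      using less_piece_index[OF sample_knots_mono, of 0 u] less_piece_index[OF sample_knots_mono, of m u] 2 by (auto simp: j_def)
    have zu: "z (j - 1) < u" "u \<le> z j"
      using less_piece_index[OF sample_knots_mono, of "j - 1" u] less_piece_index[OF sample_knots_mono, of j u] j 2 by (auto simp: j_def)
    have "(S has_vector_derivative slope_seq m z y j) (at u within {z (j - 1)..u})"
      using deriv[OF j, of "{z (j - 1)..u}"] zu by simp
    then have "(S has_vector_derivative slope_seq m z y j) (at_left u)"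
      using at_within_Icc_at_left[OF zu(1)] by simp
    then have "vector_derivative S (at_left u) = slope_seq m z y j"
      by (intro vector_derivative_within) auto
    then show ?thesis using 2 by (simp add: unfold step_fun_def j_def)
  next
    case 3
    have "u \<noteq> z 0" "\<not> z 0 < u" "piece_index m z u = 0" using 3 piece_index_eq_0_iff[OF sample_knots_mono, of u] by auto
    then show ?thesis by (simp add: unfold step_fun_def slope_seq_def)
  next
    case 4
    then have "u \<noteq> z 0" "\<not> u \<le> z m" "piece_index m z u = Suc m"
      using piece_index_eq_Suc_iff[OF sample_knots_mono m, of u] knots_le[OF sample_knots_mono, of 0 m] by auto
    then show ?thesis by (simp add: unfold step_fun_def slope_seq_def)
  qed
qed

lemma string_deriv_zero:
  assumes "0 < C / sqrt n" and "\<not> gates_open n x m z (C / sqrt n)"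
  shows "string_deriv C n x = (\<lambda>_. 0)"
proof
  fix u
  have "vector_derivative (\<lambda>_. 0 :: real) (at_right v) = 0" for v :: real
    by (intro vector_derivative_within) auto
  moreover have "vector_derivative (\<lambda>_. 0 :: real) (at_left v) = 0" for v :: real
    by (intro vector_derivative_within) auto
  ultimately show "string_deriv C n x u = 0"
    unfolding string_deriv_def no_emp_taut_string[OF assms] Let_def by simp
qed

end

lemma local_extreme_intervals_const_fun: "local_extreme_intervals (\<lambda>_. c) = {}"
proof (rule ccontr)
  assume "local_extreme_intervals (\<lambda>_. c) \<noteq> {}"
  then obtain I where I: "I \<in> local_extreme_intervals (\<lambda>_. c)" by blast
  obtain v where v: "v \<in> I" using local_extreme_intervalsD(2)[OF I] by blast
  obtain w where w: "w \<notin> I" using local_extreme_intervalsD(3)[OF I] by (metis UNIV_eq_I not_bounded_UNIV)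
  obtain u where "c \<noteq> c" using local_extreme_intervals_escape[OF I, of UNIV v w] v w by auto
  then show False by simp
qed

section \<open>Densities\<close>

text \<open>The bounds by \<open>Limsup\<close> and \<open>Liminf\<close> are turned into the form
  that \<open>peak_stable\<close> and \<open>trough_stable\<close> require: the value at
  \<open>t\<close> is approached, or surpassed, at nearby points other than
  \<open>t\<close>.\<close>

lemma regular_extremesD:
  assumes "regular_extremes f"
  shows "monotone_off_extremes f"
    and "c < f t \<Longrightarrow> e > 0 \<Longrightarrow> \<exists>y. y \<noteq> t \<and> \<bar>y - t\<bar> < e \<and> c < f y"
    and "f t < c \<Longrightarrow> e > 0 \<Longrightarrow> \<exists>y. y \<noteq> t \<and> \<bar>y - t\<bar> < e \<and> f y < c"
proof -
  show "monotone_off_extremes f"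
    using assms unfolding regular_extremes_def monotone_off_extremes_def by blast
  have lim: "Liminf (at t) (\<lambda>y. ereal (f y)) \<le> ereal (f t)" "ereal (f t) \<le> Limsup (at t) (\<lambda>y. ereal (f y))"
    using assms unfolding regular_extremes_def by auto
  show "\<exists>y. y \<noteq> t \<and> \<bar>y - t\<bar> < e \<and> c < f y" if "c < f t" "e > 0"
  proof (rule ccontr)
    assume no: "\<not> (\<exists>y. y \<noteq> t \<and> \<bar>y - t\<bar> < e \<and> c < f y)"
    then have "\<forall>\<^sub>F y in at t. ereal (f y) \<le> ereal c"
      unfolding eventually_at using \<open>e > 0\<close> by (intro exI[of _ e]) (auto simp: dist_real_def not_less)
    from order_trans[OF lim(2) Limsup_bounded[OF this]] show False using that by simp
  qed
  show "\<exists>y. y \<noteq> t \<and> \<bar>y - t\<bar> < e \<and> f y < c" if "f t < c" "e > 0"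
  proof (rule ccontr)
    assume no: "\<not> (\<exists>y. y \<noteq> t \<and> \<bar>y - t\<bar> < e \<and> f y < c)"
    then have "\<forall>\<^sub>F y in at t. ereal c \<le> ereal (f y)"
      unfolding eventually_at using \<open>e > 0\<close> by (intro exI[of _ e]) (auto simp: dist_real_def not_less)
    from order_trans[OF Liminf_bounded[OF this] lim(1)] show False using that by simp
  qed
qed

section \<open>Distribution functions of densities\<close>

context
  fixes f :: "real \<Rightarrow> real"
  assumes f: "is_density f"
begin

lemma is_density_measurable: "f \<in> borel_measurable borel"
  using f by (simp add: is_density_def)

lemma is_density_nonneg: "0 \<le> f x"
  using f by (simp add: is_density_def)

lemma prob_space_density: "prob_space (density lborel (\<lambda>x. ennreal (f x)))"
  using f is_density_measurable by (intro prob_spaceI) (simp add: emeasure_density is_density_def)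

lemma real_distribution_density: "real_distribution (density lborel (\<lambda>x. ennreal (f x)))"
  using prob_space_density by (simp add: real_distribution_def real_distribution_axioms_def)

interpretation real_distribution "density lborel (\<lambda>x. ennreal (f x))"
  by (rule real_distribution_density)

lemma density_cdf_mono: "x \<le> y \<Longrightarrow> density_cdf f x \<le> density_cdf f y"
  unfolding density_cdf_def by (rule cdf_nondecreasing)

lemma density_cdf_bounds: "0 \<le> density_cdf f x" "density_cdf f x \<le> 1"
  unfolding density_cdf_def using cdf_nonneg cdf_bounded_prob by auto

lemma isCont_density_cdf: "isCont (density_cdf f) x"
proof -
  note [measurable] = is_density_measurable
  have "emeasure (density lborel (\<lambda>x. ennreal (f x))) {x} = 0"
    by (simp add: emeasure_density nn_integral_0_iff_AE AE_lborel_singleton)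
  then show ?thesis unfolding density_cdf_def isCont_cdf by (simp add: measure_def)
qed

lemma density_cdf_diff:
  assumes "p < q"
  shows "ennreal (density_cdf f q - density_cdf f p) = (\<integral>\<^sup>+x\<in>{p<..<q}. ennreal (f x) \<partial>lborel)"
proof -
  note [measurable] = is_density_measurable
  have "density_cdf f q - density_cdf f p = measure (density lborel (\<lambda>x. ennreal (f x))) {p<..q}"
    unfolding density_cdf_def using cdf_diff_eq[OF assms] .
  then have "ennreal (density_cdf f q - density_cdf f p) = emeasure (density lborel (\<lambda>x. ennreal (f x))) {p<..q}"
    by (simp add: emeasure_eq_measure)
  also have "\<dots> = (\<integral>\<^sup>+x\<in>{p<..q}. ennreal (f x) \<partial>lborel)"
    by (simp add: emeasure_density)
  also have "\<dots> = (\<integral>\<^sup>+x\<in>{p<..<q}. ennreal (f x) \<partial>lborel)"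
    by (intro nn_integral_cong_AE) (use AE_lborel_singleton[of q] in \<open>auto simp: indicator_def\<close>)
  finally show ?thesis .
qed

lemma slope_bounds_density_cdf: "slope_bounds (density_cdf f) f"
  unfolding slope_bounds_def
proof (intro allI impI conjI)
  note [measurable] = is_density_measurable
  fix p q c :: real assume pq: "p < q"
  have const: "(\<integral>\<^sup>+x\<in>{p<..<q}. ennreal c \<partial>lborel) = ennreal (c * (q - p))" if "0 \<le> c"
    using pq that by (simp add: nn_integral_cmult_indicator ennreal_mult)
  { assume le: "\<forall>x\<in>{p<..<q}. f x \<le> c"
    obtain u where "p < u" "u < q" using dense[OF pq] by blast
    then have "f u \<le> c" using le by simp
    then have c: "0 \<le> c" using is_density_nonneg[of u] by linarith
    have "ennreal (density_cdf f q - density_cdf f p) \<le> (\<integral>\<^sup>+x\<in>{p<..<q}. ennreal c \<partial>lborel)"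
      unfolding density_cdf_diff[OF pq] using le
      by (intro nn_integral_mono) (auto simp: indicator_def intro!: ennreal_leI)
    also have "\<dots> = ennreal (c * (q - p))" using c by (rule const)
    finally show "density_cdf f q - density_cdf f p \<le> c * (q - p)"
      using c pq by (simp add: ennreal_le_iff) }
  { assume ge: "\<forall>x\<in>{p<..<q}. c \<le> f x"
    show "c * (q - p) \<le> density_cdf f q - density_cdf f p"
    proof (cases "0 \<le> c")
      case True
      have "ennreal (c * (q - p)) = (\<integral>\<^sup>+x\<in>{p<..<q}. ennreal c \<partial>lborel)" using const[OF True] by simp
      also have "\<dots> \<le> ennreal (density_cdf f q - density_cdf f p)"
        unfolding density_cdf_diff[OF pq] using ge
        by (intro nn_integral_mono) (auto simp: indicator_def intro!: ennreal_leI)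
      finally show ?thesis using density_cdf_mono[of p q] pq by (simp add: ennreal_le_iff)
    next
      case False
      then have "c * (q - p) \<le> 0" using pq by (simp add: mult_nonpos_nonneg)
      then show ?thesis using density_cdf_mono[of p q] pq by simp
    qed }
qed

lemma AE_pos_interval:
  assumes "p < (q :: real)" "AE x in lborel. x \<in> {p<..<q} \<longrightarrow> P x"
  shows "\<exists>x\<in>{p<..<q}. P x"
proof (rule ccontr)
  assume "\<not> ?thesis"
  with assms(2) have "AE x in lborel. x \<notin> {p<..<q}" by (auto elim: eventually_mono)
  then have "emeasure lborel {p<..<q} = 0" by (subst (asm) AE_iff_measurable[of "{p<..<q}"]) auto
  then show False using assms(1) by simp
qed

text \<open>If \<open>f\<close> were below \<open>v\<close> throughout, \<open>slope_bounds\<close>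
  would still permit the increment to be exactly \<open>v * (q - p)\<close>. The strict statement
  needs the integral: \<open>v - f\<close> would be positive on an interval and have integral 0 over
  it.\<close>

lemma density_mean_value_ge:
  assumes pq: "p < q" and ge: "v * (q - p) \<le> density_cdf f q - density_cdf f p"
  shows "\<exists>u\<in>{p<..<q}. v \<le> f u"
proof (rule ccontr)
  note [measurable] = is_density_measurable
  assume "\<not> ?thesis"
  then have less: "f u < v" if "u \<in> {p<..<q}" for u using that by force
  obtain u where "p < u" "u < q" using dense[OF pq] by blast
  then have v: "0 < v" using less[of u] is_density_nonneg[of u] by force
  let ?I = "\<integral>\<^sup>+x\<in>{p<..<q}. ennreal (f x) \<partial>lborel" and ?J = "\<integral>\<^sup>+x\<in>{p<..<q}. ennreal (v - f x) \<partial>lborel"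
  have "?I + ?J = (\<integral>\<^sup>+x. (ennreal (f x) * indicator {p<..<q} x + ennreal (v - f x) * indicator {p<..<q} x) \<partial>lborel)"
    by (rule nn_integral_add[symmetric]) auto
  also have "\<dots> = (\<integral>\<^sup>+x\<in>{p<..<q}. ennreal v \<partial>lborel)"
    using less is_density_nonneg
    by (intro nn_integral_cong) (auto simp: indicator_def ennreal_plus[symmetric] less_imp_le simp del: ennreal_plus)
  also have "\<dots> = ennreal (v * (q - p))"
    using pq v by (simp add: nn_integral_cmult_indicator ennreal_mult)
  also have "\<dots> \<le> ?I"
    unfolding density_cdf_diff[OF pq, symmetric] using ge by (rule ennreal_leI)
  finally have "?I + ?J \<le> ?I + 0" by simp
  moreover have "?I \<noteq> top" unfolding density_cdf_diff[OF pq, symmetric] by simp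
  ultimately have "?J = 0" by (simp add: ennreal_add_left_cancel_le)
  then have "AE x in lborel. ennreal (v - f x) * indicator {p<..<q} x = 0"
    by (subst (asm) nn_integral_0_iff_AE) auto
  then have "AE x in lborel. x \<in> {p<..<q} \<longrightarrow> v - f x \<le> 0"
    by eventually_elim (auto simp: indicator_def ennreal_eq_0_iff split: if_splits)
  from AE_pos_interval[OF pq this] show False using less by force
qed

lemma density_mean_value_le:
  assumes pq: "p < q" and le: "density_cdf f q - density_cdf f p \<le> v * (q - p)"
  shows "\<exists>u\<in>{p<..<q}. f u \<le> v"
proof (rule ccontr)
  note [measurable] = is_density_measurable
  assume "\<not> ?thesis"
  then have less: "v < f u" if "u \<in> {p<..<q}" for u using that by force
  have "0 \<le> v * (q - p)" using density_cdf_mono[of p q] le pq by simp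
  then have v: "0 \<le> v" using pq by (simp add: zero_le_mult_iff)
  let ?I = "\<integral>\<^sup>+x\<in>{p<..<q}. ennreal v \<partial>lborel" and ?J = "\<integral>\<^sup>+x\<in>{p<..<q}. ennreal (f x - v) \<partial>lborel"
  have I: "?I = ennreal (v * (q - p))"
    using pq v by (simp add: nn_integral_cmult_indicator ennreal_mult)
  have "?I + ?J = (\<integral>\<^sup>+x. (ennreal v * indicator {p<..<q} x + ennreal (f x - v) * indicator {p<..<q} x) \<partial>lborel)"
    by (rule nn_integral_add[symmetric]) auto
  also have "\<dots> = (\<integral>\<^sup>+x\<in>{p<..<q}. ennreal (f x) \<partial>lborel)"
    using less v
    by (intro nn_integral_cong) (auto simp: indicator_def ennreal_plus[symmetric] less_imp_le simp del: ennreal_plus)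
  also have "\<dots> \<le> ?I"
    unfolding density_cdf_diff[OF pq, symmetric] I using le by (rule ennreal_leI)
  finally have "?I + ?J \<le> ?I + 0" by simp
  moreover have "?I \<noteq> top" unfolding I by simp
  ultimately have "?J = 0" by (simp add: ennreal_add_left_cancel_le)
  then have "AE x in lborel. ennreal (f x - v) * indicator {p<..<q} x = 0"
    by (subst (asm) nn_integral_0_iff_AE) auto
  then have "AE x in lborel. x \<in> {p<..<q} \<longrightarrow> f x - v \<le> 0"
    by eventually_elim (auto simp: indicator_def ennreal_eq_0_iff split: if_splits)
  from AE_pos_interval[OF pq this] show False using less by force
qed

text \<open>On an interval of length \<open>2 / c\<close> a density that is at least
  \<open>c\<close> would have mass 2. So there are small values arbitrarily far out on both sides,
  although \<open>f\<close> need not tend to 0.\<close>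

lemma density_small_in_interval:
  assumes "0 < c"
  shows "\<exists>u. a < u \<and> u < a + 2 / c \<and> f u < c"
proof (rule ccontr)
  assume no: "\<not> ?thesis"
  have "c * (a + 2 / c - a) \<le> density_cdf f (a + 2 / c) - density_cdf f a"
    using assms by (intro slope_bounds_ge[OF slope_bounds_density_cdf], simp, use no in \<open>meson not_less\<close>)
  then have "2 \<le> density_cdf f (a + 2 / c) - density_cdf f a" using assms by simp
  then show False using density_cdf_bounds[of "a + 2 / c"] density_cdf_bounds[of a] by linarith
qed

lemma density_small_left: "0 < c \<Longrightarrow> \<exists>u<a. f u < c"
  using density_small_in_interval[of c "a - 2 / c"] by auto

lemma density_small_right: "0 < c \<Longrightarrow> \<exists>u>a. f u < c"
  using density_small_in_interval[of c a] by auto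

end

section \<open>Comparison of the string with the distribution function\<close>

lemma sample_knots_exist:
  assumes "0 < n"
  obtains m z where "sample_knots n x m z"
proof -
  have fin: "finite (x ` {..<n})" by simp
  obtain z where z: "bij_betw z {..<card (x ` {..<n})} (x ` {..<n})" "strict_mono_on {..<card (x ` {..<n})} z"
    using ex_strict_mono_enumeration[OF fin] .
  have "card (x ` {..<n}) \<noteq> 0" using assms by (auto simp: lessThan_empty_iff)
  then obtain m where "card (x ` {..<n}) = Suc m" by (metis not0_implies_Suc)
  then show ?thesis
    using that z unfolding sample_knots_def bij_betw_def by (simp add: lessThan_Suc_atMost) blast
qed

lemma isCont_le_from_left:
  fixes F :: "real \<Rightarrow> real"
  assumes "isCont F a" "b < a" "\<And>y. b < y \<Longrightarrow> y < a \<Longrightarrow> F y \<le> c"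
  shows "F a \<le> c"
proof (rule tendsto_upperbound)
  show "(F \<longlongrightarrow> F a) (at_left a)"
    using assms(1) unfolding isCont_def by (rule tendsto_within_subset) simp
  show "\<forall>\<^sub>F y in at_left a. F y \<le> c"
    using eventually_at_left_real[OF assms(2)] by eventually_elim (use assms(3) in auto)
qed simp

lemma Inf_Sup_bounds:
  fixes J :: "real set"
  assumes "J \<noteq> {}" "J \<subseteq> {a<..<b}"
  shows "a \<le> Inf J" "Inf J \<le> Sup J" "Sup J \<le> b"
proof -
  have bdd: "bdd_below J" "bdd_above J"
    using assms(2) bdd_below_mono[of "{a<..<b}" J] bdd_above_mono[of "{a<..<b}" J] by auto
  show "a \<le> Inf J" using assms by (intro cInf_greatest) auto
  show "Sup J \<le> b" using assms by (intro cSup_least) auto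
  show "Inf J \<le> Sup J" using bdd assms(1) by (intro cInf_le_cSup) auto
qed

text \<open>
  If every local extreme of \<open>h\<close> contains a point where \<open>f\<close> is at least as extreme as \<open>h\<close>, up to a
  factor, then these points alternate.
\<close>

lemma card_extremes_le:
  fixes f h :: "real \<Rightarrow> real"
  assumes f: "monotone_off_extremes f" "finite (local_extreme_intervals f)"
    "\<And>I. I \<in> local_extreme_intervals f \<Longrightarrow> \<exists>x. I = {x}"
    and f_nonneg: "\<And>u. 0 \<le> f u"
    and small: "\<And>a c. 0 < c \<Longrightarrow> \<exists>u<a. f u < c" "\<And>a c. 0 < c \<Longrightarrow> \<exists>u>a. f u < c"
    and h: "monotone_off_extremes h" and fin: "finite (local_extreme_intervals h)"
    and zero: "\<And>u. u < A \<Longrightarrow> h u = 0" "\<And>u. u > B \<Longrightarrow> h u = 0"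
    and "0 < \<kappa>"
    and max: "\<And>I v. local_max_interval h I \<Longrightarrow> v \<in> I \<Longrightarrow> \<exists>u\<in>I. \<kappa> * h v \<le> f u"
    and min: "\<And>I v. local_min_interval h I \<Longrightarrow> v \<in> I \<Longrightarrow> \<exists>u\<in>I. f u \<le> \<kappa> * h v"
  shows "card (local_extreme_intervals h) \<le> card (local_extreme_intervals f)"
proof -
  define E where "E = local_extreme_intervals h"
  define m where "m = card E"
  obtain p I where p: "strict_mono_on {1..m} p" and I: "bij_betw I {1..m} E"
    and pI: "\<And>j. j \<in> {1..m} \<Longrightarrow> p j \<in> I j"
    by (rule enumerate_extremes[OF fin, of m]) (simp_all add: m_def E_def)
  have IE: "I j \<in> local_extreme_intervals h" if "j \<in> {1..m}" for j
    using I that by (auto simp: bij_betw_def E_def)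
  have Ineq: "I i \<noteq> I j" if "i \<in> {1..m}" "j \<in> {1..m}" "i \<noteq> j" for i j
    using inj_onD[OF bij_betw_imp_inj_on[OF I]] that by blast
  have KI: "\<exists>i\<in>{1..m}. K = I i" if "K \<in> local_extreme_intervals h" for K
    using I that by (auto simp: bij_betw_def E_def)
  have min_nonneg: "0 \<le> h v" if K: "local_min_interval h K" "v \<in> K" for K v
  proof -
    obtain u where "f u \<le> \<kappa> * h v" using min[OF K] by blast
    then have "0 \<le> \<kappa> * h v" using f_nonneg[of u] by linarith
    then show ?thesis using \<open>0 < \<kappa>\<close> by (simp add: zero_le_mult_iff)
  qed
  have pless: "p i < p j" if "i \<in> {1..m}" "j \<in> {1..m}" "i < j" for i j
    using strict_mono_onD[OF p that(1,2,3)] .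
  have gap: "\<not> K \<subseteq> {p j<..<p (Suc j)}" if j: "j \<in> {1..m}" "Suc j \<in> {1..m}"
    and K: "K \<in> local_extreme_intervals h" for j K
  proof
    assume sub: "K \<subseteq> {p j<..<p (Suc j)}"
    obtain i where i: "i \<in> {1..m}" "K = I i" using KI[OF K] by blast
    then have "p j < p i" "p i < p (Suc j)" using pI[OF i(1)] sub by auto
    then have "\<not> i \<le> j" "\<not> Suc j \<le> i"
      using pless[OF i(1) j(1)] pless[OF j(2) i(1)] by (metis le_less less_asym less_irrefl)+
    then show False by simp
  qed
  have first: "local_max_interval h (I 1) \<and> 0 < h (p 1)" if one: "1 \<in> {1..m}"
  proof -
    have "\<not> K \<subseteq> {..<p 1}" if K: "K \<in> local_extreme_intervals h" for K
    proof
      assume sub: "K \<subseteq> {..<p 1}"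
      obtain i where i: "i \<in> {1..m}" "K = I i" using KI[OF K] by blast
      then have "p i < p 1" using pI[OF i(1)] sub by auto
      then have "\<not> 1 < i" using pless[OF one i(1)] by force
      then show False using i \<open>p i < p 1\<close> by auto
    qed
    from first_extreme_max[OF h zero(1) min_nonneg IE[OF one] pI[OF one] this]
    show ?thesis .
  qed
  \<comment> \<open>The first extreme is a maximum and the kinds alternate, so parity determines the
    kind.\<close>
  have type: "(odd j \<longrightarrow> local_max_interval h (I j)) \<and> (even j \<longrightarrow> local_min_interval h (I j))"
    if "1 \<le> j" "j \<le> m" for j
    using that
  proof (induction j rule: dec_induct)
    case base
    then show ?case using first by simp
  next
    case (step j)
    then have j: "j \<in> {1..m}" "Suc j \<in> {1..m}" by auto
    show ?case
    proof (cases "odd j")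
      case True
      then have "local_max_interval h (I j)" using step by simp
      from consecutive_extremes_alternate[OF h this IE[OF j(2)] pI[OF j(1)] pI[OF j(2)]
          pless[OF j] Ineq[OF j] gap[OF j]]
      show ?thesis using True by simp
    next
      case False
      then have "local_min_interval h (I j)" using step by simp
      from consecutive_extremes_alternate'[OF h this IE[OF j(2)] pI[OF j(1)] pI[OF j(2)]
          pless[OF j] Ineq[OF j] gap[OF j]]
      show ?thesis using False by simp
    qed
  qed
  have alt: "if odd j then h (p (Suc j)) < h (p j) else h (p j) < h (p (Suc j))"
    if j: "j \<in> {1..m}" "Suc j \<in> {1..m}" for j
  proof (cases "odd j")
    case True
    then have "local_max_interval h (I j)" using type[of j] j by simp
    from consecutive_extremes_alternate[OF h this IE[OF j(2)] pI[OF j(1)] pI[OF j(2)]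
        pless[OF j] Ineq[OF j] gap[OF j]]
    show ?thesis using True by simp
  next
    case False
    then have "local_min_interval h (I j)" using type[of j] j by simp
    from consecutive_extremes_alternate'[OF h this IE[OF j(2)] pI[OF j(1)] pI[OF j(2)]
        pless[OF j] Ineq[OF j] gap[OF j]]
    show ?thesis using False by simp
  qed
  have "\<exists>v. v \<in> I j \<and> (odd j \<longrightarrow> \<kappa> * h (p j) \<le> f v) \<and> (even j \<longrightarrow> f v \<le> \<kappa> * h (p j))"
    if j: "j \<in> {1..m}" for j
    using type[of j] j max[of "I j" "p j"] min[of "I j" "p j"] pI[OF j] by (cases "odd j") auto
  then obtain u where u: "\<And>j. j \<in> {1..m} \<Longrightarrow> u j \<in> I j \<and>
      (odd j \<longrightarrow> \<kappa> * h (p j) \<le> f (u j)) \<and> (even j \<longrightarrow> f (u j) \<le> \<kappa> * h (p j))"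
    by metis
  \<comment> \<open>Disjoint intervals are ordered as wholes, so the points \<open>u j\<close>
    inherit the order of the representatives \<open>p j\<close>.\<close>
  have uless: "u i < u j" if ij: "i \<in> {1..m}" "j \<in> {1..m}" "i < j" for i j
  proof (rule ccontr)
    assume "\<not> u i < u j"
    have disj: "v \<notin> I j" if "v \<in> I i" for v
      using local_extreme_intervals_disjoint[OF IE[OF ij(1)] IE[OF ij(2)] that] Ineq[OF ij(1,2)] ij by blast
    have int: "is_interval (I i)" "is_interval (I j)"
      using local_extreme_intervalsD(1) IE ij by blast+
    have "p i < u j"
      using disj[OF pI[OF ij(1)]] int(2) u[OF ij(2)] pI[OF ij(2)] pless[OF ij]
      by (metis is_interval_1 less_imp_le not_le)
    then have "u j \<in> I i"
      using int(1) pI[OF ij(1)] u[OF ij(1)] \<open>\<not> u i < u j\<close> by (meson is_interval_1 less_imp_le not_le)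
    then show False using disj u[OF ij(2)] by blast
  qed
  show ?thesis
  proof (cases "m = 0")
    case True
    then show ?thesis by (simp add: m_def E_def)
  next
    case False
    then have one: "1 \<in> {1..m}" and mm: "m \<in> {1..m}" by auto
    have pos1: "0 < h (p 1)" using first[OF one] by simp
    have last: "local_max_interval h (I m) \<and> 0 < h (p m)"
    proof -
      have "\<not> K \<subseteq> {p m<..}" if K: "K \<in> local_extreme_intervals h" for K
      proof
        assume sub: "K \<subseteq> {p m<..}"
        obtain i where i: "i \<in> {1..m}" "K = I i" using KI[OF K] by blast
        then have "p m < p i" using pI[OF i(1)] sub by auto
        then have "\<not> i < m" using pless[OF i(1) mm] by force
        then show False using i \<open>p m < p i\<close> by auto
      qed
      from last_extreme_max[OF h zero(2) min_nonneg IE[OF mm] pI[OF mm] this]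
      show ?thesis by simp
    qed
    have "odd m" using type[of m] False last local_max_min_exclusive by auto
    \<comment> \<open>The outermost extremes are maxima with positive values, so small values of
      \<open>f\<close> further out serve as the outer points of the alternation.\<close>
    obtain a where a: "a < u 1" "f a < \<kappa> * h (p 1)" using small(1) pos1 \<open>0 < \<kappa>\<close> by (meson mult_pos_pos)
    obtain b where b: "u m < b" "f b < \<kappa> * h (p m)" using small(2) last \<open>0 < \<kappa>\<close> by (meson mult_pos_pos)
    define q where "q j = (if j = 0 then a else if j = Suc m then b else u j)" for j
    have q: "q j < q (Suc j)" if "j \<le> m" for j
      using that a b uless[of j "Suc j"] False by (auto simp: q_def)
    have hq: "\<kappa> * h (p i) < \<kappa> * h (p j)" if "h (p i) < h (p j)" for i j
      using that \<open>0 < \<kappa>\<close> by simp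
    have "m \<le> card (local_extreme_intervals f)"
    proof (rule alternations_le_extremes[where q = q, OF f q])
      fix j assume j: "j \<in> {1..m}"
      have qj: "q j = u j" using j by (simp add: q_def)
      show "f (q (j - 1)) < f (q j) \<and> f (q (Suc j)) < f (q j) \<and> odd j \<or>
        f (q j) < f (q (j - 1)) \<and> f (q j) < f (q (Suc j)) \<and> even j"
      proof (cases "odd j")
        case True
        have fj: "\<kappa> * h (p j) \<le> f (q j)" using u[OF j] True qj by simp
        have "f (q (j - 1)) < f (q j)"
        proof (cases "j = 1")
          case True
          then show ?thesis using a fj by (simp add: q_def)
        next
          case neq: False
          then have j': "j - 1 \<in> {1..m}" "Suc (j - 1) \<in> {1..m}" and ev: "even (j - 1)" and qj': "q (j - 1) = u (j - 1)"
            using j True by (auto simp: q_def)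
          have "f (u (j - 1)) \<le> \<kappa> * h (p (j - 1))" using u[OF j'(1)] ev by blast
          also have "\<dots> < \<kappa> * h (p j)" using alt[OF j'] ev j by (intro hq) simp
          finally show ?thesis using fj qj' by simp
        qed
        moreover have "f (q (Suc j)) < f (q j)"
        proof (cases "j = m")
          case True
          then show ?thesis using b fj by (simp add: q_def)
        next
          case neq: False
          then have j': "Suc j \<in> {1..m}" and ev: "even (Suc j)" and qj': "q (Suc j) = u (Suc j)"
            using j True by (auto simp: q_def)
          have "f (u (Suc j)) \<le> \<kappa> * h (p (Suc j))" using u[OF j'(1)] ev by blast
          also have "\<dots> < \<kappa> * h (p j)" using alt[OF j j'] True by (intro hq) simp
          finally show ?thesis using fj qj' by simp
        qed
        ultimately show ?thesis using True by simp
      next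
        case False
        have fj: "f (q j) \<le> \<kappa> * h (p j)" using u[OF j] False qj by simp
        have "j \<noteq> m" "j \<noteq> 1" using False \<open>odd m\<close> by auto
        then have j1: "j - 1 \<in> {1..m}" "Suc (j - 1) \<in> {1..m}" and od1: "odd (j - 1)" and q1: "q (j - 1) = u (j - 1)"
          and j2: "Suc j \<in> {1..m}" and od2: "odd (Suc j)" and q2: "q (Suc j) = u (Suc j)"
          using j False by (auto simp: q_def)
        have "\<kappa> * h (p j) < \<kappa> * h (p (j - 1))" using alt[OF j1] od1 j by (intro hq) simp
        also have "\<dots> \<le> f (q (j - 1))" using u[OF j1(1)] od1 unfolding q1 by blast
        finally have l: "f (q j) < f (q (j - 1))" using fj by simp
        have "\<kappa> * h (p j) < \<kappa> * h (p (Suc j))" using alt[OF j j2] False by (intro hq) simp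
        also have "\<dots> \<le> f (q (Suc j))" using u[OF j2(1)] od2 unfolding q2 by blast
        finally have "f (q j) < f (q (Suc j))" using fj by simp
        then show ?thesis using l False by simp
      qed
    qed
    then show ?thesis by (simp add: m_def E_def)
  qed
qed

text \<open>A pigeonhole argument: \<open>k\<close> disjoint windows contain an extreme interval
  each, and there are at most \<open>k\<close> such intervals. So each lies in a window, one in
  every window, and the order of the windows makes the rank of the i-th one equal to
  \<open>i\<close>.\<close>

lemma extremes_near:
  fixes h :: "real \<Rightarrow> real"
  assumes fin: "finite (local_extreme_intervals h)" and card: "card (local_extreme_intervals h) \<le> k"
    and t: "\<And>i j. i \<in> {1..k} \<Longrightarrow> j \<in> {1..k} \<Longrightarrow> i < j \<Longrightarrow> t i + r < t j - r"
    and near: "\<And>i. i \<in> {1..k} \<Longrightarrow> \<exists>J\<in>local_extreme_intervals h. J \<subseteq> {t i - r<..<t i + r}"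
    and r: "2 * r \<le> \<delta>" "0 < r"
  shows "card (local_extreme_intervals h) = k" "inj_on midpoint_of (local_extreme_intervals h)"
    "\<forall>I\<in>local_extreme_intervals h. interval_length I \<le> \<delta>"
    "\<forall>I\<in>local_extreme_intervals h.
       \<bar>midpoint_of I - t (card {J \<in> local_extreme_intervals h. midpoint_of J \<le> midpoint_of I})\<bar> \<le> \<delta>"
proof -
  define E where "E = local_extreme_intervals h"
  obtain J where J: "\<And>i. i \<in> {1..k} \<Longrightarrow> J i \<in> E \<and> J i \<subseteq> {t i - r<..<t i + r}"
    using near unfolding E_def by metis
  have ne: "J i \<noteq> {}" if "i \<in> {1..k}" for i
    using J[OF that] local_extreme_intervalsD(2) unfolding E_def by blast
  have mid: "t i - r \<le> midpoint_of (J i)" "midpoint_of (J i) \<le> t i + r" "interval_length (J i) \<le> 2 * r"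
    if "i \<in> {1..k}" for i
    using Inf_Sup_bounds[OF ne[OF that], of "t i - r" "t i + r"] J[OF that]
    by (auto simp: midpoint_of_def interval_length_def)
  have midless: "midpoint_of (J i) < midpoint_of (J j)" if "i \<in> {1..k}" "j \<in> {1..k}" "i < j" for i j
    using mid[OF that(1)] mid[OF that(2)] t[OF that] by linarith
  have inj: "inj_on J {1..k}"
    by (rule inj_onI) (metis midless less_irrefl linorder_neqE_nat)
  have "J ` {1..k} \<subseteq> E" using J by blast
  then have img: "J ` {1..k} = E"
    using fin card card_image[OF inj] by (intro card_seteq) (auto simp: E_def)
  show "card (local_extreme_intervals h) = k"
    using card_image[OF inj] img by (simp add: E_def)
  have mle: "midpoint_of (J i) \<le> midpoint_of (J j) \<longleftrightarrow> i \<le> j" if "i \<in> {1..k}" "j \<in> {1..k}" for i j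
    using midless[OF that] midless[OF that(2,1)] by (cases i j rule: linorder_cases) auto
  show "inj_on midpoint_of (local_extreme_intervals h)"
    unfolding E_def[symmetric] img[symmetric]
    by (rule inj_onI) (metis (no_types, lifting) imageE mle order_antisym order_refl)
  show "\<forall>I\<in>local_extreme_intervals h. interval_length I \<le> \<delta>"
    unfolding E_def[symmetric] img[symmetric] using mid(3) r by force
  show "\<forall>I\<in>local_extreme_intervals h.
       \<bar>midpoint_of I - t (card {J \<in> local_extreme_intervals h. midpoint_of J \<le> midpoint_of I})\<bar> \<le> \<delta>"
  proof
    fix I assume "I \<in> local_extreme_intervals h"
    then have "I \<in> J ` {1..k}" using img by (simp add: E_def)
    then obtain i where i: "i \<in> {1..k}" "I = J i" by blast
    have "{K \<in> E. midpoint_of K \<le> midpoint_of I} = J ` {1..i}"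
      using mle[OF _ i(1)] i unfolding img[symmetric] by auto
    then have "card {K \<in> E. midpoint_of K \<le> midpoint_of I} = card {1..i}"
      using i(1) by (simp add: card_image inj_on_subset[OF inj])
    then have "card {K \<in> local_extreme_intervals h. midpoint_of K \<le> midpoint_of I} = i" by (simp add: E_def)
    then show "\<bar>midpoint_of I - t (card {J \<in> local_extreme_intervals h. midpoint_of J \<le> midpoint_of I})\<bar> \<le> \<delta>"
      using mid[OF i(1)] i r by simp
  qed
qed

section \<open>A sample that is uniformly close to its distribution function\<close>

context
  fixes f :: "real \<Rightarrow> real" and n :: nat and x :: "nat \<Rightarrow> real" and m :: nat and z :: "nat \<Rightarrow> real"
    and d \<epsilon> :: real
  assumes f: "is_density f" and n: "0 < n" and knots: "sample_knots n x m z"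
    and close: "\<And>y. \<bar>emp_cdf n x y - density_cdf f y\<bar> \<le> d"
    and small_d: "4 * d < 1" and eps: "0 < \<epsilon>" "2 * d \<le> \<epsilon>"
begin

private abbreviation (input) F where "F \<equiv> density_cdf f"

private lemma zmono: "strict_mono_on {..m} z" by (rule sample_knots_mono[OF n knots])

lemma F_first_knot_le: "F (z 0) \<le> d"
proof (rule isCont_le_from_left[where b = "z 0 - 1", OF isCont_density_cdf[OF f]])
  show "F y \<le> d" if "y < z 0" for y
    using close[of y] emp_cdf_left[OF n knots that] by linarith
qed simp

lemma F_last_knot_ge: "1 - d \<le> F (z m)"
  using close[of "z m"] emp_cdf_right[OF n knots, of "z m"] by linarith

text \<open>By continuity, \<open>F\<close> at a knot is controlled by the value of the empirical
  distribution function before its jump; this is what the upper gates require.\<close>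

lemma F_knot_le:
  assumes "1 \<le> j" "j \<le> m"
  shows "F (z j) \<le> emp_cdf n x (z (j - 1)) + d"
proof (rule isCont_le_from_left[OF isCont_density_cdf[OF f]])
  show "z (j - 1) < z j" using assms by (intro knots_less[OF zmono]) auto
  show "F y \<le> emp_cdf n x (z (j - 1)) + d" if "z (j - 1) < y" "y < z j" for y
    using close[of y] emp_cdf_left_of_knot[OF n knots assms, of y] that by simp
qed

text \<open>With one distinct observation, the same value of \<open>F\<close> would be at most
  \<open>d\<close> and at least \<open>1 - d\<close>.\<close>

lemma knots_pos: "1 \<le> m"
proof (rule ccontr)
  assume "\<not> 1 \<le> m"
  then have "m = 0" by simp
  then show False using F_first_knot_le F_last_knot_ge small_d by simp
qed

text \<open>
  The string is compared with the distribution function conditioned on the range of the sample,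
  which has the same end points.
\<close>

definition sample_mass where "sample_mass = F (z m) - F (z 0)"

definition cond_cdf where "cond_cdf y = (F y - F (z 0)) / sample_mass"

lemma sample_mass_pos: "0 < sample_mass" "sample_mass \<le> 1"
  using F_first_knot_le F_last_knot_ge small_d density_cdf_bounds[OF f, of "z m"] density_cdf_bounds[OF f, of "z 0"]
  by (auto simp: sample_mass_def)

text \<open>With \<alpha> and \<beta> for the masses left and right of the sample, conditioning
  raises \<open>F\<close> by at most \<beta> and lowers it by at most \<alpha>. The two errors do
  not add up, so \<open>d\<close> remains a bound.\<close>

lemma cond_cdf_close:
  assumes "z 0 \<le> y" "y \<le> z m"
  shows "\<bar>cond_cdf y - F y\<bar> \<le> d"
proof -
  define \<alpha> where "\<alpha> = F (z 0)"
  define \<beta> where "\<beta> = 1 - F (z m)"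
  have sample_mass: "sample_mass = 1 - \<alpha> - \<beta>" by (simp add: sample_mass_def \<alpha>_def \<beta>_def)
  have \<alpha>\<beta>: "0 \<le> \<alpha>" "0 \<le> \<beta>" "\<alpha> \<le> d" "\<beta> \<le> d"
    using F_first_knot_le F_last_knot_ge density_cdf_bounds[OF f] by (auto simp: \<alpha>_def \<beta>_def)
  have Fy: "\<alpha> \<le> F y" "F y \<le> 1 - \<beta>"
    using density_cdf_mono[OF f assms(1)] density_cdf_mono[OF f assms(2)] by (auto simp: \<alpha>_def \<beta>_def)
  have eq: "cond_cdf y - F y = (F y * (\<alpha> + \<beta>) - \<alpha>) / sample_mass"
    using sample_mass_pos(1) unfolding cond_cdf_def \<alpha>_def[symmetric] by (simp add: field_simps sample_mass)
  have "F y * (\<alpha> + \<beta>) \<le> (1 - \<beta>) * (\<alpha> + \<beta>)" using Fy \<alpha>\<beta> by (intro mult_right_mono) auto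
  then have "F y * (\<alpha> + \<beta>) - \<alpha> \<le> \<beta> * sample_mass" by (simp add: sample_mass algebra_simps)
  then have "cond_cdf y - F y \<le> \<beta>" unfolding eq using sample_mass_pos(1) by (simp add: pos_divide_le_eq)
  moreover have "\<alpha> * (\<alpha> + \<beta>) \<le> F y * (\<alpha> + \<beta>)" using Fy \<alpha>\<beta> by (intro mult_right_mono) auto
  then have "- \<alpha> * sample_mass \<le> F y * (\<alpha> + \<beta>) - \<alpha>" by (simp add: sample_mass algebra_simps)
  then have "- \<alpha> \<le> cond_cdf y - F y" unfolding eq using sample_mass_pos(1) by (simp add: pos_le_divide_eq)
  ultimately show ?thesis using \<alpha>\<beta> by linarith
qed

lemma cond_cdf_gates:
  shows "cond_cdf (z 0) = 0" "cond_cdf (z m) = 1"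
    "j \<le> m \<Longrightarrow> emp_cdf n x (z j) - \<epsilon> \<le> cond_cdf (z j)"
    "1 \<le> j \<Longrightarrow> j \<le> m \<Longrightarrow> cond_cdf (z j) \<le> emp_cdf n x (z (j - 1)) + \<epsilon>"
proof -
  show "cond_cdf (z 0) = 0" by (simp add: cond_cdf_def)
  show "cond_cdf (z m) = 1" using sample_mass_pos(1) by (simp add: cond_cdf_def sample_mass_def)
  have c: "\<bar>cond_cdf (z j) - F (z j)\<bar> \<le> d" if "j \<le> m" for j
    using that by (intro cond_cdf_close knots_le[OF zmono]) auto
  show "emp_cdf n x (z j) - \<epsilon> \<le> cond_cdf (z j)" if "j \<le> m"
    using c[OF that] close[of "z j"] eps by linarith
  show "cond_cdf (z j) \<le> emp_cdf n x (z (j - 1)) + \<epsilon>" if "1 \<le> j" "j \<le> m"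
    using c[OF that(2)] F_knot_le[OF that] eps by linarith
qed

lemma sample_gates_open: "gates_open n x m z \<epsilon>"
  by (rule gates_openI[where S = cond_cdf, OF n knots eps(1) knots_pos cond_cdf_gates])

lemma gate_lo_le_cond_cdf: "j \<le> m \<Longrightarrow> gate_lo n x m z \<epsilon> j \<le> cond_cdf (z j)"
  using cond_cdf_gates by (auto simp: gate_lo_def)

lemma cond_cdf_le_gate_hi: "j \<le> m \<Longrightarrow> cond_cdf (z j) \<le> gate_hi n x m z \<epsilon> j"
  using cond_cdf_gates by (auto simp: gate_hi_def)

context
  fixes y :: "nat \<Rightarrow> real"
  assumes y: "taut_polygon m z (gate_lo n x m z \<epsilon>) (gate_hi n x m z \<epsilon>) y"
begin

lemma taut_polygon_ends: "y 0 = 0" "y m = 1"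
  using through_gates_ends[OF n knots eps(1) knots_pos taut_polygonD(3)[OF y]] .

text \<open>Beyond the sample the polygon continues with the constants 0 and 1, from which
  \<open>F\<close> differs by at most \<open>d\<close> there. Closeness on the whole line is what
  the stability of extremes asks for.\<close>

lemma polygon_close: "\<bar>polygon m z y u - F u\<bar> \<le> \<epsilon> + d"
proof -
  consider "u < z 0" | "z 0 \<le> u" "u \<le> z m" | "z m < u" by linarith
  then show ?thesis
  proof cases
    case 1
    then have "F u \<le> d" using density_cdf_mono[OF f, of u "z 0"] F_first_knot_le by simp
    then show ?thesis using polygon_left[OF zmono, of u y] 1 taut_polygon_ends density_cdf_bounds[OF f, of u] eps
      by simp
  next
    case 2
    then show ?thesis
      using polygon_in_tube_bounds[OF n knots eps(1) sample_gates_open taut_polygonD(3)[OF y] 2] close[of u]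
      by linarith
  next
    case 3
    then have "1 - d \<le> F u" using density_cdf_mono[OF f, of "z m" u] F_last_knot_ge by simp
    then show ?thesis using polygon_right[OF zmono, of u y] 3 taut_polygon_ends density_cdf_bounds[OF f, of u] eps
      by simp
  qed
qed

lemma gate_ends: "gate_lo n x m z \<epsilon> 0 = gate_hi n x m z \<epsilon> 0"
  by (simp add: gate_lo_def gate_hi_def)

private abbreviation (input) w where "w \<equiv> slope_seq m z y"

lemma polygon_block:
  assumes "1 \<le> a" "a \<le> b" "b \<le> m" "\<And>j. j \<in> {a..b} \<Longrightarrow> w j = w a"
  shows "y b - y (a - 1) = w a * (z b - z (a - 1))"
proof -
  have less: "z (a - 1) < z b" using assms by (intro knots_less[OF zmono]) auto
  have const: "step_fun m z w v = w a" if "z (a - 1) < v" "v < z b" for v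
  proof -
    have "v \<in> block m z (a, b)" using block_bounds(1)[OF zmono assms(1,2,3)] that by fastforce
    then show ?thesis using assms(4)[of "piece_index m z v"] by (simp add: step_fun_def block_def)
  qed
  note sb = slope_bounds_polygon[OF zmono knots_pos, of y]
  have "w a * (z b - z (a - 1)) \<le> polygon m z y (z b) - polygon m z y (z (a - 1))"
    by (rule slope_bounds_ge[OF sb less]) (simp add: const)
  moreover have "polygon m z y (z b) - polygon m z y (z (a - 1)) \<le> w a * (z b - z (a - 1))"
    by (rule slope_bounds_le[OF sb less]) (simp add: const)
  moreover have "polygon m z y (z b) = y b" "polygon m z y (z (a - 1)) = y (a - 1)"
    using assms by (auto intro!: polygon_knot[OF zmono])
  ultimately show ?thesis by simp
qed

lemma F_increment: "F (z b) - F (z a) = sample_mass * (cond_cdf (z b) - cond_cdf (z a))"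
  using sample_mass_pos(1) by (simp add: cond_cdf_def diff_divide_distrib[symmetric])

text \<open>At the left end of a maximal block the slope increases, so the string is on its upper
  gate and not below \<open>cond_cdf\<close>; at the right end it is on its lower gate and not
  above. At the end knots the heights coincide. Thus \<open>cond_cdf\<close> rises at least as much
  as the string over the block, and \<open>sample_mass\<close> converts its increments into those of
  \<open>F\<close>.\<close>

lemma density_ge_at_max:
  assumes I: "local_max_interval (step_fun m z w) I" and v: "v \<in> I"
  shows "\<exists>u\<in>I. sample_mass * step_fun m z w v \<le> f u"
proof -
  obtain a b where ab: "(a, b) \<in> max_blocks m w" and Ib: "I = block m z (a, b)"
    using I unfolding local_max_interval_step_fun[OF zmono knots_pos] by auto
  note D = max_blocksD[OF ab]
  have hv: "step_fun m z w v = w a"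
    using v D(6)[of "piece_index m z v"] unfolding Ib by (simp add: block_def step_fun_def)
  have left: "cond_cdf (z (a - 1)) \<le> y (a - 1)"
  proof (cases "a = 1")
    case True
    then show ?thesis using cond_cdf_gates(1) taut_polygon_ends by simp
  next
    case False
    then have "y (a - 1) = gate_hi n x m z \<epsilon> (a - 1)"
      using D(1-5) by (intro taut_polygon_convex_kink[OF zmono gate_ends y]) auto
    then show ?thesis using cond_cdf_le_gate_hi[of "a - 1"] D(1-5) by simp
  qed
  have right: "y b \<le> cond_cdf (z b)"
  proof (cases "b = m")
    case True
    then show ?thesis using cond_cdf_gates(2) taut_polygon_ends by simp
  next
    case False
    have "w b = w a" using D(1-5) by (intro D(6)) auto
    then have "y b = gate_lo n x m z \<epsilon> b"
      using D(1-5) False by (intro taut_polygon_concave_kink[OF zmono gate_ends y]) auto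
    then show ?thesis using gate_lo_le_cond_cdf[of b] D(1-5) by simp
  qed
  have less: "z (a - 1) < z b" using D(1-5) by (intro knots_less[OF zmono]) auto
  have "w a * (z b - z (a - 1)) \<le> cond_cdf (z b) - cond_cdf (z (a - 1))"
    using polygon_block[OF D(1-3) D(6)] left right by linarith
  then have "sample_mass * w a * (z b - z (a - 1)) \<le> F (z b) - F (z (a - 1))"
    unfolding F_increment using sample_mass_pos(1) by simp
  from density_mean_value_ge[OF f less this] obtain u where "u \<in> {z (a - 1)<..<z b}" "sample_mass * w a \<le> f u"
    by blast
  then show ?thesis using block_bounds(1)[OF zmono D(1-3)] hv unfolding Ib by fastforce
qed

lemma density_le_at_min:
  assumes I: "local_min_interval (step_fun m z w) I" and v: "v \<in> I"
  shows "\<exists>u\<in>I. f u \<le> sample_mass * step_fun m z w v"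
proof -
  obtain a b where ab: "(a, b) \<in> max_blocks m (\<lambda>j. - w j)" and Ib: "I = block m z (a, b)"
    using I unfolding local_min_interval_step_fun[OF zmono knots_pos] by auto
  note D = max_blocksD(4,5)[OF ab]
  have const: "w j = w a" if "j \<in> {a..b}" for j using max_blocksD(6)[OF ab that] by simp
  have hv: "step_fun m z w v = w a"
    using v const[of "piece_index m z v"] unfolding Ib by (simp add: block_def step_fun_def)
  have ab': "1 \<le> a" "a \<le> b" "b \<le> m" using max_blocksD(1-3)[OF ab] by auto
  have left: "y (a - 1) \<le> cond_cdf (z (a - 1))"
  proof (cases "a = 1")
    case True
    then show ?thesis using cond_cdf_gates(1) taut_polygon_ends by simp
  next
    case False
    then have "y (a - 1) = gate_lo n x m z \<epsilon> (a - 1)"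
      using D ab' by (intro taut_polygon_concave_kink[OF zmono gate_ends y]) auto
    then show ?thesis using gate_lo_le_cond_cdf[of "a - 1"] ab' by simp
  qed
  have right: "cond_cdf (z b) \<le> y b"
  proof (cases "b = m")
    case True
    then show ?thesis using cond_cdf_gates(2) taut_polygon_ends by simp
  next
    case False
    have "w b = w a" using ab' by (intro const) auto
    then have "y b = gate_hi n x m z \<epsilon> b"
      using D ab' False by (intro taut_polygon_convex_kink[OF zmono gate_ends y]) auto
    then show ?thesis using cond_cdf_le_gate_hi[of b] ab' by simp
  qed
  have less: "z (a - 1) < z b" using ab' by (intro knots_less[OF zmono]) auto
  have "cond_cdf (z b) - cond_cdf (z (a - 1)) \<le> w a * (z b - z (a - 1))"
    using polygon_block[OF ab' const] left right by linarith
  then have "F (z b) - F (z (a - 1)) \<le> sample_mass * w a * (z b - z (a - 1))"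
    unfolding F_increment using sample_mass_pos(1) by simp
  from density_mean_value_le[OF f less this] obtain u where "u \<in> {z (a - 1)<..<z b}" "f u \<le> sample_mass * w a"
    by blast
  then show ?thesis using block_bounds(1)[OF zmono ab'] hv unfolding Ib by fastforce
qed

lemma card_string_extremes_le:
  assumes f_ext: "monotone_off_extremes f" "finite (local_extreme_intervals f)"
    "\<And>I. I \<in> local_extreme_intervals f \<Longrightarrow> \<exists>x. I = {x}"
  shows "card (local_extreme_intervals (step_fun m z w)) \<le> card (local_extreme_intervals f)"
proof (rule card_extremes_le[OF f_ext])
  show "step_fun m z w u = 0" if "u < z 0" for u
    using piece_index_eq_0_iff[OF zmono, of u] that by (simp add: step_fun_def slope_seq_def)
  show "step_fun m z w u = 0" if "z m < u" for u
    using piece_index_eq_Suc_iff[OF zmono knots_pos, of u] that by (simp add: step_fun_def slope_seq_def)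
  show "finite (local_extreme_intervals (step_fun m z w))"
    unfolding local_extreme_intervals_step_fun[OF zmono knots_pos]
    by (intro finite_imageI finite_extreme_blocks)
qed (use is_density_nonneg[OF f] density_small_left[OF f] density_small_right[OF f]
    monotone_off_extremes_step_fun[OF zmono knots_pos] sample_mass_pos(1)
    density_ge_at_max density_le_at_min in auto)

end

end

section \<open>Close samples have the right extremes\<close>

lemma finite_positive_separation:
  fixes S :: "real set"
  assumes "finite S" "\<And>s. s \<in> S \<Longrightarrow> 0 < s"
  shows "\<exists>r>0. \<forall>s\<in>S. r < s"
proof -
  have fin: "finite (insert 1 S)" using assms by simp
  have "Min (insert 1 S) / 2 > 0" using assms by (subst half_gt_zero_iff, subst Min_gr_iff) auto
  moreover have "Min (insert 1 S) / 2 < s" if "s \<in> S" for s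
    using Min_le[OF fin, of s] that calculation by simp
  ultimately show ?thesis by blast
qed

lemma has_local_extremes_atD:
  assumes "has_local_extremes_at f k t"
  shows "regular_extremes f" "finite (local_extreme_intervals f)" "card (local_extreme_intervals f) = k"
    "\<And>I. I \<in> local_extreme_intervals f \<Longrightarrow> \<exists>i\<in>{1..k}. I = {t i}"
    "\<And>i. i \<in> {1..k} \<Longrightarrow> {t i} \<in> local_extreme_intervals f"
    "\<And>i j. i \<in> {1..k} \<Longrightarrow> j \<in> {1..k} \<Longrightarrow> i < j \<Longrightarrow> t i < t j"
proof -
  have t: "strict_mono_on {1..k} t" and E: "local_extreme_intervals f = (\<lambda>i. {t i}) ` {1..k}"
    using assms by (auto simp: has_local_extremes_at_def)
  show "regular_extremes f" using assms by (simp add: has_local_extremes_at_def)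
  show "finite (local_extreme_intervals f)" by (simp add: E)
  have "inj_on (\<lambda>i. {t i}) {1..k}"
    using inj_onD[OF strict_mono_on_imp_inj_on[OF t]] by (intro inj_onI) blast
  then show "card (local_extreme_intervals f) = k" by (simp add: E card_image)
  show "\<exists>i\<in>{1..k}. I = {t i}" if "I \<in> local_extreme_intervals f" for I using that by (auto simp: E)
  show "{t i} \<in> local_extreme_intervals f" if "i \<in> {1..k}" for i using that by (auto simp: E)
  show "t i < t j" if "i \<in> {1..k}" "j \<in> {1..k}" "i < j" for i j using strict_mono_onD[OF t that] .
qed

lemma extreme_stable:
  assumes f: "is_density f" and ext: "has_local_extremes_at f k t" and i: "i \<in> {1..k}" and r: "0 < r"
    and sep: "\<And>i j. i \<in> {1..k} \<Longrightarrow> j \<in> {1..k} \<Longrightarrow> i < j \<Longrightarrow> t i + r < t j - r"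
  shows "\<exists>\<tau>>0. \<forall>H h. slope_bounds H h \<longrightarrow> monotone_off_extremes h \<longrightarrow>
     (\<forall>x. \<bar>H x - density_cdf f x\<bar> \<le> \<tau>) \<longrightarrow> (\<exists>J\<in>local_extreme_intervals h. J \<subseteq> {t i - r<..<t i + r})"
proof -
  note E = has_local_extremes_atD[OF ext]
  note reg = regular_extremesD[OF E(1)]
  have iso: "I = {t i}" if I: "I \<in> local_extreme_intervals f" "I \<subseteq> {t i - r<..<t i + r}" for I
  proof -
    obtain j where j: "j \<in> {1..k}" "I = {t j}" using E(4)[OF I(1)] by blast
    then have "t i - r < t j" "t j < t i + r" using I(2) by auto
    then have "\<not> i < j" "\<not> j < i" using sep[OF i j(1)] sep[OF j(1) i] r by linarith+
    then show ?thesis using j by simp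
  qed
  consider "local_max_interval f {t i}" | "local_min_interval f {t i}"
    using E(5)[OF i] by (auto simp: local_extreme_intervals_def)
  then show ?thesis
  proof cases
    case 1
    from peak_stable[OF reg(1) slope_bounds_density_cdf[OF f] 1 r iso reg(2)] show ?thesis by metis
  next
    case 2
    from trough_stable[OF reg(1) slope_bounds_density_cdf[OF f] 2 r iso reg(3)] show ?thesis by metis
  qed
qed

text \<open>The sample is an arbitrary sequence here: chance enters only through the uniform
  distance, and the threshold for \<open>n\<close> does not depend on the sample.\<close>

lemma eventually_good_extremes:
  assumes f: "is_density f" and ext: "has_local_extremes_at f k t" and \<delta>: "0 < \<delta>"
    and C: "0 < C" "2 * D \<le> C" and D: "0 \<le> D"
  shows "\<forall>\<^sub>F n in sequentially. \<forall>x. (\<forall>y. \<bar>emp_cdf n x y - density_cdf f y\<bar> \<le> D / sqrt (real n)) \<longrightarrow>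
     num_extremes C n x = k \<and>
     (\<forall>i\<in>{1..num_extremes C n x}. interval_length (extreme_interval C n x i) \<le> \<delta>) \<and>
     (\<forall>i\<in>{1..num_extremes C n x}. \<bar>extreme_midpoint C n x i - t i\<bar> \<le> \<delta>)"
proof -
  note E = has_local_extremes_atD[OF ext]
  \<comment> \<open>Half the distances between extremes: a radius below all of them makes the
    windows around the extremes disjoint.\<close>
  define S where "S = (\<lambda>(i, j). (t j - t i) / 2) ` {(i, j). i \<in> {1..k} \<and> j \<in> {1..k} \<and> i < j}"
  have "finite {(i, j). i \<in> {1..k} \<and> j \<in> {1..k} \<and> i < j}"
    by (rule finite_subset[of _ "{1..k} \<times> {1..k}"]) auto
  then have "finite S" by (simp add: S_def)
  moreover have "0 < s" if "s \<in> S" for s using that E(6) by (auto simp: S_def)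
  ultimately have "\<exists>r>0. \<forall>s\<in>S. r < s" by (rule finite_positive_separation)
  then obtain r0 where r0: "0 < r0" "\<And>s. s \<in> S \<Longrightarrow> r0 < s" by auto
  define r where "r = min r0 (\<delta> / 2)"
  have r: "0 < r" "2 * r \<le> \<delta>" using r0(1) \<delta> by (auto simp: r_def)
  have sep: "t i + r < t j - r" if "i \<in> {1..k}" "j \<in> {1..k}" "i < j" for i j
  proof -
    have "(t j - t i) / 2 \<in> S" unfolding S_def using that by (intro image_eqI[of _ _ "(i, j)"]) auto
    then have "r < (t j - t i) / 2" using r0(2) unfolding r_def by (meson min.strict_coboundedI1)
    then show ?thesis by simp
  qed
  have "\<forall>i\<in>{1..k}. \<exists>\<tau>>0. \<forall>H h. slope_bounds H h \<longrightarrow> monotone_off_extremes h \<longrightarrow>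
     (\<forall>x. \<bar>H x - density_cdf f x\<bar> \<le> \<tau>) \<longrightarrow> (\<exists>J\<in>local_extreme_intervals h. J \<subseteq> {t i - r<..<t i + r})"
    using extreme_stable[OF f ext _ r(1) sep] by blast
  then obtain \<tau> where \<tau>: "\<And>i. i \<in> {1..k} \<Longrightarrow> 0 < \<tau> i \<and> (\<forall>H h. slope_bounds H h \<longrightarrow> monotone_off_extremes h \<longrightarrow>
     (\<forall>x. \<bar>H x - density_cdf f x\<bar> \<le> \<tau> i) \<longrightarrow> (\<exists>J\<in>local_extreme_intervals h. J \<subseteq> {t i - r<..<t i + r}))"
    by metis
  have "\<exists>r>0. \<forall>s\<in>\<tau> ` {1..k}. r < s"
  proof (rule finite_positive_separation)
    show "0 < s" if "s \<in> \<tau> ` {1..k}" for s using \<tau> that by blast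
  qed simp
  then obtain \<tau>0 where \<tau>0: "0 < \<tau>0" "\<And>i. i \<in> {1..k} \<Longrightarrow> \<tau>0 < \<tau> i" by blast
  have lim: "(\<lambda>n. c / sqrt (real n)) \<longlonglongrightarrow> 0" for c
    by (intro tendsto_divide_0[OF tendsto_const] filterlim_at_top_imp_at_infinity
        filterlim_compose[OF sqrt_at_top filterlim_real_sequentially])
  \<comment> \<open>\<open>C / sqrt n\<close> bounds the distance of the string from the empirical
    distribution function, and \<open>D / sqrt n\<close> that of the latter from \<open>F\<close>;
    together they must fall below the tolerance of every extreme.\<close>
  have "\<forall>\<^sub>F n in sequentially. (C + D) / sqrt (real n) < \<tau>0"
    using order_tendstoD(2)[OF lim \<tau>0(1)] .
  moreover have "\<forall>\<^sub>F n in sequentially. D / sqrt (real n) < 1 / 4"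
    using order_tendstoD(2)[OF lim, of "1 / 4"] by simp
  moreover have "\<forall>\<^sub>F n in sequentially. 0 < n" by (rule eventually_gt_at_top)
  ultimately show ?thesis
  proof eventually_elim
    case (elim n)
    show ?case
    proof (intro allI impI)
      fix x assume close: "\<forall>y. \<bar>emp_cdf n x y - density_cdf f y\<bar> \<le> D / sqrt (real n)"
      define d where "d = D / sqrt (real n)"
      define \<epsilon> where "\<epsilon> = C / sqrt (real n)"
      have cl: "\<And>y. \<bar>emp_cdf n x y - density_cdf f y\<bar> \<le> d" using close by (simp add: d_def)
      have d: "4 * d < 1" using elim by (simp add: d_def)
      have eps: "0 < \<epsilon>" "2 * d \<le> \<epsilon>"
        using elim C by (auto simp: \<epsilon>_def d_def divide_right_mono)
      have sum: "\<epsilon> + d < \<tau>0" using elim by (simp add: \<epsilon>_def d_def add_divide_distrib)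
      obtain m z where knots: "sample_knots n x m z" using sample_knots_exist elim by blast
      note zm = sample_knots_mono[OF elim(3) knots]
      note ctx = f elim(3) knots cl d eps
      note gates = sample_gates_open[OF ctx]
      have m: "1 \<le> m" using knots_pos[OF ctx] .
      have "gate_lo n x m z \<epsilon> j \<le> gate_hi n x m z \<epsilon> j" if "j \<le> m" for j
        using gate_lo_le_cond_cdf[OF ctx that] cond_cdf_le_gate_hi[OF ctx that] by linarith
      then obtain y where y: "taut_polygon m z (gate_lo n x m z \<epsilon>) (gate_hi n x m z \<epsilon>) y"
        using taut_polygon_exists by blast
      define h where "h = step_fun m z (slope_seq m z y)"
      have h: "string_deriv C n x = h"
        unfolding h_def using string_deriv_step_fun[OF elim(3) knots, of C y] eps gates y
        by (simp add: \<epsilon>_def)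
      have fin: "finite (local_extreme_intervals h)"
        unfolding h_def local_extreme_intervals_step_fun[OF zm m] by (intro finite_imageI finite_extreme_blocks)
      have le: "card (local_extreme_intervals h) \<le> k"
        using card_string_extremes_le[OF ctx y regular_extremesD(1)[OF E(1)] E(2)] E(4) E(3)
        unfolding h_def by blast
      have near: "\<exists>J\<in>local_extreme_intervals h. J \<subseteq> {t i - r<..<t i + r}" if i: "i \<in> {1..k}" for i
      proof -
        have "\<bar>polygon m z y u - density_cdf f u\<bar> \<le> \<tau> i" for u
          using polygon_close[OF ctx y, of u] sum \<tau>0(2)[OF i] by linarith
        then show ?thesis
          using \<tau>[OF i] slope_bounds_polygon[OF zm m, of y] monotone_off_extremes_step_fun[OF zm m]
          unfolding h_def by blast
      qed
      note N = extremes_near[where t = t, OF fin le sep near r(2,1)]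
      have "\<forall>i\<in>{1..card (local_extreme_intervals h)}. interval_length (nth_extreme_interval h i) \<le> \<delta>"
        using all_nth_extreme_interval[OF fin N(2), where Q = "\<lambda>I i. interval_length I \<le> \<delta>"] N(3) by blast
      moreover have "\<forall>i\<in>{1..card (local_extreme_intervals h)}. \<bar>midpoint_of (nth_extreme_interval h i) - t i\<bar> \<le> \<delta>"
        using all_nth_extreme_interval[OF fin N(2), where Q = "\<lambda>I i. \<bar>midpoint_of I - t i\<bar> \<le> \<delta>"] N(4) by blast
      ultimately show "num_extremes C n x = k \<and>
         (\<forall>i\<in>{1..num_extremes C n x}. interval_length (extreme_interval C n x i) \<le> \<delta>) \<and>
         (\<forall>i\<in>{1..num_extremes C n x}. \<bar>extreme_midpoint C n x i - t i\<bar> \<le> \<delta>)"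
        using N(1) unfolding num_extremes_def extreme_interval_def extreme_midpoint_def h by blast
    qed
  qed
qed

section \<open>A bound of order \<open>1 / sqrt n\<close> for the empirical distribution function\<close>

lemma (in prob_space) expectation_indep_centred:
  fixes X :: "nat \<Rightarrow> 'a \<Rightarrow> real" and \<psi> :: "real \<Rightarrow> real" and g :: "(nat \<Rightarrow> real) \<Rightarrow> real"
  assumes indep: "indep_vars (\<lambda>_. borel) X UNIV" and i: "i \<notin> I"
    and \<psi> [measurable]: "\<psi> \<in> borel_measurable borel" and "\<And>x. \<bar>\<psi> x\<bar> \<le> c"
    and g [measurable]: "g \<in> borel_measurable (PiM I (\<lambda>_. borel))" and "\<And>v. \<bar>g v\<bar> \<le> c"
    and centred: "expectation (\<lambda>\<omega>. \<psi> (X i \<omega>)) = 0"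
  shows "expectation (\<lambda>\<omega>. \<psi> (X i \<omega>) * g (restrict (\<lambda>l. X l \<omega>) I)) = 0"
proof -
  have X [measurable]: "random_variable borel (X l)" for l
    using indep by (simp add: indep_vars_def)
  have "indep_var (PiM {i} (\<lambda>_. borel)) (\<lambda>\<omega>. restrict (\<lambda>l. X l \<omega>) {i})
      (PiM I (\<lambda>_. borel)) (\<lambda>\<omega>. restrict (\<lambda>l. X l \<omega>) I)"
    using i by (intro indep_var_restrict[OF indep]) auto
  then have "indep_var borel ((\<lambda>v. \<psi> (v i)) \<circ> (\<lambda>\<omega>. restrict (\<lambda>l. X l \<omega>) {i}))
      borel (g \<circ> (\<lambda>\<omega>. restrict (\<lambda>l. X l \<omega>) I))"
    by (rule indep_var_compose) measurable
  then have ind: "indep_var borel (\<lambda>\<omega>. \<psi> (X i \<omega>)) borel (\<lambda>\<omega>. g (restrict (\<lambda>l. X l \<omega>) I))"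
    by (simp add: o_def)
  have meas: "(\<lambda>\<omega>. g (restrict (\<lambda>l. X l \<omega>) I)) \<in> borel_measurable M"
    using ind by (simp add: indep_var_rv2)
  have "integrable M (\<lambda>\<omega>. \<psi> (X i \<omega>))"
    by (rule integrable_const_bound[where B = c]) (use assms in auto)
  moreover have "integrable M (\<lambda>\<omega>. g (restrict (\<lambda>l. X l \<omega>) I))"
    by (rule integrable_const_bound[where B = c, OF _ meas]) (use assms in auto)
  ultimately show ?thesis using indep_var_lebesgue_integral[OF ind] centred by simp
qed

text \<open>
  For nested sets \<open>B j\<close> with probabilities \<open>P j\<close>, the sums of
  \<open>\<phi> j (X i) = (indicator (B j) (X i) - P j) / (1 - P j)\<close> form a martingale in \<open>j\<close>: the function
  \<open>\<phi> J - \<phi> j\<close> vanishes on \<open>B j\<close> and is centred, and off \<open>B j\<close> the \<open>\<phi> l\<close> with \<open>l \<le> j\<close> are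
  constant.  Kolmogorov's argument then bounds the maximum of these sums.
\<close>

context prob_space
begin

context
  fixes X :: "nat \<Rightarrow> 'a \<Rightarrow> real" and B :: "nat \<Rightarrow> real set" and P :: "nat \<Rightarrow> real" and n J :: nat and \<rho> :: real
  assumes indep: "indep_vars (\<lambda>_. borel) X UNIV"
    and X [measurable]: "\<And>i. X i \<in> borel_measurable M"
    and B [measurable]: "\<And>j. B j \<in> sets borel"
    and nested: "\<And>i j. i \<le> j \<Longrightarrow> j \<le> J \<Longrightarrow> B i \<subseteq> B j"
    and prob_B: "\<And>i j. prob {\<omega> \<in> space M. X i \<omega> \<in> B j} = P j"
    and half: "P J \<le> 1 / 2"
    and \<rho>: "0 < \<rho>"
begin

lemma P_bounds: "0 \<le> P j" "j \<le> J \<Longrightarrow> P j \<le> 1 / 2"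
proof -
  show "0 \<le> P j" using measure_nonneg prob_B by metis
  assume "j \<le> J"
  then have "prob {\<omega> \<in> space M. X 0 \<omega> \<in> B j} \<le> prob {\<omega> \<in> space M. X 0 \<omega> \<in> B J}"
    using nested[of j J] by (intro finite_measure_mono) auto
  then show "P j \<le> 1 / 2" using half by (simp add: prob_B)
qed

text \<open>Dividing by \<open>1 - P j\<close> gives each of these functions the value 1 on its own
  set, so that any two of them agree on the smaller set.\<close>

definition centred_indicator :: "nat \<Rightarrow> real \<Rightarrow> real" where
  "centred_indicator j x = (indicator (B j) x - P j) / (1 - P j)"

definition walk :: "nat \<Rightarrow> (nat \<Rightarrow> real) \<Rightarrow> real" where
  "walk j v = (\<Sum>i<n. centred_indicator j (v i))"

definition first_exit :: "nat \<Rightarrow> (nat \<Rightarrow> real) \<Rightarrow> bool" where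
  "first_exit j v \<longleftrightarrow> \<rho> \<le> \<bar>walk j v\<bar> \<and> (\<forall>l<j. \<bar>walk l v\<bar> < \<rho>)"

lemma centred_indicator_measurable [measurable]: "centred_indicator j \<in> borel_measurable borel"
  unfolding centred_indicator_def by measurable

text \<open>Off \<open>B j\<close> the value is \<open>- P j / (1 - P j)\<close>, which is at least
  -1 because \<open>P j \<le> 1 / 2\<close>.\<close>

lemma centred_indicator_bound: "j \<le> J \<Longrightarrow> \<bar>centred_indicator j x\<bar> \<le> 1"
  using P_bounds[of j] unfolding centred_indicator_def by (auto simp: indicator_def abs_le_iff field_simps)

lemma expectation_centred_indicator: "j \<le> J \<Longrightarrow> expectation (\<lambda>\<omega>. centred_indicator j (X i \<omega>)) = 0"
proof -
  assume j: "j \<le> J"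
  have "expectation (\<lambda>\<omega>. indicator (B j) (X i \<omega>)) = expectation (indicator {\<omega> \<in> space M. X i \<omega> \<in> B j})"
    by (intro Bochner_Integration.integral_cong) (auto simp: indicator_def)
  also have "\<dots> = P j" by (simp add: prob_B)
  finally have "expectation (\<lambda>\<omega>. indicator (B j) (X i \<omega>)) = P j" .
  moreover have "integrable M (\<lambda>\<omega>. indicator (B j) (X i \<omega>) :: real)"
    by (rule integrable_const_bound[where B = 1]) (auto simp: indicator_def)
  ultimately show ?thesis unfolding centred_indicator_def by (simp add: prob_space)
qed

lemma walk_bound: "j \<le> J \<Longrightarrow> \<bar>walk j v\<bar> \<le> n"
proof -
  assume "j \<le> J"
  then have "\<bar>walk j v\<bar> \<le> (\<Sum>i<n. 1)"
    unfolding walk_def by (intro order_trans[OF sum_abs] sum_mono centred_indicator_bound)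
  then show ?thesis by simp
qed

lemma walk_measurable [measurable]: "(\<lambda>\<omega>. walk j (\<lambda>i. X i \<omega>)) \<in> borel_measurable M"
  unfolding walk_def by measurable

lemma first_exit_measurable [measurable]: "Measurable.pred M (\<lambda>\<omega>. first_exit j (\<lambda>i. X i \<omega>))"
  unfolding first_exit_def by measurable

text \<open>Different summands are uncorrelated by independence, and each is bounded by 1.\<close>

lemma walk_second_moment: "expectation (\<lambda>\<omega>. (walk J (\<lambda>i. X i \<omega>))\<^sup>2) \<le> n"
proof -
  have int: "integrable M (\<lambda>\<omega>. centred_indicator J (X i \<omega>) * centred_indicator J (X l \<omega>))" for i l
  proof (rule integrable_const_bound[where B = 1])
    show "AE \<omega> in M. norm (centred_indicator J (X i \<omega>) * centred_indicator J (X l \<omega>)) \<le> 1"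
      using centred_indicator_bound[of J] by (auto simp: abs_mult intro!: mult_le_one)
  qed measurable
  have zero: "expectation (\<lambda>\<omega>. centred_indicator J (X i \<omega>) * centred_indicator J (X l \<omega>)) = 0" if "i \<noteq> l" for i l
    using expectation_indep_centred[OF indep, of i "{l}" "centred_indicator J" 1 "\<lambda>v. centred_indicator J (v l)"]
      that centred_indicator_bound expectation_centred_indicator by simp
  have one: "expectation (\<lambda>\<omega>. centred_indicator J (X i \<omega>) * centred_indicator J (X i \<omega>)) \<le> 1" for i
  proof -
    have "expectation (\<lambda>\<omega>. centred_indicator J (X i \<omega>) * centred_indicator J (X i \<omega>)) \<le> expectation (\<lambda>_. 1)"
      using centred_indicator_bound[of J]
      by (intro integral_mono int) (auto simp flip: power2_eq_square simp: abs_square_le_1)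
    then show ?thesis by (simp add: prob_space)
  qed
  have "expectation (\<lambda>\<omega>. (walk J (\<lambda>i. X i \<omega>))\<^sup>2) =
      expectation (\<lambda>\<omega>. \<Sum>i<n. \<Sum>l<n. centred_indicator J (X i \<omega>) * centred_indicator J (X l \<omega>))"
    by (simp add: walk_def power2_eq_square sum_product)
  also have "\<dots> = (\<Sum>i<n. \<Sum>l<n. expectation (\<lambda>\<omega>. centred_indicator J (X i \<omega>) * centred_indicator J (X l \<omega>)))"
    using int by (simp add: Bochner_Integration.integral_sum)
  also have "\<dots> = (\<Sum>i<n. expectation (\<lambda>\<omega>. centred_indicator J (X i \<omega>) * centred_indicator J (X i \<omega>)))"
  proof (intro sum.cong refl)
    fix i assume "i \<in> {..<n}"
    have "(\<Sum>l<n. expectation (\<lambda>\<omega>. centred_indicator J (X i \<omega>) * centred_indicator J (X l \<omega>))) =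
        (\<Sum>l<n. if l = i then expectation (\<lambda>\<omega>. centred_indicator J (X i \<omega>) * centred_indicator J (X i \<omega>)) else 0)"
      using zero by (intro sum.cong refl) auto
    also have "\<dots> = expectation (\<lambda>\<omega>. centred_indicator J (X i \<omega>) * centred_indicator J (X i \<omega>))"
      using \<open>i \<in> {..<n}\<close> by simp
    finally show "(\<Sum>l<n. expectation (\<lambda>\<omega>. centred_indicator J (X i \<omega>) * centred_indicator J (X l \<omega>))) =
      expectation (\<lambda>\<omega>. centred_indicator J (X i \<omega>) * centred_indicator J (X i \<omega>))" .
  qed
  also have "\<dots> \<le> (\<Sum>i<n. 1)" by (intro sum_mono one)
  finally show ?thesis by simp
qed

lemma increment_orthogonal:
  assumes j: "j \<le> J"
  shows "expectation (\<lambda>\<omega>. (walk J (\<lambda>i. X i \<omega>) - walk j (\<lambda>i. X i \<omega>)) *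
     (walk j (\<lambda>i. X i \<omega>) * of_bool (first_exit j (\<lambda>i. X i \<omega>)))) = 0"
proof -
  define \<psi> where "\<psi> x = centred_indicator J x - centred_indicator j x" for x
  define Y where "Y v = walk j v * of_bool (first_exit j v)" for v
  have [measurable]: "\<psi> \<in> borel_measurable borel" unfolding \<psi>_def by measurable
  have \<psi>2: "\<bar>\<psi> x\<bar> \<le> 2" for x
    using centred_indicator_bound[of J x] centred_indicator_bound[OF j, of x] unfolding \<psi>_def by linarith
  have Yn: "\<bar>Y v\<bar> \<le> n" for v using walk_bound[OF j, of v] by (auto simp: Y_def)
  have int: "integrable M (\<lambda>\<omega>. centred_indicator l (X i \<omega>))" if "l \<le> J" for l i
    by (rule integrable_const_bound[where B = 1]) (use centred_indicator_bound[OF that] in auto)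
  have centred: "expectation (\<lambda>\<omega>. \<psi> (X i \<omega>)) = 0" for i
    unfolding \<psi>_def using int[of J] int[OF j] expectation_centred_indicator[of J] expectation_centred_indicator[OF j]
    by simp
  obtain x0 where x0: "x0 \<notin> B J"
  proof -
    have "B J \<noteq> UNIV"
    proof
      assume "B J = UNIV"
      then have "P J = 1" using prob_B[of 0 J] prob_space by simp
      then show False using half by simp
    qed
    then show ?thesis using that by blast
  qed
  have summand: "expectation (\<lambda>\<omega>. \<psi> (X i \<omega>) * Y (\<lambda>l. X l \<omega>)) = 0" if i: "i < n" for i
  proof -
    define I where "I = {..<n} - {i}"
    \<comment> \<open>Coordinate \<open>i\<close> is replaced by a point outside \<open>B J\<close>.
      Where \<open>X i\<close> lies in \<open>B j\<close>, the factor \<psi> vanishes; elsewhere the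
      replacement does not change the walks up to \<open>j\<close>. Either way the product equals
      one of a function of \<open>X i\<close> and a function of the other coordinates.\<close>
    define u where "u v l = (if l = i then x0 else v l)" for v :: "nat \<Rightarrow> real" and l
    define g where "g v = Y (u v)" for v
    have u [measurable]: "(\<lambda>v. u v l) \<in> borel_measurable (PiM I (\<lambda>_. borel))" if "l < n" for l
      using that by (cases "l = i") (auto simp: u_def I_def)
    have walk_u [measurable]: "(\<lambda>v. walk q (u v)) \<in> borel_measurable (PiM I (\<lambda>_. borel))" for q
      unfolding walk_def by (intro borel_measurable_sum measurable_compose[OF u]) auto
    have g [measurable]: "g \<in> borel_measurable (PiM I (\<lambda>_. borel))"
      unfolding g_def Y_def first_exit_def by measurable
    have eq: "\<psi> (X i \<omega>) * Y (\<lambda>l. X l \<omega>) = \<psi> (X i \<omega>) * g (restrict (\<lambda>l. X l \<omega>) I)" for \<omega>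
    proof (cases "X i \<omega> \<in> B j")
      case True
      then have "X i \<omega> \<in> B J" using nested[OF j] by auto
      then have "\<psi> (X i \<omega>) = 0" using True P_bounds[of J] P_bounds[of j] j
        by (simp add: \<psi>_def centred_indicator_def)
      then show ?thesis by simp
    next
      case False
      have walk_eq: "walk q (u (restrict (\<lambda>l. X l \<omega>) I)) = walk q (\<lambda>l. X l \<omega>)" if q: "q \<le> j" for q
        unfolding walk_def
      proof (intro sum.cong refl)
        fix l assume l: "l \<in> {..<n}"
        have "X i \<omega> \<notin> B q" "x0 \<notin> B q" using False x0 nested[OF q j] nested[of q J] q j by auto
        then show "centred_indicator q (u (restrict (\<lambda>l. X l \<omega>) I) l) = centred_indicator q (X l \<omega>)"
          using l by (auto simp: u_def I_def centred_indicator_def)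
      qed
      have "g (restrict (\<lambda>l. X l \<omega>) I) = Y (\<lambda>l. X l \<omega>)"
        unfolding g_def Y_def first_exit_def by (simp add: walk_eq)
      then show ?thesis by simp
    qed
    show ?thesis unfolding eq
    proof (rule expectation_indep_centred[OF indep, where c = "max 2 (real n)"])
      show "i \<notin> I" by (simp add: I_def)
      show "\<bar>\<psi> x\<bar> \<le> max 2 (real n)" for x using \<psi>2[of x] by (simp add: le_max_iff_disj)
      show "\<bar>g v\<bar> \<le> max 2 (real n)" for v using Yn by (simp add: g_def le_max_iff_disj)
      show "\<psi> \<in> borel_measurable borel" by measurable
      show "g \<in> borel_measurable (PiM I (\<lambda>_. borel))" by (rule g)
      show "expectation (\<lambda>\<omega>. \<psi> (X i \<omega>)) = 0" by (rule centred)
    qed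
  qed
  have Ym [measurable]: "(\<lambda>\<omega>. Y (\<lambda>l. X l \<omega>)) \<in> borel_measurable M" unfolding Y_def by measurable
  have "integrable M (\<lambda>\<omega>. \<psi> (X i \<omega>) * Y (\<lambda>l. X l \<omega>))" for i
  proof (rule integrable_const_bound[where B = "2 * real n"])
    show "AE \<omega> in M. norm (\<psi> (X i \<omega>) * Y (\<lambda>l. X l \<omega>)) \<le> 2 * real n"
      using \<psi>2 Yn by (auto simp: abs_mult intro!: mult_mono)
  qed measurable
  then have "expectation (\<lambda>\<omega>. \<Sum>i<n. \<psi> (X i \<omega>) * Y (\<lambda>l. X l \<omega>)) = 0"
    using summand by (simp add: Bochner_Integration.integral_sum)
  moreover have "(walk J (\<lambda>i. X i \<omega>) - walk j (\<lambda>i. X i \<omega>)) * Y (\<lambda>l. X l \<omega>) =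
      (\<Sum>i<n. \<psi> (X i \<omega>) * Y (\<lambda>l. X l \<omega>))" for \<omega>
    by (simp add: walk_def \<psi>_def sum_subtractf sum_distrib_right[symmetric])
  ultimately show ?thesis by (simp add: Y_def)
qed

text \<open>The event is split by the first \<open>j\<close> at which the walk reaches \<rho> in
  absolute value. On each part the later increment is orthogonal to the walk at \<open>j\<close>, so
  the second moment of the last walk over this part is at least that of the walk at
  \<open>j\<close>, hence at least \<open>\<rho>^2\<close> times the probability of the part. The
  parts are disjoint, so together they are bounded by the whole second moment.\<close>

lemma maximal_inequality:
  "prob {\<omega> \<in> space M. \<exists>j\<le>J. \<rho> \<le> \<bar>real (card {i. i < n \<and> X i \<omega> \<in> B j}) - n * P j\<bar>} \<le> n / \<rho>\<^sup>2"
proof -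
  define W where "W j \<omega> = walk j (\<lambda>i. X i \<omega>)" for j \<omega>
  define e where "e j \<omega> = (of_bool (first_exit j (\<lambda>i. X i \<omega>)) :: real)" for j \<omega>
  have [measurable]: "W j \<in> borel_measurable M" "e j \<in> borel_measurable M" for j
    unfolding W_def[abs_def] e_def[abs_def] by measurable
  have bounds: "\<bar>W j \<omega>\<bar> \<le> n" "0 \<le> e j \<omega>" "e j \<omega> \<le> 1" "e j \<omega> * e j \<omega> = e j \<omega>" if "j \<le> J" for j \<omega>
    using walk_bound[OF that] by (auto simp: W_def e_def)
  have int: "integrable M (\<lambda>\<omega>. W i \<omega> * W j \<omega> * e l \<omega>)" if "i \<le> J" "j \<le> J" "l \<le> J" for i j l
  proof (rule integrable_const_bound[where B = "real n * real n * 1"])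
    show "AE \<omega> in M. norm (W i \<omega> * W j \<omega> * e l \<omega>) \<le> real n * real n * 1"
    proof (rule AE_I2)
      fix \<omega>
      have "\<bar>W i \<omega>\<bar> * \<bar>W j \<omega>\<bar> * \<bar>e l \<omega>\<bar> \<le> real n * real n * 1"
        using bounds(1)[OF that(1)] bounds(1)[OF that(2)] bounds(2,3)[OF that(3)]
        by (intro mult_mono) auto
      then show "norm (W i \<omega> * W j \<omega> * e l \<omega>) \<le> real n * real n * 1" by (simp add: abs_mult)
    qed
  qed measurable
  have inte: "integrable M (e l)" for l
    by (rule integrable_const_bound[where B = 1]) (auto simp: e_def)
  have exit: "\<rho>\<^sup>2 * expectation (e j) \<le> expectation (\<lambda>\<omega>. (W J \<omega>)\<^sup>2 * e j \<omega>)" if j: "j \<le> J" for j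
  proof -
    have "expectation (\<lambda>\<omega>. W J \<omega> * W j \<omega> * e j \<omega>) - expectation (\<lambda>\<omega>. W j \<omega> * W j \<omega> * e j \<omega>) = 0"
      using increment_orthogonal[OF j] int[of J j j] int[of j j j] j
      by (simp add: W_def e_def algebra_simps flip: Bochner_Integration.integral_diff)
    moreover have "0 \<le> expectation (\<lambda>\<omega>. (W J \<omega> - W j \<omega>)\<^sup>2 * e j \<omega>)"
      using bounds(2)[OF j] by (intro integral_nonneg_AE) auto
    moreover have "expectation (\<lambda>\<omega>. (W J \<omega> - W j \<omega>)\<^sup>2 * e j \<omega>) =
        expectation (\<lambda>\<omega>. W J \<omega> * W J \<omega> * e j \<omega> - 2 * (W J \<omega> * W j \<omega> * e j \<omega>) + W j \<omega> * W j \<omega> * e j \<omega>)"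
      by (intro Bochner_Integration.integral_cong refl) (simp add: power2_eq_square algebra_simps)
    moreover have "\<dots> = expectation (\<lambda>\<omega>. W J \<omega> * W J \<omega> * e j \<omega>) - 2 * expectation (\<lambda>\<omega>. W J \<omega> * W j \<omega> * e j \<omega>)
        + expectation (\<lambda>\<omega>. W j \<omega> * W j \<omega> * e j \<omega>)"
      using int[of J J j] int[of J j j] int[of j j j] j by simp
    ultimately have "expectation (\<lambda>\<omega>. W j \<omega> * W j \<omega> * e j \<omega>) \<le> expectation (\<lambda>\<omega>. W J \<omega> * W J \<omega> * e j \<omega>)"
      by linarith
    moreover have "expectation (\<lambda>\<omega>. \<rho>\<^sup>2 * e j \<omega>) \<le> expectation (\<lambda>\<omega>. W j \<omega> * W j \<omega> * e j \<omega>)"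
    proof (rule integral_mono)
      show "\<rho>\<^sup>2 * e j \<omega> \<le> W j \<omega> * W j \<omega> * e j \<omega>" for \<omega>
      proof (cases "first_exit j (\<lambda>i. X i \<omega>)")
        case True
        then have "\<rho> \<le> \<bar>W j \<omega>\<bar>" by (simp add: first_exit_def W_def)
        then have "\<rho>\<^sup>2 \<le> \<bar>W j \<omega>\<bar>\<^sup>2" using \<rho> by (intro power_mono) auto
        then show ?thesis using True by (simp add: e_def power2_eq_square)
      qed (simp add: e_def)
    qed (use inte int[of j j j] j in auto)
    ultimately show ?thesis by (simp add: power2_eq_square)
  qed
  have sum_e: "(\<Sum>j\<le>J. e j \<omega>) = of_bool (\<exists>j\<le>J. \<rho> \<le> \<bar>W j \<omega>\<bar>)" for \<omega>
  proof (cases "\<exists>j\<le>J. \<rho> \<le> \<bar>W j \<omega>\<bar>")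
    case True
    define j where "j = (LEAST j. \<rho> \<le> \<bar>W j \<omega>\<bar>)"
    obtain j' where j': "j' \<le> J" "\<rho> \<le> \<bar>W j' \<omega>\<bar>" using True by blast
    have j1: "\<rho> \<le> \<bar>W j \<omega>\<bar>" unfolding j_def by (rule LeastI) (rule j')
    have j2: "j \<le> J" using Least_le[of "\<lambda>j. \<rho> \<le> \<bar>W j \<omega>\<bar>" j'] j' unfolding j_def by simp
    have j3: "\<bar>W l \<omega>\<bar> < \<rho>" if "l < j" for l using not_less_Least[OF that[unfolded j_def]] by simp
    have "first_exit l (\<lambda>i. X i \<omega>) \<longleftrightarrow> l = j" for l
    proof
      assume l: "first_exit l (\<lambda>i. X i \<omega>)"
      show "l = j"
      proof (rule linorder_cases[of l j])
        assume "l < j" then show ?thesis using j3[of l] l by (simp add: first_exit_def W_def)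
      next
        assume "j < l" then show ?thesis using j1 l by (force simp: first_exit_def W_def)
      qed
    qed (use j1 j3 in \<open>simp add: first_exit_def W_def\<close>)
    then have "(\<Sum>j\<le>J. e j \<omega>) = (\<Sum>l\<le>J. if l = j then 1 else 0)"
      by (intro sum.cong) (auto simp: e_def)
    then show ?thesis using True j2 by simp
  next
    case False
    then have "\<not> first_exit j (\<lambda>i. X i \<omega>)" if "j \<le> J" for j using that by (auto simp: first_exit_def W_def)
    then show ?thesis using False by (simp add: e_def)
  qed
  have "{\<omega> \<in> space M. \<exists>j\<le>J. \<rho> \<le> \<bar>real (card {i. i < n \<and> X i \<omega> \<in> B j}) - n * P j\<bar>} \<subseteq>
      {\<omega> \<in> space M. \<exists>j\<le>J. \<rho> \<le> \<bar>W j \<omega>\<bar>}" (is "_ \<subseteq> ?E")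
  proof safe
    fix \<omega> j assume j: "j \<le> J" and large: "\<rho> \<le> \<bar>real (card {i. i < n \<and> X i \<omega> \<in> B j}) - n * P j\<bar>"
    have "real (card {i. i < n \<and> X i \<omega> \<in> B j}) = (\<Sum>i<n. indicator (B j) (X i \<omega>))"
      by (simp add: indicator_def of_bool_def[symmetric] sum.If_cases Int_def conj_commute)
    \<comment> \<open>Undoing the normalisation multiplies by \<open>1 - P j \<le> 1\<close>, so the
      deviation of the count is at most that of the walk.\<close>
    then have "real (card {i. i < n \<and> X i \<omega> \<in> B j}) - n * P j = (1 - P j) * W j \<omega>"
      using P_bounds[of j] j
      by (simp add: W_def walk_def centred_indicator_def sum_divide_distrib[symmetric] sum_subtractf)
    then have "\<rho> \<le> (1 - P j) * \<bar>W j \<omega>\<bar>" using large P_bounds[of j] j by (simp add: abs_mult)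
    also have "\<dots> \<le> 1 * \<bar>W j \<omega>\<bar>" using P_bounds(1)[of j] by (intro mult_right_mono) auto
    finally show "\<exists>j\<le>J. \<rho> \<le> \<bar>W j \<omega>\<bar>" using j by auto
  qed
  then have "prob {\<omega> \<in> space M. \<exists>j\<le>J. \<rho> \<le> \<bar>real (card {i. i < n \<and> X i \<omega> \<in> B j}) - n * P j\<bar>} \<le> prob ?E"
    by (intro finite_measure_mono) auto
  also have "prob ?E = expectation (\<lambda>\<omega>. \<Sum>j\<le>J. e j \<omega>)"
  proof -
    have "prob ?E = expectation (indicator ?E)" by simp
    also have "\<dots> = expectation (\<lambda>\<omega>. \<Sum>j\<le>J. e j \<omega>)"
      unfolding sum_e by (intro Bochner_Integration.integral_cong) (auto simp: indicator_def)
    finally show ?thesis .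
  qed
  also have "\<dots> = (\<Sum>j\<le>J. expectation (e j))" using inte by simp
  finally have "\<rho>\<^sup>2 * prob {\<omega> \<in> space M. \<exists>j\<le>J. \<rho> \<le> \<bar>real (card {i. i < n \<and> X i \<omega> \<in> B j}) - n * P j\<bar>}
      \<le> \<rho>\<^sup>2 * (\<Sum>j\<le>J. expectation (e j))" by (intro mult_left_mono) auto
  also have "\<dots> \<le> (\<Sum>j\<le>J. expectation (\<lambda>\<omega>. (W J \<omega>)\<^sup>2 * e j \<omega>))"
    unfolding sum_distrib_left using exit by (intro sum_mono) auto
  also have "\<dots> = expectation (\<lambda>\<omega>. \<Sum>j\<le>J. (W J \<omega>)\<^sup>2 * e j \<omega>)"
    using int[of J J] by (subst Bochner_Integration.integral_sum) (auto simp: power2_eq_square)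
  also have "\<dots> \<le> expectation (\<lambda>\<omega>. (W J \<omega>)\<^sup>2)"
  proof (rule integral_mono)
    show "integrable M (\<lambda>\<omega>. (W J \<omega>)\<^sup>2)"
    proof (rule integrable_const_bound[where B = "real n * real n"])
      show "AE \<omega> in M. norm ((W J \<omega>)\<^sup>2) \<le> real n * real n"
      proof (rule AE_I2)
        fix \<omega>
        have "\<bar>W J \<omega>\<bar> * \<bar>W J \<omega>\<bar> \<le> real n * real n" using bounds(1)[of J \<omega>] by (intro mult_mono) auto
        then show "norm ((W J \<omega>)\<^sup>2) \<le> real n * real n" by (simp add: power2_eq_square abs_mult)
      qed
    qed measurable
    show "(\<Sum>j\<le>J. (W J \<omega>)\<^sup>2 * e j \<omega>) \<le> (W J \<omega>)\<^sup>2" for \<omega>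
      unfolding sum_distrib_left[symmetric] sum_e by simp
  qed (use int[of J J] in \<open>auto simp: power2_eq_square\<close>)
  also have "\<dots> \<le> n" using walk_second_moment by (simp add: W_def)
  finally show ?thesis using \<rho> by (simp add: field_simps)
qed

end

text \<open>Deviations are controlled on the quantiles of levels \<open>j / (2 * n)\<close>. The
  maximal inequality requires sets of probability at most 1/2, so the lower half of this grid is
  treated by left rays and the upper half by right rays. Each half fails with probability at most
  \<open>n / r^2 = 4 / D^2\<close>, which explains the 8.\<close>

lemma emp_cdf_close_prob:
  fixes X :: "nat \<Rightarrow> 'a \<Rightarrow> real" and \<mu> :: "real measure"
  assumes indep: "indep_vars (\<lambda>_. borel) X UNIV"
    and \<mu>: "real_distribution \<mu>" and cont: "\<And>x. isCont (cdf \<mu>) x"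
    and prob_X: "\<And>i A. A \<in> sets borel \<Longrightarrow> prob {\<omega> \<in> space M. X i \<omega> \<in> A} = measure \<mu> A"
    and n: "0 < n" and D: "1 \<le> D"
  shows "\<exists>A\<in>events. 1 - 8 / D\<^sup>2 \<le> prob A \<and>
    (\<forall>\<omega>\<in>A. \<forall>y. \<bar>emp_cdf n (\<lambda>i. X i \<omega>) y - cdf \<mu> y\<bar> \<le> D / sqrt n)"
proof -
  have [measurable]: "X i \<in> borel_measurable M" for i
    using indep unfolding indep_vars_def by blast
  interpret \<mu>: real_distribution \<mu> by fact
  let ?F = "cdf \<mu>"
  \<comment> \<open>By continuity and the limits at both infinities, every level strictly between 0
    and 1 is attained.\<close>
  have "\<exists>x. ?F x = real j / real (2 * n)" if j: "j \<in> {1..<2 * n}" for j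
  proof -
    have j01: "0 < real j / real (2 * n)" "real j / real (2 * n) < 1" using j by auto
    obtain a where a: "?F a < real j / real (2 * n)"
      using order_tendstoD(2)[OF \<mu>.cdf_lim_at_bot j01(1)] by (auto simp: eventually_at_bot_linorder)
    obtain b where b: "real j / real (2 * n) < ?F b"
      using order_tendstoD(1)[OF \<mu>.cdf_lim_at_top_prob j01(2)] by (auto simp: eventually_at_top_linorder)
    have "a \<le> b"
    proof (rule ccontr)
      assume "\<not> a \<le> b"
      then have "?F b \<le> ?F a" by (intro \<mu>.cdf_nondecreasing) simp
      then show False using a b by simp
    qed
    moreover have "continuous_on {a..b} ?F" using cont by (intro continuous_at_imp_continuous_on) blast
    ultimately show ?thesis using IVT'[of ?F a "real j / real (2 * n)" b] a b by force
  qed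
  then obtain q where q: "\<And>j. j \<in> {1..<2 * n} \<Longrightarrow> ?F (q j) = real j / real (2 * n)" by metis
  have qmono: "q i \<le> q j" if "i \<in> {1..<2 * n}" "j \<in> {1..<2 * n}" "i \<le> j" for i j
  proof (rule ccontr)
    assume less: "\<not> q i \<le> q j"
    then have "i \<noteq> j" by auto
    have "?F (q j) \<le> ?F (q i)" using less by (intro \<mu>.cdf_nondecreasing) simp
    then show False using q[OF that(1)] q[OF that(2)] that \<open>i \<noteq> j\<close> n by (simp add: divide_le_cancel)
  qed
  define r where "r = D * sqrt n / 2"
  have r: "0 < r" using n D by (simp add: r_def)
  define L where "L j = (if j = 0 then {} else {..q j})" for j
  \<comment> \<open>Right rays are indexed from the top of the grid, so that they increase with
    \<open>j\<close>.\<close>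
  define U where "U j = (if j = 0 then {} else {q (2 * n - j)<..})" for j
  define bad where "bad B = {\<omega> \<in> space M. \<exists>j\<le>n. r \<le> \<bar>real (card {i. i < n \<and> X i \<omega> \<in> B j}) - n * measure \<mu> (B j)\<bar>}"
    for B :: "nat \<Rightarrow> real set"
  have mL: "measure \<mu> (L j) = real j / real (2 * n)" if "j \<le> n" for j
    using q[of j] that n by (auto simp: L_def cdf_def)
  have mU: "measure \<mu> (U j) = real j / real (2 * n)" if "j \<le> n" for j
  proof (cases "j = 0")
    case False
    have "measure \<mu> (UNIV - {..q (2 * n - j)}) = 1 - ?F (q (2 * n - j))"
      using \<mu>.prob_compl[of "{..q (2 * n - j)}"] by (simp add: cdf_def)
    also have "UNIV - {..q (2 * n - j)} = U j" using False by (auto simp: U_def)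
    also have "1 - ?F (q (2 * n - j)) = real j / real (2 * n)"
      using q[of "2 * n - j"] False that n by (simp add: of_nat_diff field_simps)
    finally show ?thesis .
  qed (simp add: U_def)
  have badL: "prob (bad L) \<le> n / r\<^sup>2"
    unfolding bad_def
  proof (rule maximal_inequality[OF indep])
    show "L i \<subseteq> L j" if "i \<le> j" "j \<le> n" for i j
      using qmono[of i j] that n by (auto simp: L_def)
    show "measure \<mu> (L n) \<le> 1 / 2" using mL[of n] n by simp
  qed (use r prob_X in \<open>auto simp: L_def\<close>)
  have badU: "prob (bad U) \<le> n / r\<^sup>2"
    unfolding bad_def
  proof (rule maximal_inequality[OF indep])
    show "U i \<subseteq> U j" if "i \<le> j" "j \<le> n" for i j
      using qmono[of "2 * n - j" "2 * n - i"] that n by (auto simp: U_def)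
    show "measure \<mu> (U n) \<le> 1 / 2" using mU[of n] n by simp
  qed (use r prob_X in \<open>auto simp: U_def\<close>)
  have bad [measurable]: "bad B \<in> events" if [measurable]: "\<And>j. B j \<in> sets borel" for B
    unfolding bad_def by measurable
  have [measurable]: "bad L \<in> events" "bad U \<in> events"
    by (rule bad, simp add: L_def, rule bad, simp add: U_def)
  define A where "A = space M - (bad L \<union> bad U)"
  have "prob (bad L \<union> bad U) \<le> prob (bad L) + prob (bad U)"
    by (intro measure_Un_le) measurable
  also have "\<dots> \<le> 2 * (n / r\<^sup>2)" using badL badU by simp
  also have "\<dots> = 8 / D\<^sup>2"
    using n D by (simp add: r_def power_mult_distrib power_divide field_simps)
  finally have "1 - 8 / D\<^sup>2 \<le> prob A"
    unfolding A_def by (subst prob_compl) auto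
  moreover have "\<bar>emp_cdf n (\<lambda>i. X i \<omega>) y - ?F y\<bar> \<le> D / sqrt n" if \<omega>: "\<omega> \<in> A" for \<omega> y
  proof -
    define N where "N v = real (card {i. i < n \<and> X i \<omega> \<le> v})" for v
    have Nmono: "N v \<le> N w" if "v \<le> w" for v w
      unfolding N_def using that by (intro of_nat_mono card_mono) auto
    have N01: "0 \<le> N v" "N v \<le> n" for v
    proof -
      have "card {i. i < n \<and> X i \<omega> \<le> v} \<le> card {..<n}" by (intro card_mono) auto
      then show "0 \<le> N v" "N v \<le> n" by (simp_all add: N_def)
    qed
    have grid: "\<bar>N (q j) - real j / 2\<bar> < r" if j: "j \<in> {1..<2 * n}" for j
    proof (cases "j \<le> n")
      case True
      have "\<not> r \<le> \<bar>real (card {i. i < n \<and> X i \<omega> \<in> L j}) - n * measure \<mu> (L j)\<bar>"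
        using \<omega> True unfolding A_def bad_def by blast
      then show ?thesis using mL[OF True] j n by (simp add: N_def L_def)
    next
      case False
      define j' where "j' = 2 * n - j"
      have j': "j' \<le> n" "j' \<noteq> 0" "2 * n - j' = j" using False j by (auto simp: j'_def)
      have "\<not> r \<le> \<bar>real (card {i. i < n \<and> X i \<omega> \<in> U j'}) - n * measure \<mu> (U j')\<bar>"
        using \<omega> j'(1) unfolding A_def bad_def by blast
      moreover have "real (card {i. i < n \<and> X i \<omega> \<in> U j'}) = n - N (q j)"
      proof -
        have "{i. i < n \<and> X i \<omega> \<in> U j'} = {..<n} - {i. i < n \<and> X i \<omega> \<le> q j}"
          using j' by (auto simp: U_def)
        also have "card \<dots> = n - card {i. i < n \<and> X i \<omega> \<le> q j}"
          by (subst card_Diff_subset) auto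
        finally show ?thesis using N01(2)[of "q j"] by (simp add: N_def of_nat_diff)
      qed
      moreover have "n * measure \<mu> (U j') = n - real j / 2"
        using mU[OF j'(1)] n j False by (simp add: j'_def of_nat_diff field_simps)
      ultimately show ?thesis by (simp add: abs_minus_commute)
    qed
    \<comment> \<open>The last grid index not beyond \<open>y\<close> is wanted, with 0 if there is
      none; the grid points \<open>j\<close> and \<open>Suc j\<close> then enclose
      \<open>y\<close>.\<close>
    define T where "T = insert 0 {j \<in> {1..<2 * n}. q j \<le> y}"
    define j where "j = Max T"
    have "finite T" by (simp add: T_def)
    have jT: "j \<in> T" unfolding j_def using \<open>finite T\<close> by (intro Max_in) (auto simp: T_def)
    have F01: "0 \<le> ?F y" "?F y \<le> 1" using \<mu>.cdf_nonneg \<mu>.cdf_bounded_prob by auto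
    have lower: "real j / 2 - r \<le> N y" "real j / 2 \<le> n * ?F y"
    proof -
      have "real j / 2 - r \<le> N y \<and> real j / 2 \<le> n * ?F y"
      proof (cases "j = 0")
        case True
        then show ?thesis using N01[of y] r F01 by simp
      next
        case False
        then have j: "j \<in> {1..<2 * n}" "q j \<le> y" using jT by (auto simp: T_def)
        have "real j / real (2 * n) \<le> ?F y" using \<mu>.cdf_nondecreasing[OF j(2)] q[OF j(1)] by simp
        then have "real j / 2 \<le> n * ?F y" using n by (simp add: field_simps)
        then show ?thesis using grid[OF j(1)] Nmono[OF j(2)] by linarith
      qed
      then show "real j / 2 - r \<le> N y" "real j / 2 \<le> n * ?F y" by auto
    qed
    have upper: "N y \<le> real (Suc j) / 2 + r" "n * ?F y \<le> real (Suc j) / 2"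
    proof -
      have "N y \<le> real (Suc j) / 2 + r \<and> n * ?F y \<le> real (Suc j) / 2"
      proof (cases "Suc j < 2 * n")
        case False
        then have "real n \<le> real (Suc j) / 2" by simp
        moreover have "real n * ?F y \<le> real n * 1" using F01 by (intro mult_left_mono) auto
        ultimately show ?thesis using N01[of y] r by linarith
      next
        case True
        then have j: "Suc j \<in> {1..<2 * n}" by simp
        have "\<not> q (Suc j) \<le> y"
        proof
          assume "q (Suc j) \<le> y"
          then have "Suc j \<in> T" using j by (simp add: T_def)
          then have "Suc j \<le> j" unfolding j_def using \<open>finite T\<close> by (intro Max_ge)
          then show False by simp
        qed
        then have le: "y \<le> q (Suc j)" by simp
        have "?F y \<le> real (Suc j) / real (2 * n)" using \<mu>.cdf_nondecreasing[OF le] q[OF j] by simp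
        then have "n * ?F y \<le> real (Suc j) / 2" using n by (simp add: field_simps)
        then show ?thesis using grid[OF j] Nmono[OF le] by linarith
      qed
      then show "N y \<le> real (Suc j) / 2 + r" "n * ?F y \<le> real (Suc j) / 2" by auto
    qed
    \<comment> \<open>Between adjacent grid points the expected counts differ by 1/2. As
      \<open>1 \<le> D * sqrt n\<close>, this is at most half of \<open>D * sqrt n\<close>, and
      \<open>r\<close> was chosen as the other half.\<close>
    have "real (Suc j) / 2 = real j / 2 + 1 / 2" by simp
    then have "\<bar>N y - n * ?F y\<bar> \<le> 1 / 2 + r" using lower upper by linarith
    also have "1 \<le> D * sqrt n" using mult_mono[of 1 D 1 "sqrt n"] D n by simp
    then have "1 / 2 + r \<le> D * sqrt n" by (simp add: r_def)
    finally have "\<bar>N y - n * ?F y\<bar> / n \<le> D * sqrt n / n" by (intro divide_right_mono) auto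
    moreover have "\<bar>N y - n * ?F y\<bar> / n = \<bar>N y / n - ?F y\<bar>"
    proof -
      have "N y / n - ?F y = (N y - n * ?F y) / n" using n by (simp add: diff_divide_distrib)
      then show ?thesis by simp
    qed
    moreover have "D * sqrt n / n = D / sqrt n"
    proof -
      have "D * sqrt n / n = D * sqrt n / (sqrt n * sqrt n)" by simp
      also have "\<dots> = D / sqrt n" using n by (simp del: real_sqrt_mult_self)
      finally show ?thesis .
    qed
    ultimately show ?thesis by (simp add: emp_cdf_def N_def)
  qed
  ultimately show ?thesis by (intro bexI[of _ A]) (auto simp: A_def)
qed

end

section \<open>Measurability\<close>

text \<open>A countable family of admissible heights that is dense among them and depends measurably
  on the gates. Clipping to the unit interval keeps the heights within the gates for every list,
  even at positions beyond its length.\<close>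

definition rational_polygon :: "nat \<Rightarrow> (nat \<Rightarrow> real) \<Rightarrow> (nat \<Rightarrow> real) \<Rightarrow> rat list \<Rightarrow> nat \<Rightarrow> real" where
  "rational_polygon m lo hi qs j = (if j \<le> m then lo j + max 0 (min 1 (of_rat (qs ! j))) * (hi j - lo j) else 0)"

lemma through_gates_rational_polygon:
  assumes "\<And>j. j \<le> m \<Longrightarrow> lo j \<le> hi j"
  shows "through_gates m lo hi (rational_polygon m lo hi qs)"
  unfolding through_gates_def
proof (intro conjI allI impI)
  fix j assume j: "j \<le> m"
  have "0 \<le> max 0 (min 1 (of_rat (qs ! j))) * (hi j - lo j)"
    using assms[OF j] by (intro mult_nonneg_nonneg) auto
  then show "lo j \<le> rational_polygon m lo hi qs j" using j by (simp add: rational_polygon_def)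
  have "max 0 (min 1 (of_rat (qs ! j))) * (hi j - lo j) \<le> 1 * (hi j - lo j)"
    using assms[OF j] by (intro mult_right_mono) auto
  then show "rational_polygon m lo hi qs j \<le> hi j" using j by (simp add: rational_polygon_def)
qed (simp add: rational_polygon_def)

lemma rational_polygon_approx:
  assumes y: "through_gates m lo hi y" and "0 < e"
  shows "\<exists>qs. polygon_length m z (rational_polygon m lo hi qs) \<le> polygon_length m z y + e"
proof -
  define d where "d = e / (2 * real (Suc m))"
  have d: "0 < d" using \<open>0 < e\<close> by (simp add: d_def)
  have "\<exists>q. \<bar>lo j + max 0 (min 1 (of_rat q)) * (hi j - lo j) - y j\<bar> \<le> d" if j: "j \<le> m" for j
  proof -
    have yj: "lo j \<le> y j" "y j \<le> hi j" using y j by (auto simp: through_gates_def)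
    define s where "s = (if hi j = lo j then 0 else (y j - lo j) / (hi j - lo j))"
    have s: "0 \<le> s" "s \<le> 1" "y j = lo j + s * (hi j - lo j)" using yj by (auto simp: s_def)
    \<comment> \<open>The 1 added to the width of the gate keeps the tolerance positive when the
      gate is a single point.\<close>
    have "s < s + d / (hi j - lo j + 1)" using d yj by simp
    then obtain q where q: "s < of_rat q" "of_rat q < s + d / (hi j - lo j + 1)"
      using of_rat_dense by blast
    have clip: "max 0 (min 1 v) - s \<le> e \<and> 0 \<le> max 0 (min 1 v) - s" if "s < v" "v < s + e" for v e :: real
      using that s by (auto simp: max_def min_def)
    have "max 0 (min 1 (of_rat q)) - s \<le> d / (hi j - lo j + 1)" "0 \<le> max 0 (min 1 (of_rat q)) - s"
      using clip[OF q] by auto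
    then have "0 \<le> (max 0 (min 1 (of_rat q)) - s) * (hi j - lo j)"
      using yj by (intro mult_nonneg_nonneg) auto
    moreover have "(max 0 (min 1 (of_rat q)) - s) * (hi j - lo j) \<le> d / (hi j - lo j + 1) * (hi j - lo j + 1)"
      using yj d clip[OF q] by (intro mult_mono) auto
    moreover have "d / (hi j - lo j + 1) * (hi j - lo j + 1) = d" using yj by simp
    moreover have "lo j + max 0 (min 1 (of_rat q)) * (hi j - lo j) - y j = (max 0 (min 1 (of_rat q)) - s) * (hi j - lo j)"
      unfolding s(3) by (simp add: algebra_simps)
    ultimately have "\<bar>lo j + max 0 (min 1 (of_rat q)) * (hi j - lo j) - y j\<bar> \<le> d" by linarith
    then show ?thesis by blast
  qed
  then obtain q where q: "\<And>j. j \<le> m \<Longrightarrow> \<bar>lo j + max 0 (min 1 (of_rat (q j))) * (hi j - lo j) - y j\<bar> \<le> d"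
    by metis
  define qs where "qs = map q [0..<Suc m]"
  have "qs ! j = q j" if "j \<le> m" for j
    unfolding qs_def using that by (subst nth_map) (simp_all del: upt_Suc)
  then have close: "\<bar>rational_polygon m lo hi qs j - y j\<bar> \<le> d" if "j \<le> m" for j
    using q[OF that] that by (simp add: rational_polygon_def)
  have "\<bar>polygon_length m z (rational_polygon m lo hi qs) - polygon_length m z y\<bar> \<le>
      2 * (\<Sum>j\<le>m. \<bar>rational_polygon m lo hi qs j - y j\<bar>)"
    by (rule polygon_length_lipschitz)
  also have "\<dots> \<le> 2 * (\<Sum>j\<le>m. d)" using close by (intro mult_left_mono sum_mono) auto
  also have "\<dots> = e" by (simp add: d_def field_simps)
  finally show ?thesis by (intro exI[of _ qs]) linarith
qed

text \<open>The minimal length written as a countable infimum, which makes it measurable in the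
  knots and the gates.\<close>

definition taut_length :: "nat \<Rightarrow> (nat \<Rightarrow> real) \<Rightarrow> (nat \<Rightarrow> real) \<Rightarrow> (nat \<Rightarrow> real) \<Rightarrow> real" where
  "taut_length m z lo hi = (INF qs. polygon_length m z (rational_polygon m lo hi qs))"

lemma polygon_length_nonneg: "0 \<le> polygon_length m z y"
  by (simp add: polygon_length_def sum_nonneg)

lemma bdd_below_polygon_length: "bdd_below (range (\<lambda>qs. polygon_length m z (g qs)))"
  by (intro bdd_belowI2[where m = 0] polygon_length_nonneg)

lemma taut_length_eq:
  assumes "\<And>j. j \<le> m \<Longrightarrow> lo j \<le> hi j" and y: "taut_polygon m z lo hi y"
  shows "taut_length m z lo hi = polygon_length m z y"
proof (rule antisym)
  show "polygon_length m z y \<le> taut_length m z lo hi"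
    unfolding taut_length_def
    using taut_polygonD(4)[OF y through_gates_rational_polygon[OF assms(1)]]
    by (intro cINF_greatest) auto
  show "taut_length m z lo hi \<le> polygon_length m z y"
  proof (rule field_le_epsilon)
    fix e :: real assume "0 < e"
    from rational_polygon_approx[OF taut_polygonD(3)[OF y] this, of z] obtain qs
      where "polygon_length m z (rational_polygon m lo hi qs) \<le> polygon_length m z y + e" by blast
    then show "taut_length m z lo hi \<le> polygon_length m z y + e"
      unfolding taut_length_def
      by (intro cINF_lower2[OF bdd_below_polygon_length, of qs]) auto
  qed
qed

text \<open>Lowering the upper gate at \<open>j\<close> to \<open>c\<close> keeps the minimal length
  exactly if the minimiser already passes at or below \<open>c\<close>: otherwise the minimiser for
  the lowered gate would be a second one for the original gates. In this way sublevel sets of a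
  single height are expressed through minimal lengths.\<close>

lemma taut_polygon_level:
  assumes z: "strict_mono_on {..m} z" and start: "lo 0 = hi 0"
    and le: "\<And>j. j \<le> m \<Longrightarrow> lo j \<le> hi j" and y: "taut_polygon m z lo hi y" and j: "j \<le> m"
  shows "y j \<le> c \<longleftrightarrow> lo j \<le> c \<and> taut_length m z lo (hi(j := min (hi j) c)) \<le> taut_length m z lo hi"
proof
  assume yc: "y j \<le> c"
  then have c: "lo j \<le> c" using taut_polygonD(1)[OF y j] by simp
  have le': "lo i \<le> (hi(j := min (hi j) c)) i" if "i \<le> m" for i using le[OF that] c by auto
  obtain y' where y': "taut_polygon m z lo (hi(j := min (hi j) c)) y'"
    by (rule taut_polygon_exists[of m lo "hi(j := min (hi j) c)"]) (rule le')
  have tl: "taut_length m z lo (hi(j := min (hi j) c)) = polygon_length m z y'"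
    by (rule taut_length_eq[OF _ y']) (rule le')
  have tl': "taut_length m z lo hi = polygon_length m z y"
    by (rule taut_length_eq[OF _ y]) (rule le)
  have "through_gates m lo (hi(j := min (hi j) c)) y"
    using taut_polygonD(3)[OF y] yc by (auto simp: through_gates_def)
  with y' have "polygon_length m z y' \<le> polygon_length m z y" by (rule taut_polygonD(4))
  then show "lo j \<le> c \<and> taut_length m z lo (hi(j := min (hi j) c)) \<le> taut_length m z lo hi"
    using c unfolding tl tl' by blast
next
  assume c: "lo j \<le> c \<and> taut_length m z lo (hi(j := min (hi j) c)) \<le> taut_length m z lo hi"
  have le': "lo i \<le> (hi(j := min (hi j) c)) i" if "i \<le> m" for i using le[OF that] c by auto
  obtain y' where y': "taut_polygon m z lo (hi(j := min (hi j) c)) y'"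
    by (rule taut_polygon_exists[of m lo "hi(j := min (hi j) c)"]) (rule le')
  have tl: "taut_length m z lo (hi(j := min (hi j) c)) = polygon_length m z y'"
    by (rule taut_length_eq[OF _ y']) (rule le')
  have tl': "taut_length m z lo hi = polygon_length m z y"
    by (rule taut_length_eq[OF _ y]) (rule le)
  have gates: "through_gates m lo hi y'"
    using taut_polygonD(3)[OF y'] unfolding through_gates_def by (auto split: if_splits)
  have "polygon_length m z y' \<le> polygon_length m z y"
    using c unfolding tl tl' by blast
  then have "taut_polygon m z lo hi y'"
    using y gates unfolding taut_polygon_def by (meson order_trans)
  then have "y = y'" by (rule taut_polygon_unique[OF z start y])
  then show "y j \<le> c" using taut_polygonD(2)[OF y' j] by simp
qed

section \<open>The event in terms of index blocks\<close>

definition block_mid :: "(nat \<Rightarrow> real) \<Rightarrow> nat \<times> nat \<Rightarrow> real" where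
  "block_mid z p = (z (fst p - 1) + z (snd p)) / 2"

definition good_blocks :: "nat \<Rightarrow> (nat \<Rightarrow> real) \<Rightarrow> (nat \<Rightarrow> real) \<Rightarrow> nat \<Rightarrow> (nat \<Rightarrow> real) \<Rightarrow> real \<Rightarrow> bool" where
  "good_blocks m z w k t \<delta> \<longleftrightarrow> card (extreme_blocks m w) = k \<and>
     (\<forall>p\<in>extreme_blocks m w. z (snd p) - z (fst p - 1) \<le> \<delta> \<and>
        \<bar>block_mid z p - t (card {q\<in>extreme_blocks m w. block_mid z q \<le> block_mid z p})\<bar> \<le> \<delta>)"

context
  fixes m :: nat and z :: "nat \<Rightarrow> real"
  assumes z: "strict_mono_on {..m} z" and m: "1 \<le> m"
begin

lemma block_geometry:
  assumes "p \<in> extreme_blocks m w"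
  shows "midpoint_of (block m z p) = block_mid z p" "interval_length (block m z p) = z (snd p) - z (fst p - 1)"
    "block_mid z p \<in> block m z p"
proof -
  obtain a b where p: "p = (a, b)" by (cases p)
  note D = extreme_blocksD[OF assms[unfolded p]]
  note IS = Inf_Sup_block[OF z D]
  show "midpoint_of (block m z p) = block_mid z p" "interval_length (block m z p) = z (snd p) - z (fst p - 1)"
    by (simp_all add: p midpoint_of_def interval_length_def block_mid_def IS)
  have "z (a - 1) < z b" using D by (intro knots_less[OF z]) auto
  then have "block_mid z p \<in> {z (a - 1)<..z b}" by (simp add: block_mid_def p)
  then show "block_mid z p \<in> block m z p" using block_bounds(1)[OF z D] unfolding p by blast
qed

text \<open>The midpoint of a block lies in the block and extreme intervals are disjoint, so equal
  midpoints force equal blocks; a block in turn determines its indices through its end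
  points.\<close>

lemma inj_on_block_mid: "inj_on (block m z) (extreme_blocks m w)" "inj_on (block_mid z) (extreme_blocks m w)"
proof -
  have eq: "p = q" if pq: "p \<in> extreme_blocks m w" "q \<in> extreme_blocks m w" "block m z p = block m z q" for p q
  proof -
    obtain a b c d where p: "p = (a, b)" "q = (c, d)" by (cases p, cases q)
    note D = extreme_blocksD[OF pq(1)[unfolded p]] extreme_blocksD[OF pq(2)[unfolded p]]
    have zz: "z (a - 1) = z (c - 1)" "z b = z d"
      using Inf_Sup_block[OF z D(1-3)] Inf_Sup_block[OF z D(4-6)] pq(3) unfolding p by metis+
    have "a - 1 \<le> m" "c - 1 \<le> m" using D by auto
    then have "a - 1 = c - 1" using zz(1) D knots_less[OF z, of "a - 1" "c - 1"] knots_less[OF z, of "c - 1" "a - 1"]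
      by (cases "a - 1" "c - 1" rule: linorder_cases) auto
    moreover have "b = d" using zz(2) D knots_less[OF z, of b d] knots_less[OF z, of d b]
      by (cases b d rule: linorder_cases) auto
    ultimately show ?thesis using D by (simp add: p)
  qed
  then show "inj_on (block m z) (extreme_blocks m w)" by (rule inj_onI)
  show "inj_on (block_mid z) (extreme_blocks m w)"
  proof (rule inj_onI)
    fix p q assume pq: "p \<in> extreme_blocks m w" "q \<in> extreme_blocks m w" "block_mid z p = block_mid z q"
    have "block m z p \<in> local_extreme_intervals (step_fun m z w)" "block m z q \<in> local_extreme_intervals (step_fun m z w)"
      using pq by (auto simp: local_extreme_intervals_step_fun[OF z m])
    then have "block m z p = block m z q"
      using local_extreme_intervals_disjoint block_geometry(3)[OF pq(1)] block_geometry(3)[OF pq(2)] pq(3) by metis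
    then show "p = q" using eq pq by blast
  qed
qed

text \<open>Intervals are replaced by index pairs from a finite range, and their lengths and
  midpoints by expressions in the knots; what remains are combinations of inequalities between
  random variables.\<close>

lemma good_extremes_iff_good_blocks:
  fixes w
  defines "h \<equiv> step_fun m z w"
  shows "(card (local_extreme_intervals h) = k \<and>
     (\<forall>i\<in>{1..card (local_extreme_intervals h)}. interval_length (nth_extreme_interval h i) \<le> \<delta>) \<and>
     (\<forall>i\<in>{1..card (local_extreme_intervals h)}. \<bar>midpoint_of (nth_extreme_interval h i) - t i\<bar> \<le> \<delta>)) \<longleftrightarrow>
     good_blocks m z w k t \<delta>"
proof -
  let ?A = "extreme_blocks m w"
  have E: "local_extreme_intervals h = block m z ` ?A"
    unfolding h_def by (rule local_extreme_intervals_step_fun[OF z m])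
  have fin: "finite (local_extreme_intervals h)"
    unfolding E by (intro finite_imageI finite_extreme_blocks)
  have inj: "inj_on midpoint_of (local_extreme_intervals h)"
    unfolding E
  proof (rule inj_onI)
    fix I J assume "I \<in> block m z ` ?A" "J \<in> block m z ` ?A" and eq: "midpoint_of I = midpoint_of J"
    then obtain p q where pq: "p \<in> ?A" "q \<in> ?A" "I = block m z p" "J = block m z q" by blast
    then have "block_mid z p = block_mid z q" using eq block_geometry(1) by simp
    then show "I = J" using inj_onD[OF inj_on_block_mid(2) _ pq(1,2)] pq by simp
  qed
  have rank: "card {J \<in> local_extreme_intervals h. midpoint_of J \<le> midpoint_of (block m z p)} =
      card {q \<in> ?A. block_mid z q \<le> block_mid z p}" if p: "p \<in> ?A" for p
  proof -
    have "{J \<in> local_extreme_intervals h. midpoint_of J \<le> midpoint_of (block m z p)} =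
        block m z ` {q \<in> ?A. block_mid z q \<le> block_mid z p}"
      unfolding E using block_geometry(1) p by auto
    moreover have "inj_on (block m z) {q \<in> ?A. block_mid z q \<le> block_mid z p}"
      by (rule inj_on_subset[OF inj_on_block_mid(1)[of w]]) auto
    ultimately show ?thesis by (simp add: card_image)
  qed
  have "card (local_extreme_intervals h) = card ?A"
    unfolding E by (rule card_image[OF inj_on_block_mid(1)])
  moreover have "(\<forall>i\<in>{1..card (local_extreme_intervals h)}. interval_length (nth_extreme_interval h i) \<le> \<delta>) \<longleftrightarrow>
      (\<forall>p\<in>?A. z (snd p) - z (fst p - 1) \<le> \<delta>)"
  proof -
    have "(\<forall>i\<in>{1..card (local_extreme_intervals h)}. interval_length (nth_extreme_interval h i) \<le> \<delta>) \<longleftrightarrow>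
      (\<forall>I\<in>local_extreme_intervals h. interval_length I \<le> \<delta>)"
      by (rule all_nth_extreme_interval[OF fin inj, where Q = "\<lambda>I i. interval_length I \<le> \<delta>"])
    also have "\<dots> \<longleftrightarrow> (\<forall>p\<in>?A. z (snd p) - z (fst p - 1) \<le> \<delta>)"
      unfolding E using block_geometry(2) by simp
    finally show ?thesis .
  qed
  moreover have "(\<forall>i\<in>{1..card (local_extreme_intervals h)}. \<bar>midpoint_of (nth_extreme_interval h i) - t i\<bar> \<le> \<delta>) \<longleftrightarrow>
      (\<forall>p\<in>?A. \<bar>block_mid z p - t (card {q\<in>?A. block_mid z q \<le> block_mid z p})\<bar> \<le> \<delta>)"
  proof -
    have "(\<forall>i\<in>{1..card (local_extreme_intervals h)}. \<bar>midpoint_of (nth_extreme_interval h i) - t i\<bar> \<le> \<delta>) \<longleftrightarrow>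
      (\<forall>I\<in>local_extreme_intervals h. \<bar>midpoint_of I -
        t (card {J \<in> local_extreme_intervals h. midpoint_of J \<le> midpoint_of I})\<bar> \<le> \<delta>)"
      by (rule all_nth_extreme_interval[OF fin inj, where Q = "\<lambda>I i. \<bar>midpoint_of I - t i\<bar> \<le> \<delta>"])
    also have "\<dots> \<longleftrightarrow> (\<forall>p\<in>?A. \<bar>midpoint_of (block m z p) -
        t (card {J \<in> local_extreme_intervals h. midpoint_of J \<le> midpoint_of (block m z p)})\<bar> \<le> \<delta>)"
      by (subst (1) E) simp
    also have "\<dots> \<longleftrightarrow> (\<forall>p\<in>?A. \<bar>block_mid z p - t (card {q\<in>?A. block_mid z q \<le> block_mid z p})\<bar> \<le> \<delta>)"
      using rank block_geometry(1) by simp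
    finally show ?thesis .
  qed
  ultimately show ?thesis unfolding good_blocks_def by auto
qed

end

text \<open>Coding pairs by natural numbers reduces the cardinality of a random set of pairs to that
  of a random set of naturals.\<close>

lemma measurable_card_pairs [measurable]:
  fixes S :: "'a \<Rightarrow> (nat \<times> nat) set"
  assumes [measurable]: "\<And>p. Measurable.pred M (\<lambda>x. p \<in> S x)"
  shows "(\<lambda>x. card (S x)) \<in> measurable M (count_space UNIV)"
proof -
  have "card (S x) = card {i. prod_decode i \<in> S x}" for x
    using card_vimage_inj[of prod_decode "S x"] by (simp add: vimage_def inj_prod_decode surj_prod_decode)
  moreover have "(\<lambda>x. card {i. prod_decode i \<in> S x}) \<in> measurable M (count_space UNIV)"
    by measurable
  ultimately show ?thesis by simp
qed

lemma good_blocks_measurable: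
  assumes z [measurable]: "\<And>j. j \<le> m \<Longrightarrow> (\<lambda>\<omega>. z \<omega> j) \<in> borel_measurable M"
    and w [measurable]: "\<And>j. (\<lambda>\<omega>. w \<omega> j) \<in> borel_measurable M"
  shows "Measurable.pred M (\<lambda>\<omega>. good_blocks m (z \<omega>) (w \<omega>) k t \<delta>)"
proof -
  \<comment> \<open>Measurability of the knots is known for indices up to \<open>m\<close>; the
    extension by 0 is measurable at every index and agrees with them on all indices that occur in
    blocks.\<close>
  define z' where "z' \<omega> j = (if j \<le> m then z \<omega> j else 0)" for \<omega> j
  have [measurable]: "(\<lambda>\<omega>. z' \<omega> j) \<in> borel_measurable M" for j
    unfolding z'_def by (cases "j \<le> m") auto
  have mem [measurable]: "Measurable.pred M (\<lambda>\<omega>. p \<in> extreme_blocks m (w \<omega>))" for p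
    unfolding extreme_blocks_def max_blocks_def by (cases p) (simp, measurable)
  have mid [measurable]: "(\<lambda>\<omega>. block_mid (z' \<omega>) p) \<in> borel_measurable M" for p
    unfolding block_mid_def by measurable
  have rank: "(\<lambda>\<omega>. card {q\<in>extreme_blocks m (w \<omega>). block_mid (z' \<omega>) q \<le> block_mid (z' \<omega>) p}) \<in>
      measurable M (count_space UNIV)" for p
    by (rule measurable_card_pairs) simp
  have [measurable]: "(\<lambda>\<omega>. t (card {q\<in>extreme_blocks m (w \<omega>). block_mid (z' \<omega>) q \<le> block_mid (z' \<omega>) p}))
      \<in> borel_measurable M" for p
    by (rule measurable_compose[OF rank]) simp
  have [measurable]: "(\<lambda>\<omega>. card (extreme_blocks m (w \<omega>))) \<in> measurable M (count_space UNIV)"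
    by (rule measurable_card_pairs) measurable
  have "good_blocks m (z \<omega>) (w \<omega>) k t \<delta> = good_blocks m (z' \<omega>) (w \<omega>) k t \<delta>" for \<omega>
  proof -
    have "fst p - 1 \<le> m" "snd p \<le> m" if "p \<in> extreme_blocks m (w \<omega>)" for p
      using extreme_blocksD[of "fst p" "snd p" m "w \<omega>"] that by auto
    then have zz: "z' \<omega> (fst p - 1) = z \<omega> (fst p - 1)" "z' \<omega> (snd p) = z \<omega> (snd p)"
      if "p \<in> extreme_blocks m (w \<omega>)" for p using that by (simp_all add: z'_def)
    have mid: "block_mid (z' \<omega>) p = block_mid (z \<omega>) p" if "p \<in> extreme_blocks m (w \<omega>)" for p
      using zz[OF that] by (simp add: block_mid_def)
    have "{q\<in>extreme_blocks m (w \<omega>). block_mid (z' \<omega>) q \<le> block_mid (z' \<omega>) p} =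
        {q\<in>extreme_blocks m (w \<omega>). block_mid (z \<omega>) q \<le> block_mid (z \<omega>) p}"
      if "p \<in> extreme_blocks m (w \<omega>)" for p using mid that by auto
    then show ?thesis unfolding good_blocks_def using zz mid by simp
  qed
  moreover have "Measurable.pred M (\<lambda>\<omega>. good_blocks m (z' \<omega>) (w \<omega>) k t \<delta>)"
    unfolding good_blocks_def Ball_def by measurable
  ultimately show ?thesis by simp
qed

lemma gates_open_lo_le_hi:
  assumes "gates_open n x m z \<epsilon>" "j \<le> m"
  shows "gate_lo n x m z \<epsilon> j \<le> gate_hi n x m z \<epsilon> j"
  using assms by (cases "j = 0"; cases "j = m") (auto simp: gates_open_def gate_lo_def gate_hi_def)

lemma taut_length_measurable:
  assumes [measurable]: "\<And>j. (\<lambda>\<omega>. z \<omega> j) \<in> borel_measurable M"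
    "\<And>j. (\<lambda>\<omega>. lo \<omega> j) \<in> borel_measurable M" "\<And>j. (\<lambda>\<omega>. hi \<omega> j) \<in> borel_measurable M"
  shows "(\<lambda>\<omega>. taut_length m (z \<omega>) (lo \<omega>) (hi \<omega>)) \<in> borel_measurable M"
proof -
  have [measurable]: "(\<lambda>\<omega>. rational_polygon m (lo \<omega>) (hi \<omega>) qs j) \<in> borel_measurable M" for qs j
    unfolding rational_polygon_def by (cases "j \<le> m") simp_all
  have "(\<lambda>\<omega>. polygon_length m (z \<omega>) (rational_polygon m (lo \<omega>) (hi \<omega>) qs)) \<in> borel_measurable M" for qs
    unfolding polygon_length_def norm_Pair by measurable
  then show ?thesis
    unfolding taut_length_def
    by (intro borel_measurable_cINF bdd_below_polygon_length) auto
qed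

section \<open>The string on a cell\<close>

context
  fixes M :: "'a measure" and X :: "nat \<Rightarrow> 'a \<Rightarrow> real" and n m :: nat and r :: "nat \<Rightarrow> nat" and \<epsilon> :: real
  assumes X [measurable]: "\<And>i. X i \<in> borel_measurable M"
begin

definition knots_at :: "'a \<Rightarrow> nat \<Rightarrow> real" where
  "knots_at \<omega> j = X (r j) \<omega>"

definition in_cell :: "'a \<Rightarrow> bool" where
  "in_cell \<omega> \<longleftrightarrow> (\<forall>i j. i < j \<and> j \<le> m \<longrightarrow> knots_at \<omega> i < knots_at \<omega> j) \<and>
     (\<forall>i\<in>{..<n}. \<exists>j\<in>{..m}. X i \<omega> = knots_at \<omega> j) \<and>
     gates_open n (\<lambda>i. X i \<omega>) m (knots_at \<omega>) \<epsilon>"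

definition lo_at :: "'a \<Rightarrow> nat \<Rightarrow> real" where
  "lo_at \<omega> = gate_lo n (\<lambda>i. X i \<omega>) m (knots_at \<omega>) \<epsilon>"

definition hi_at :: "'a \<Rightarrow> nat \<Rightarrow> real" where
  "hi_at \<omega> = gate_hi n (\<lambda>i. X i \<omega>) m (knots_at \<omega>) \<epsilon>"

text \<open>Set to 0 off the cell, so that the heights are functions on the whole space; by
  \<open>taut_polygon_unique\<close> the description is meaningful on the cell.\<close>

definition taut_at :: "'a \<Rightarrow> nat \<Rightarrow> real" where
  "taut_at \<omega> j = (if in_cell \<omega> \<and> j \<le> m
     then (THE y. taut_polygon m (knots_at \<omega>) (lo_at \<omega>) (hi_at \<omega>) y) j else 0)"

lemma knots_at_measurable [measurable]: "(\<lambda>\<omega>. knots_at \<omega> j) \<in> borel_measurable M"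
  unfolding knots_at_def by measurable

lemma emp_cdf_measurable [measurable]:
  "(\<lambda>\<omega>. emp_cdf n (\<lambda>i. X i \<omega>) (knots_at \<omega> j)) \<in> borel_measurable M"
  unfolding emp_cdf_def by measurable

lemma in_cell_measurable [measurable]: "Measurable.pred M in_cell"
  unfolding in_cell_def[abs_def] gates_open_def by measurable

lemma gates_measurable [measurable]:
  "(\<lambda>\<omega>. lo_at \<omega> j) \<in> borel_measurable M" "(\<lambda>\<omega>. hi_at \<omega> j) \<in> borel_measurable M"
  unfolding lo_at_def hi_at_def gate_lo_def gate_hi_def by measurable

lemma in_cellD:
  assumes "in_cell \<omega>"
  shows "strict_mono_on {..m} (knots_at \<omega>)" "gates_open n (\<lambda>i. X i \<omega>) m (knots_at \<omega>) \<epsilon>" "lo_at \<omega> 0 = hi_at \<omega> 0"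
    "j \<le> m \<Longrightarrow> lo_at \<omega> j \<le> hi_at \<omega> j"
  using assms gates_open_lo_le_hi[of n "\<lambda>i. X i \<omega>" m "knots_at \<omega>" \<epsilon> j]
  by (auto simp: in_cell_def strict_mono_on_def lo_at_def hi_at_def gate_lo_def gate_hi_def)

lemma taut_polygon_taut_at:
  assumes "in_cell \<omega>"
  shows "taut_polygon m (knots_at \<omega>) (lo_at \<omega>) (hi_at \<omega>) (taut_at \<omega>)"
proof -
  note c = in_cellD[OF assms]
  obtain y where y: "taut_polygon m (knots_at \<omega>) (lo_at \<omega>) (hi_at \<omega>) y"
    using c(4) by (rule taut_polygon_exists)
  have "(THE y. taut_polygon m (knots_at \<omega>) (lo_at \<omega>) (hi_at \<omega>) y) = y"
    using y taut_polygon_unique[OF c(1,3) _ y] by blast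
  then have "taut_at \<omega> = y"
    using assms taut_polygonD(3)[OF y] by (auto simp: taut_at_def through_gates_def fun_eq_iff)
  then show ?thesis using y by simp
qed

lemma taut_at_measurable [measurable]: "(\<lambda>\<omega>. taut_at \<omega> j) \<in> borel_measurable M"
proof (cases "j \<le> m")
  case False
  then show ?thesis by (simp add: taut_at_def)
next
  case True
  have level: "taut_at \<omega> j \<le> c \<longleftrightarrow> in_cell \<omega> \<and> lo_at \<omega> j \<le> c \<and>
      taut_length m (knots_at \<omega>) (lo_at \<omega>) ((hi_at \<omega>)(j := min (hi_at \<omega> j) c)) \<le>
      taut_length m (knots_at \<omega>) (lo_at \<omega>) (hi_at \<omega>) \<or> \<not> in_cell \<omega> \<and> 0 \<le> c" for \<omega> c
  proof (cases "in_cell \<omega>")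
    case cell: True
    note c = in_cellD[OF cell]
    show ?thesis
      using taut_polygon_level[OF c(1,3) c(4) taut_polygon_taut_at[OF cell] True, of c] cell by simp
  qed (simp add: taut_at_def)
  have [measurable]: "(\<lambda>\<omega>. taut_length m (knots_at \<omega>) (lo_at \<omega>) (hi_at \<omega>)) \<in> borel_measurable M"
    by (rule taut_length_measurable) measurable
  have [measurable]: "(\<lambda>\<omega>. taut_length m (knots_at \<omega>) (lo_at \<omega>) ((hi_at \<omega>)(j := min (hi_at \<omega> j) c))) \<in> borel_measurable M" for c
    by (rule taut_length_measurable) (simp_all add: fun_upd_def)
  show ?thesis
    unfolding borel_measurable_iff_le
  proof
    fix c
    have "Measurable.pred M (\<lambda>\<omega>. in_cell \<omega> \<and> lo_at \<omega> j \<le> c \<and>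
      taut_length m (knots_at \<omega>) (lo_at \<omega>) ((hi_at \<omega>)(j := min (hi_at \<omega> j) c)) \<le>
      taut_length m (knots_at \<omega>) (lo_at \<omega>) (hi_at \<omega>) \<or> \<not> in_cell \<omega> \<and> 0 \<le> c)"
      by measurable
    then show "{\<omega> \<in> space M. taut_at \<omega> j \<le> c} \<in> sets M" unfolding level by (rule predE)
  qed
qed

lemma slope_at_measurable:
  "(\<lambda>\<omega>. slope_seq m (knots_at \<omega>) (taut_at \<omega>) j) \<in> borel_measurable M"
  unfolding slope_seq_def by (cases "1 \<le> j \<and> j \<le> m") simp_all

end

text \<open>
  The cells \<open>(m, r)\<close> fix which sample points are the knots.  On a cell the taut string is a measurable
  function of the sample, because its values are determined by minimal lengths; if no cell
  contains the sample point, there is no string.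
\<close>

lemma extremes_event_sets:
  fixes X :: "nat \<Rightarrow> 'a \<Rightarrow> real"
  assumes X: "\<And>i. X i \<in> borel_measurable M" and n: "0 < n" and C: "0 < C" and k: "k \<noteq> 0"
  shows "{\<omega> \<in> space M. num_extremes C n (\<lambda>j. X j \<omega>) = k \<and>
      (\<forall>i\<in>{1..num_extremes C n (\<lambda>j. X j \<omega>)}. interval_length (extreme_interval C n (\<lambda>j. X j \<omega>) i) \<le> \<delta>) \<and>
      (\<forall>i\<in>{1..num_extremes C n (\<lambda>j. X j \<omega>)}. \<bar>extreme_midpoint C n (\<lambda>j. X j \<omega>) i - t i\<bar> \<le> \<delta>)} \<in> sets M"
proof -
  define E where "E \<omega> \<longleftrightarrow> num_extremes C n (\<lambda>j. X j \<omega>) = k \<and>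
      (\<forall>i\<in>{1..num_extremes C n (\<lambda>j. X j \<omega>)}. interval_length (extreme_interval C n (\<lambda>j. X j \<omega>) i) \<le> \<delta>) \<and>
      (\<forall>i\<in>{1..num_extremes C n (\<lambda>j. X j \<omega>)}. \<bar>extreme_midpoint C n (\<lambda>j. X j \<omega>) i - t i\<bar> \<le> \<delta>)" for \<omega>
  define \<epsilon> where "\<epsilon> = C / sqrt (real n)"
  have eps: "0 < \<epsilon>" using n C by (simp add: \<epsilon>_def)
  define R where "R m = PiE {..m} (\<lambda>_. {..<n})" for m :: nat
  define good where "good m r \<omega> \<longleftrightarrow> in_cell X n m r \<epsilon> \<omega> \<and>
      good_blocks m (knots_at X r \<omega>) (slope_seq m (knots_at X r \<omega>) (taut_at X n m r \<epsilon> \<omega>)) k t \<delta>" for m r \<omega>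
  have knots: "sample_knots n (\<lambda>i. X i \<omega>) m (knots_at X r \<omega>)" if "r \<in> R m" "in_cell X n m r \<epsilon> \<omega>" for m r \<omega>
  proof -
    have "knots_at X r \<omega> ` {..m} \<subseteq> (\<lambda>i. X i \<omega>) ` {..<n}"
      using that(1) by (auto simp: R_def knots_at_def[OF X] PiE_iff)
    moreover have "(\<lambda>i. X i \<omega>) ` {..<n} \<subseteq> knots_at X r \<omega> ` {..m}"
      using that(2) by (auto simp: in_cell_def[OF X])
    ultimately show ?thesis
      using in_cellD(1)[OF X that(2)] by (auto simp: sample_knots_def)
  qed
  have good_E: "E \<omega> \<longleftrightarrow> good m r \<omega>" if r: "r \<in> R m" and cell: "in_cell X n m r \<epsilon> \<omega>" for m r \<omega>
  proof -
    note c = in_cellD[OF X cell]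
    note kn = knots[OF r cell]
    have m: "1 \<le> m" using c(2) by (simp add: gates_open_def)
    have "string_deriv C n (\<lambda>i. X i \<omega>) = step_fun m (knots_at X r \<omega>) (slope_seq m (knots_at X r \<omega>) (taut_at X n m r \<epsilon> \<omega>))"
      using string_deriv_step_fun[OF n kn, of C] eps c(2) taut_polygon_taut_at[OF X cell]
      unfolding lo_at_def[OF X] hi_at_def[OF X] \<epsilon>_def by blast
    then show ?thesis
      using good_extremes_iff_good_blocks[OF c(1) m] cell
      unfolding E_def good_def num_extremes_def extreme_interval_def extreme_midpoint_def by simp
  qed
  have E_cell: "\<exists>m\<in>{..<n}. \<exists>r\<in>R m. in_cell X n m r \<epsilon> \<omega>" if E: "E \<omega>" for \<omega>
  proof -
    obtain m z where kn: "sample_knots n (\<lambda>i. X i \<omega>) m z" using sample_knots_exist[OF n] .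
    \<comment> \<open>With closed gates there is no string, and the derivative is 0 and has no
      extremes, contrary to \<open>k \<noteq> 0\<close>.\<close>
    have open_gates: "gates_open n (\<lambda>i. X i \<omega>) m z \<epsilon>"
    proof (rule ccontr)
      assume "\<not> gates_open n (\<lambda>i. X i \<omega>) m z \<epsilon>"
      then have "string_deriv C n (\<lambda>i. X i \<omega>) = (\<lambda>_. 0)"
        using string_deriv_zero[OF n kn, of C] eps unfolding \<epsilon>_def by simp
      then have "num_extremes C n (\<lambda>j. X j \<omega>) = 0"
        by (simp add: num_extremes_def local_extreme_intervals_const_fun)
      then show False using E k by (simp add: E_def)
    qed
    have sm: "strict_mono_on {..m} z" and img: "z ` {..m} = (\<lambda>i. X i \<omega>) ` {..<n}"
      using kn by (auto simp: sample_knots_def)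
    \<comment> \<open>There are at most \<open>n\<close> distinct observations, so finitely many
      cells cover the event.\<close>
    have "Suc m = card (z ` {..m})" using card_image[OF strict_mono_on_imp_inj_on[OF sm]] by simp
    also have "\<dots> \<le> n" unfolding img using card_image_le[of "{..<n}"] by simp
    finally have "m < n" by simp
    have "\<forall>j\<in>{..m}. \<exists>i<n. z j = X i \<omega>" using img by blast
    then obtain r' where r': "\<And>j. j \<le> m \<Longrightarrow> r' j < n \<and> z j = X (r' j) \<omega>" by (metis atMost_iff)
    define r where "r = restrict r' {..m}"
    have r: "r \<in> R m" using r' by (auto simp: R_def r_def)
    have zr: "knots_at X r \<omega> j = z j" if "j \<le> m" for j
      using r'[OF that] that by (simp add: knots_at_def[OF X] r_def)
    have "gates_open n (\<lambda>i. X i \<omega>) m (knots_at X r \<omega>) \<epsilon>"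
    proof -
      have "knots_at X r \<omega> (j - 1) = z (j - 1)" if "j \<in> {1..<m}" for j using that by (intro zr) auto
      then show ?thesis using open_gates unfolding gates_open_def by (auto simp: zr)
    qed
    moreover have "knots_at X r \<omega> i < knots_at X r \<omega> j" if "i < j" "j \<le> m" for i j
      using knots_less[OF sm that] zr that by simp
    moreover have "\<exists>j\<in>{..m}. X i \<omega> = knots_at X r \<omega> j" if "i < n" for i
    proof -
      have "X i \<omega> \<in> z ` {..m}" using img that by auto
      then show ?thesis using zr by auto
    qed
    ultimately have "in_cell X n m r \<epsilon> \<omega>" by (auto simp: in_cell_def[OF X])
    then show ?thesis using \<open>m < n\<close> r by blast
  qed
  have "{\<omega> \<in> space M. E \<omega>} = (\<Union>m\<in>{..<n}. \<Union>r\<in>R m. {\<omega> \<in> space M. good m r \<omega>})"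
  proof (intro equalityI subsetI)
    fix \<omega> assume "\<omega> \<in> {\<omega> \<in> space M. E \<omega>}"
    then show "\<omega> \<in> (\<Union>m\<in>{..<n}. \<Union>r\<in>R m. {\<omega> \<in> space M. good m r \<omega>})"
      using E_cell[of \<omega>] good_E[of _ _ \<omega>] by blast
  next
    fix \<omega> assume "\<omega> \<in> (\<Union>m\<in>{..<n}. \<Union>r\<in>R m. {\<omega> \<in> space M. good m r \<omega>})"
    then obtain m r where "\<omega> \<in> space M" "r \<in> R m" "good m r \<omega>" by blast
    then show "\<omega> \<in> {\<omega> \<in> space M. E \<omega>}"
      using good_E[of r m \<omega>] by (auto simp: good_def)
  qed
  also have "\<dots> \<in> sets M"
  proof (intro sets.finite_UN)
    show "finite (R m)" for m unfolding R_def by (intro finite_PiE) auto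
    fix m and r :: "nat \<Rightarrow> nat"
    have [measurable]: "Measurable.pred M (in_cell X n m r \<epsilon>)" by (rule in_cell_measurable[OF X])
    have [measurable]: "Measurable.pred M (\<lambda>\<omega>. good_blocks m (knots_at X r \<omega>)
        (slope_seq m (knots_at X r \<omega>) (taut_at X n m r \<epsilon> \<omega>)) k t \<delta>)"
      by (intro good_blocks_measurable knots_at_measurable[OF X] slope_at_measurable[OF X])
    show "{\<omega> \<in> space M. good m r \<omega>} \<in> sets M" unfolding good_def by measurable
  qed simp
  finally show ?thesis by (simp add: E_def)
qed

text \<open>A density is positive somewhere and takes smaller values on both sides of such a point,
  so it is not monotone. For \<open>k = 0\<close> the event would also include the samples that have
  no string.\<close>

lemma has_local_extremes_at_pos:
  assumes f: "is_density f" and ext: "has_local_extremes_at f k t"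
  shows "k \<noteq> 0"
proof
  assume "k = 0"
  then have E: "local_extreme_intervals f = {}" using ext by (simp add: has_local_extremes_at_def)
  have "\<exists>v. 0 < f v"
  proof (rule ccontr)
    assume "\<nexists>v. 0 < f v"
    then have "f v = 0" for v using is_density_nonneg[OF f, of v] by (meson antisym not_less)
    then have "f = (\<lambda>_. 0)" by blast
    then show False using f unfolding is_density_def by simp
  qed
  then obtain v where v: "0 < f v" ..
  obtain a where a: "a < v" "f a < f v" using density_small_left[OF f v, of v] by blast
  obtain b where b: "v < b" "f b < f v" using density_small_right[OF f v, of v] by blast
  note ab = a b
  have "mono_on {a..b} f \<or> antimono_on {a..b} f"
    using monotone_off_extremesD[OF regular_extremesD(1)[OF has_local_extremes_atD(1)[OF ext]]] E by blast
  then show False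
    using mono_on_IccD[of a b f v b] antimono_on_IccD[of a b f a v] ab by force
qed

theorem theorem4p1:
  fixes M :: "'a measure" and X :: "nat \<Rightarrow> 'a \<Rightarrow> real"
    and f :: "real \<Rightarrow> real" and k :: nat and t :: "nat \<Rightarrow> real" and \<delta> :: real
  assumes "prob_space M"
    and "is_density f"
    and "has_local_extremes_at f k t"
    and "0 < (INF G \<in> {G. \<exists>g. is_density g \<and> G = density_cdf g \<and> fewer_local_extremes_than g k}.
                SUP x. ereal \<bar>density_cdf f x - G x\<bar>)"
    and "prob_space.indep_vars M (\<lambda>_. borel) X UNIV"
    and "\<And>i. distributed M lborel (X i) (\<lambda>x. ennreal (f x))"
    and "\<delta> > 0"
  shows "((\<lambda>C::real. liminf (\<lambda>n. ereal (measure M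
            {\<omega> \<in> space M.
               num_extremes C n (\<lambda>j. X j \<omega>) = k \<and>
               (\<forall>i\<in>{1..num_extremes C n (\<lambda>j. X j \<omega>)}.
                  interval_length (extreme_interval C n (\<lambda>j. X j \<omega>) i) \<le> \<delta>) \<and>
               (\<forall>i\<in>{1..num_extremes C n (\<lambda>j. X j \<omega>)}.
                  \<bar>extreme_midpoint C n (\<lambda>j. X j \<omega>) i - t i\<bar> \<le> \<delta>)})))
          \<longlongrightarrow> 1) at_top"
proof -
  interpret prob_space M by fact
  let ?good = "\<lambda>C n \<omega>. num_extremes C n (\<lambda>j. X j \<omega>) = k \<and>
               (\<forall>i\<in>{1..num_extremes C n (\<lambda>j. X j \<omega>)}.
                  interval_length (extreme_interval C n (\<lambda>j. X j \<omega>) i) \<le> \<delta>) \<and>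
               (\<forall>i\<in>{1..num_extremes C n (\<lambda>j. X j \<omega>)}.
                  \<bar>extreme_midpoint C n (\<lambda>j. X j \<omega>) i - t i\<bar> \<le> \<delta>)"
  have X: "X i \<in> borel_measurable M" for i
    using distributed_measurable[OF assms(6)[of i]] by simp
  let ?\<mu> = "density lborel (\<lambda>x. ennreal (f x))"
  have prob_X: "prob {\<omega> \<in> space M. X i \<omega> \<in> A} = measure ?\<mu> A" if "A \<in> sets borel" for i A
  proof -
    have "measure ?\<mu> A = measure (distr M lborel (X i)) A"
      by (simp add: distributed_distr_eq_density[OF assms(6)])
    also have "\<dots> = prob (X i -` A \<inter> space M)"
      using X that by (intro measure_distr) auto
    also have "X i -` A \<inter> space M = {\<omega> \<in> space M. X i \<omega> \<in> A}" by auto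
    finally show ?thesis by simp
  qed
  \<comment> \<open>\<open>emp_cdf_close_prob\<close> is applied with \<open>D = C / 2\<close>,
    which is at least 1 for \<open>2 \<le> C\<close> and turns \<open>8 / D^2\<close> into
    \<open>32 / C^2\<close>.\<close>
  have bound: "ereal (1 - 32 / C\<^sup>2) \<le> liminf (\<lambda>n. ereal (prob {\<omega> \<in> space M. ?good C n \<omega>}))"
    if C: "2 \<le> C" for C
  proof (rule Liminf_bounded)
    have "\<forall>\<^sub>F n in sequentially. 0 < n" by (rule eventually_gt_at_top)
    moreover have "\<forall>\<^sub>F n in sequentially. \<forall>x. (\<forall>y. \<bar>emp_cdf n x y - density_cdf f y\<bar> \<le> (C / 2) / sqrt (real n)) \<longrightarrow>
       num_extremes C n x = k \<and>
       (\<forall>i\<in>{1..num_extremes C n x}. interval_length (extreme_interval C n x i) \<le> \<delta>) \<and>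
       (\<forall>i\<in>{1..num_extremes C n x}. \<bar>extreme_midpoint C n x i - t i\<bar> \<le> \<delta>)"
      using C by (intro eventually_good_extremes[OF assms(2,3,7)]) auto
    ultimately show "\<forall>\<^sub>F n in sequentially. ereal (1 - 32 / C\<^sup>2) \<le> ereal (prob {\<omega> \<in> space M. ?good C n \<omega>})"
    proof eventually_elim
      case (elim n)
      have "\<exists>A\<in>events. 1 - 8 / (C / 2)\<^sup>2 \<le> prob A \<and>
          (\<forall>\<omega>\<in>A. \<forall>y. \<bar>emp_cdf n (\<lambda>i. X i \<omega>) y - cdf ?\<mu> y\<bar> \<le> (C / 2) / sqrt n)"
        using C elim(1) isCont_density_cdf[OF assms(2)] unfolding density_cdf_def
        by (intro emp_cdf_close_prob[OF assms(5) real_distribution_density[OF assms(2)]] prob_X) auto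
      then obtain A where A: "A \<in> events" "1 - 8 / (C / 2)\<^sup>2 \<le> prob A"
        "\<And>\<omega> y. \<omega> \<in> A \<Longrightarrow> \<bar>emp_cdf n (\<lambda>i. X i \<omega>) y - density_cdf f y\<bar> \<le> (C / 2) / sqrt n"
        unfolding density_cdf_def by blast
      have "A \<subseteq> {\<omega> \<in> space M. ?good C n \<omega>}"
        using A(3) elim(2) sets.sets_into_space[OF A(1)] by blast
      moreover have "{\<omega> \<in> space M. ?good C n \<omega>} \<in> events"
        using C by (intro extremes_event_sets X elim has_local_extremes_at_pos[OF assms(2,3)]) auto
      ultimately have "prob A \<le> prob {\<omega> \<in> space M. ?good C n \<omega>}" by (rule finite_measure_mono)
      then show ?case using A(2) by (simp add: power_divide)
    qed
  qed
  have upper: "liminf (\<lambda>n. ereal (prob {\<omega> \<in> space M. ?good C n \<omega>})) \<le> 1" for C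
  proof -
    have "liminf (\<lambda>n. ereal (prob {\<omega> \<in> space M. ?good C n \<omega>})) \<le> liminf (\<lambda>n. 1)"
      by (intro Liminf_mono always_eventually) (auto simp: prob_le_1)
    then show ?thesis by (simp add: Liminf_const)
  qed
  show ?thesis
  proof (rule tendsto_sandwich)
    show "\<forall>\<^sub>F C in at_top. ereal (1 - 32 / C\<^sup>2) \<le> liminf (\<lambda>n. ereal (prob {\<omega> \<in> space M. ?good C n \<omega>}))"
      using eventually_ge_at_top[of "2::real"] by eventually_elim (rule bound)
    show "\<forall>\<^sub>F C in at_top. liminf (\<lambda>n. ereal (prob {\<omega> \<in> space M. ?good C n \<omega>})) \<le> 1"
      using upper by (intro always_eventually) blast
    have "((\<lambda>C::real. 32 / C\<^sup>2) \<longlongrightarrow> 0) at_top"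
      by (intro tendsto_divide_0[OF tendsto_const] filterlim_at_top_imp_at_infinity
          filterlim_pow_at_top filterlim_ident) simp
    from tendsto_diff[OF tendsto_const[of 1] this]
    show "((\<lambda>C::real. ereal (1 - 32 / C\<^sup>2)) \<longlongrightarrow> 1) at_top"
      by (simp add: one_ereal_def)
  qed simp
qed

end
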